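(* Let $\rho_1(r)$ and $\rho_2(r)$ be two proximate orders for positive orders $\rho_1>0$ and $\rho_2>0$ respectively, satisfying $r^{\rho_1(r)}=O(r^{\rho_2(r)})$ as $r\to\infty$. (1) Suppose that $P=\sum_{\mathbf m\in\mathbb N_0^n}u_{\mathbf m}(\mathbf x)\odot_L\partial_{\mathbf x}^{\mathbf m}\in\mathbf D_{\rho_1\to\rho_2,0}$. For a left monogenic entire function $f\in A_{\rho_1,+0}$, the series $$Pf=\sum_{\mathbf m\in\mathbb N_0^n}u_{\mathbf m}(\mathbf x)\odot_L\partial_{\mathbf x}^{\mathbf m}f$$ converges and $Pf\in A_{\rho_2,+0}$. Moreover, $f\mapsto Pf$ defines a continuous homomorphism $P:A_{\rho_1,+0}\to A_{\rho_2,+0}$. (2) Let $F:A_{\rho_1,+0}\to A_{\rho_2,+0}$ be a continuous right linear homomorphism. Then there is a unique $P\in\mathbf D_{\rho_1\to\rho_2,0}$ such that $Ff=Pf$ holds for any $f\in A_{\rho_1,+0}$.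
   Context: Clifford algebra and monogenic functions: $\mathbb R_n$ is the real Clifford algebra over imaginary units $e_1,\dots,e_n$ with $e_i^2=-1$, $e_ie_j+e_je_i=0$ ($i\ne j$); for $y=\sum_A y_Ae_A$ put $\|y\|^2=\sum_A y_A^2$. Points $(x_0,\dots,x_n)\in\mathbb R^{n+1}$ are identified with paravectors $\mathbf x=x_0+\sum_{j=1}^n x_je_j$. An entire left monogenic function is $f\in C^1(\mathbb R^{n+1},\mathbb R_n)$ with $\partial_{x_0}f+\sum_{i=1}^n e_i\partial_{x_i}f=0$; the set of these is $\mathcal M_L(\mathbb R^{n+1})$. For $\mathbf m=(m_1,\dots,m_n)\in\mathbb N_0^n$: $|\mathbf m|=m_1+\dots+m_n$, $\mathbf m!=m_1!\cdots m_n!$, $\partial_{\mathbf x}^{\mathbf m}=\partial_{x_1}^{m_1}\cdots\partial_{x_n}^{m_n}$ (no $x_0$-derivative). Fueter polynomials: with $z_j=x_j-x_0e_j$, $V_{\mathbf m}(\mathbf x)=\frac{\mathbf m!}{|\mathbf m|!}\sum z_{j_1}z_{j_2}\cdots z_{j_{|\mathbf m|}}$, the sum being over all distinct sequences $(j_1,\dots,j_{|\mathbf m|})$ in which each index $i$ occurs exactly $m_i$ times ($V_{\mathbf 0}=1$). Every $f\in\mathcal M_L(\mathbb R^{n+1})$ has a unique Taylor expansion $f=\sum_{\mathbf m}V_{\mathbf m}(\mathbf x)a_{\mathbf m}$, $a_{\mathbf m}=\frac1{\mathbf m!}\partial^{\mathbf m}_{\mathbf x}f(0)\in\mathbb R_n$.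 The CK-product of $f=\sum V_{\mathbf m}a_{\mathbf m}$ and $g=\sum V_{\mathbf k}b_{\mathbf k}$ is $f\odot_L g=\sum_{\mathbf m}\sum_{\mathbf k}V_{\mathbf m+\mathbf k}(\mathbf x)a_{\mathbf m}b_{\mathbf k}$. Proximate orders: a differentiable function $\rho(r)\ge0$ on $r\ge0$ is a proximate order for the order $\rho\ge0$ if $\lim_{r\to+\infty}\rho(r)=\rho$ and $\lim_{r\to+\infty}\rho'(r)\,r\ln r=0$. A normalization $\hat\rho(r)$ of a proximate order $\rho(r)$ for $\rho>0$ is a proximate order such that $\hat\rho(r)=\rho(r)$ for all $r\ge r_1$, for some $r_1>0$, and $r\mapsto r^{\hat\rho(r)}$ is strictly increasing on $r>0$ and maps $(0,+\infty)$ onto $(0,+\infty)$ (such $\hat\rho$ exists; fix one). Let $\varphi$ be the inverse function of $t=r^{\hat\rho(r)}$ and $G_{\hat\rho,q}=\varphi(q)^q/(e\rho)^{q/\rho}$ for $q\in\mathbb N$, with $G_{\hat\rho,0}=1$. Spaces (here the subscript $\rho$ stands for the function $\rho(r)$): for $\sigma>0$, $A_{\rho,\sigma}=\{f\in\mathcal M_L(\mathbb R^{n+1}):\|f\|_{\rho,\sigma}:=\sup_{\mathbf x}\|f(\mathbf x)\|\exp(-\sigma\|\mathbf x\|^{\rho(\|\mathbf x\|)})<\infty\}$, a Banach space. $A_{\rho,+0}=\bigcap_{\epsilon>0}A_{\rho,\epsilon}$ with the projective limit topology (defined by all norms $\|\cdot\|_{\rho,\epsilon}$, $\epsilon>0$).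 Operators: $\mathbf D_{\rho_1\to\rho_2,0}$ is the set of formal right linear differential operators $P=\sum_{\mathbf m\in\mathbb N_0^n}u_{\mathbf m}(\mathbf x)\odot_L\partial_{\mathbf x}^{\mathbf m}$ (identified with their coefficient families) with $u_{\mathbf m}\in A_{\rho_2}:=\bigcup_{\sigma>0}A_{\rho_2,\sigma}$ satisfying $$\forall\sigma>0\ \exists\lambda>0\ \exists C>0\ \forall\mathbf m\in\mathbb N_0^n:\quad \|u_{\mathbf m}\|_{\rho_2,\sigma}\le C\,\frac{G_{\hat\rho_1,|\mathbf m|}}{\mathbf m!}\lambda^{|\mathbf m|},$$ where $\hat\rho_1$ is a normalization of $\rho_1$ (so each $u_{\mathbf m}\in A_{\rho_2,+0}$). Homomorphisms are right linear: $F$ additive with $F(fa)=F(f)a$ for all $a\in\mathbb R_n$. *)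

theory Defs
  imports "HOL-Analysis.Analysis" "HOL-Library.Landau_Symbols"
begin

section \<open>The real Clifford algebra\<close>

text \<open>
  The index type \<open>'n\<close> plays the role of \<open>{1, \<dots>, n}\<close>. The algebra is realised on its standard
  basis \<open>e\<^sub>A\<close> (\<open>A\<close> a set of indices, \<open>e\<^sub>A\<close> the product of the \<open>e\<^sub>i\<close>, \<open>i \<in> A\<close>, in increasing order),
  so that the Euclidean norm of \<open>real ^ 'n set\<close> is the Clifford norm. Beware that the
  operation \<open>*\<close> of the type \<open>vec\<close> is componentwise; the Clifford product is \<open>\<star>\<close>.
\<close>

type_synonym 'n clifford = "(real, 'n set) vec"

text \<open>
  \<open>e\<^sub>A e\<^sub>B\<close> is \<open>e\<^sub>C\<close> up to sign, \<open>C\<close> being the symmetric difference of \<open>A\<close> and \<open>B\<close>: each pair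
  \<open>a > b\<close> contributes a sign by anticommutation, and each pair \<open>a = b\<close> one by \<open>e\<^sub>a e\<^sub>a = -1\<close>.
\<close>

definition cl_sign :: "'n::{finite,linorder} set \<Rightarrow> 'n set \<Rightarrow> real" where
  "cl_sign A B = (- 1) ^ card {(a, b). a \<in> A \<and> b \<in> B \<and> b \<le> a}"

definition cl_basis :: "'n::{finite,linorder} set \<Rightarrow> 'n clifford" where
  "cl_basis A = axis A 1"

definition cl_mult :: "'n::{finite,linorder} clifford \<Rightarrow> 'n clifford \<Rightarrow> 'n clifford"
    (infixl "\<star>" 75) where
  "a \<star> b = (\<Sum>A\<in>UNIV. \<Sum>B\<in>UNIV. (cl_sign A B * a $ A * b $ B) *\<^sub>R cl_basis (sym_diff A B))"

definition cl_one :: "'n::{finite,linorder} clifford" where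
  "cl_one = cl_basis {}"

definition cl_gen :: "'n::{finite,linorder} \<Rightarrow> 'n clifford" where
  "cl_gen i = cl_basis {i}"

text \<open>The following lemmas confirm that this is the intended algebra.\<close>

lemma cl_linear_ext:
  fixes f g :: "'n::{finite,linorder} clifford \<Rightarrow> 'b::real_vector"
  assumes "linear f" "linear g" "\<And>A. f (cl_basis A) = g (cl_basis A)"
  shows "f a = g a"
proof -
  have "a = (\<Sum>A\<in>UNIV. (a $ A) *\<^sub>R cl_basis A)"
    by (simp add: vec_eq_iff cl_basis_def axis_def if_distrib cong: if_cong)
  then obtain c where a: "a = (\<Sum>A\<in>UNIV. c A *\<^sub>R cl_basis A)" by blast
  show ?thesis unfolding a using assms by (simp add: linear_sum linear_scale)
qed

lemma bilinear_cl_mult: "bilinear (\<star>)"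
  unfolding bilinear_def linear_iff cl_mult_def
  by (simp add: algebra_simps sum.distrib scaleR_sum_right)

lemma cl_basis_mult: "cl_basis A \<star> cl_basis B = cl_sign A B *\<^sub>R cl_basis (sym_diff A B)"
proof -
  have "cl_basis A \<star> cl_basis B = (\<Sum>A'\<in>UNIV. \<Sum>B'\<in>UNIV. if A' = A then if B' = B then
      cl_sign A' B' *\<^sub>R cl_basis (sym_diff A' B') else 0 else 0)"
    unfolding cl_mult_def by (intro sum.cong) (auto simp: cl_basis_def axis_def)
  also have "\<dots> = (\<Sum>A'\<in>UNIV. if A' = A then (\<Sum>B'\<in>UNIV. if B' = B then
      cl_sign A' B' *\<^sub>R cl_basis (sym_diff A' B') else 0) else 0)"
    by (intro sum.cong) auto
  also have "\<dots> = cl_sign A B *\<^sub>R cl_basis (sym_diff A B)"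
    by simp
  finally show ?thesis .
qed

lemma cl_gen_square: "cl_gen i \<star> cl_gen i = - cl_one"
proof -
  have "{(a, b). a = i \<and> b = i \<and> b \<le> a} = {(i, i)}" by auto
  then show ?thesis by (simp add: cl_gen_def cl_one_def cl_basis_mult cl_sign_def)
qed

lemma cl_gen_anticommute:
  assumes "i \<noteq> j" shows "cl_gen i \<star> cl_gen j + cl_gen j \<star> cl_gen i = 0"
proof -
  have "{(a, b). a = i \<and> b = j \<and> b \<le> a} = (if j \<le> i then {(i, j)} else {})"
    and "{(a, b). a = j \<and> b = i \<and> b \<le> a} = (if i \<le> j then {(j, i)} else {})" by auto
  moreover have "sym_diff {i} {j} = sym_diff {j} {i}" by auto
  ultimately show ?thesis using assms
    by (auto simp: cl_gen_def cl_basis_mult cl_sign_def insert_commute)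
qed

lemma cl_gen_mult_basis:
  assumes "\<And>b. b \<in> A \<Longrightarrow> a < b" shows "cl_gen a \<star> cl_basis A = cl_basis (insert a A)"
proof -
  have "{(x, b). x \<in> {a} \<and> b \<in> A \<and> b \<le> x} = {}" using assms by fastforce
  then have "cl_sign {a} A = 1" unfolding cl_sign_def by (simp only: card.empty power_0)
  moreover have "sym_diff {a} A = insert a A" using assms by auto
  ultimately show ?thesis by (simp add: cl_gen_def cl_basis_mult)
qed

lemma cl_mult_one: "cl_one \<star> a = a" "a \<star> cl_one = a"
proof -
  have 1: "linear (\<lambda>a. cl_one \<star> a)" "linear (\<lambda>a. a \<star> cl_one)"
    using bilinear_cl_mult unfolding bilinear_def by blast+
  have "cl_sign {} A = 1" "cl_sign A {} = 1" for A :: "'a set" by (simp_all add: cl_sign_def)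
  then have 2: "cl_one \<star> cl_basis A = cl_basis A" "cl_basis A \<star> cl_one = cl_basis A" for A :: "'a set"
    by (simp_all add: cl_one_def cl_basis_mult)
  show "cl_one \<star> a = a" by (rule cl_linear_ext[OF 1(1) linear_ident 2(1)])
  show "a \<star> cl_one = a" by (rule cl_linear_ext[OF 1(2) linear_ident 2(2)])
qed

lemma cl_sign_cocycle:
  "cl_sign A B * cl_sign (sym_diff A B) C = cl_sign B C * cl_sign A (sym_diff B C)"
proof -
  define I where "I A B = {(a, b). a \<in> A \<and> b \<in> B \<and> b \<le> a}" for A B :: "'a set"
  have s: "cl_sign A B = (- 1) ^ card (I A B)" for A B :: "'a set"
    by (simp add: cl_sign_def I_def)
  have d: "(- 1 :: real) ^ card (sym_diff X Y) = (- 1) ^ card X * (- 1) ^ card Y"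
    for X Y :: "('a \<times> 'a) set"
  proof -
    have *: "card X = card (X - Y) + card (X \<inter> Y)" "card Y = card (Y - X) + card (X \<inter> Y)"
      by (simp_all add: card_Diff_subset_Int card_mono Int_commute)
    have "card (sym_diff X Y) = card (X - Y) + card (Y - X)"
      by (intro card_Un_disjoint) auto
    moreover have "(- 1 :: real) ^ (p + c) * (- 1) ^ (q + c) = (- 1) ^ (p + q)" for p q c
      by (simp add: power_add mult_ac)
    ultimately show ?thesis by (simp only: *)
  qed
  have "I (sym_diff A B) C = sym_diff (I A C) (I B C)" "I A (sym_diff B C) = sym_diff (I A B) (I A C)"
    by (auto simp: I_def)
  then show ?thesis by (simp add: s d)
qed

lemma cl_mult_assoc: "a \<star> b \<star> c = a \<star> (b \<star> c)"
proof -
  have l: "linear (\<lambda>a. a \<star> b)" "linear (\<lambda>b. a \<star> b)" for a b :: "'a clifford"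
    using bilinear_cl_mult unfolding bilinear_def by blast+
  have c: "linear (\<lambda>a. a \<star> b \<star> c)" "linear (\<lambda>b. a \<star> b \<star> c)" "linear (\<lambda>b. a \<star> (b \<star> c))"
    "linear (\<lambda>c. a \<star> (b \<star> c))" for a b c :: "'a clifford"
    using linear_compose[OF l(1) l(1)] linear_compose[OF l(2) l(1)]
      linear_compose[OF l(1) l(2)] linear_compose[OF l(2) l(2)] by (simp_all add: o_def)
  have 1: "cl_basis A \<star> cl_basis B \<star> cl_basis C = cl_basis A \<star> (cl_basis B \<star> cl_basis C)"
    for A B C :: "'a set"
  proof -
    have "sym_diff (sym_diff A B) C = sym_diff A (sym_diff B C)" by auto
    then show ?thesis using cl_sign_cocycle[of A B C]
      by (simp add: cl_basis_mult linear_scale[OF l(1)] linear_scale[OF l(2)])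
  qed
  have 2: "cl_basis A \<star> cl_basis B \<star> c = cl_basis A \<star> (cl_basis B \<star> c)" for A B
    by (rule cl_linear_ext[OF l(2) c(4) 1])
  have 3: "cl_basis A \<star> b \<star> c = cl_basis A \<star> (b \<star> c)" for A
    by (rule cl_linear_ext[OF c(2) c(3) 2])
  show ?thesis
    by (rule cl_linear_ext[OF c(1) l(1) 3])
qed


section \<open>Entire left monogenic functions\<close>

text \<open>Points \<open>(x\<^sub>0, (x\<^sub>1, \<dots>, x\<^sub>n))\<close>; the product norm is the Euclidean norm of the paravector.\<close>

type_synonym 'n paravec = "real \<times> (real, 'n) vec"

definition pd0 :: "('n::{finite,linorder} paravec \<Rightarrow> 'n clifford) \<Rightarrow> 'n paravec \<Rightarrow> 'n clifford" where
  "pd0 f x = frechet_derivative f (at x) (1, 0)"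

definition pd :: "'n::{finite,linorder} \<Rightarrow> ('n paravec \<Rightarrow> 'n clifford) \<Rightarrow> 'n paravec \<Rightarrow> 'n clifford" where
  "pd i f x = frechet_derivative f (at x) (0, axis i 1)"

definition C1_entire :: "('n::{finite,linorder} paravec \<Rightarrow> 'n clifford) \<Rightarrow> bool" where
  "C1_entire f \<longleftrightarrow> (\<forall>x. f differentiable (at x)) \<and>
     (\<forall>v. continuous_on UNIV (\<lambda>x. frechet_derivative f (at x) v))"

definition monogenic :: "('n::{finite,linorder} paravec \<Rightarrow> 'n clifford) set" where
  "monogenic = {f. C1_entire f \<and> (\<forall>x. pd0 f x + (\<Sum>i\<in>UNIV. cl_gen i \<star> pd i f x) = 0)}"


section \<open>Fueter polynomials, Taylor coefficients and the CK-product\<close>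

type_synonym 'n multi = "'n \<Rightarrow> nat"

definition msize :: "'n::{finite,linorder} multi \<Rightarrow> nat" where
  "msize m = (\<Sum>i\<in>UNIV. m i)"

definition mfact :: "'n::{finite,linorder} multi \<Rightarrow> real" where
  "mfact m = (\<Prod>i\<in>UNIV. fact (m i))"

definition madd :: "'n multi \<Rightarrow> 'n multi \<Rightarrow> 'n multi" where
  "madd m k = (\<lambda>i. m i + k i)"

definition mpd :: "'n::{finite,linorder} multi \<Rightarrow>
    ('n paravec \<Rightarrow> 'n clifford) \<Rightarrow> 'n paravec \<Rightarrow> 'n clifford" where
  "mpd m f = foldr (\<lambda>i g. (pd i ^^ m i) g) (sorted_list_of_set UNIV) f"

definition fueter_var :: "'n::{finite,linorder} paravec \<Rightarrow> 'n \<Rightarrow> 'n clifford" where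
  "fueter_var x j = (snd x $ j) *\<^sub>R cl_one - fst x *\<^sub>R cl_gen j"

definition cl_prod_list :: "'n::{finite,linorder} clifford list \<Rightarrow> 'n clifford" where
  "cl_prod_list xs = foldr (\<star>) xs cl_one"

definition mseqs :: "'n multi \<Rightarrow> 'n list set" where
  "mseqs m = {js. \<forall>i. count_list js i = m i}"

lemma finite_mseqs: "finite (mseqs (m :: 'n::{finite,linorder} multi))"
proof (rule finite_subset)
  show "mseqs m \<subseteq> {js. set js \<subseteq> UNIV \<and> length js = msize m}"
  proof
    fix js assume "js \<in> mseqs m"
    then have "(\<Sum>i\<in>UNIV. count_list js i) = msize m" by (simp add: mseqs_def msize_def)
    moreover have "(\<Sum>i\<in>UNIV. count_list js i) = length js"
      by (rule sum_count_set) simp_all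
    ultimately show "js \<in> {js. set js \<subseteq> UNIV \<and> length js = msize m}" by simp
  qed
qed (rule finite_lists_length_eq, simp)

definition fueter :: "'n::{finite,linorder} multi \<Rightarrow> 'n paravec \<Rightarrow> 'n clifford" where
  "fueter m x = (mfact m / fact (msize m)) *\<^sub>R
     (\<Sum>js\<in>mseqs m. cl_prod_list (map (fueter_var x) js))"

definition taylor_coeff :: "('n::{finite,linorder} paravec \<Rightarrow> 'n clifford) \<Rightarrow> 'n multi \<Rightarrow> 'n clifford" where
  "taylor_coeff f m = (1 / mfact m) *\<^sub>R mpd m f 0"

text \<open>For entire left monogenic \<open>f\<close>, \<open>g\<close> the double series converges absolutely at every point.\<close>

definition ck_prod :: "('n::{finite,linorder} paravec \<Rightarrow> 'n clifford) \<Rightarrow>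
    ('n paravec \<Rightarrow> 'n clifford) \<Rightarrow> 'n paravec \<Rightarrow> 'n clifford" (infixl "\<odot>\<^sub>L" 70) where
  "(f \<odot>\<^sub>L g) x = (\<Sum>\<^sub>\<infinity>m. \<Sum>\<^sub>\<infinity>k. fueter (madd m k) x \<star> taylor_coeff f m \<star> taylor_coeff g k)"


section \<open>Proximate orders\<close>

definition proximate_order :: "(real \<Rightarrow> real) \<Rightarrow> real \<Rightarrow> bool" where
  "proximate_order \<rho> \<rho>0 \<longleftrightarrow> \<rho>0 \<ge> 0 \<and> \<rho> differentiable_on {0..} \<and> (\<forall>r\<ge>0. \<rho> r \<ge> 0) \<and>
     (\<rho> \<longlongrightarrow> \<rho>0) at_top \<and> ((\<lambda>r. deriv \<rho> r * r * ln r) \<longlongrightarrow> 0) at_top"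

definition normalization :: "(real \<Rightarrow> real) \<Rightarrow> (real \<Rightarrow> real) \<Rightarrow> real \<Rightarrow> bool" where
  "normalization \<rho>' \<rho> \<rho>0 \<longleftrightarrow> proximate_order \<rho>' \<rho>0 \<and> (\<exists>r1>0. \<forall>r\<ge>r1. \<rho>' r = \<rho> r) \<and>
     strict_mono_on {0<..} (\<lambda>r. r powr \<rho>' r) \<and> (\<lambda>r. r powr \<rho>' r) ` {0<..} = {0<..}"

text \<open>\<open>G\<close> depends on the normalization \<open>\<rho>'\<close> and on the order \<open>\<rho>0\<close>, its limit at infinity.\<close>

definition G_seq :: "(real \<Rightarrow> real) \<Rightarrow> real \<Rightarrow> nat \<Rightarrow> real" where
  "G_seq \<rho>' \<rho>0 q = (if q = 0 then 1 else
     the_inv_into {0<..} (\<lambda>r. r powr \<rho>' r) (real q) ^ q / (exp 1 * \<rho>0) powr (real q / \<rho>0))"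


section \<open>Growth spaces\<close>

text \<open>
  The norm is extended-valued, so it is defined for every function. Since \<open>0 powr 0 = 0\<close>, the
  exponential factor at the origin is always \<open>1\<close>; reading \<open>0\<^sup>0\<close> as \<open>1\<close> there would only change the
  norm to an equivalent one, and only if \<open>\<rho> 0 = 0\<close>.
\<close>

definition growth_norm :: "(real \<Rightarrow> real) \<Rightarrow> real \<Rightarrow>
    ('n::{finite,linorder} paravec \<Rightarrow> 'n clifford) \<Rightarrow> ereal" where
  "growth_norm \<rho> \<sigma> f = (SUP x. ereal (norm (f x) * exp (- \<sigma> * norm x powr \<rho> (norm x))))"

definition growth_space :: "(real \<Rightarrow> real) \<Rightarrow> real \<Rightarrow> ('n::{finite,linorder} paravec \<Rightarrow> 'n clifford) set" where
  "growth_space \<rho> \<sigma> = {f \<in> monogenic. growth_norm \<rho> \<sigma> f < \<infinity>}"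

definition growth_union :: "(real \<Rightarrow> real) \<Rightarrow> ('n::{finite,linorder} paravec \<Rightarrow> 'n clifford) set" where
  "growth_union \<rho> = (\<Union>\<sigma>\<in>{0<..}. growth_space \<rho> \<sigma>)"

definition growth_min :: "(real \<Rightarrow> real) \<Rightarrow> ('n::{finite,linorder} paravec \<Rightarrow> 'n clifford) set" where
  "growth_min \<rho> = (\<Inter>\<epsilon>\<in>{0<..}. growth_space \<rho> \<epsilon>)"

text \<open>The topology defined by all the norms: open balls for each of them form a subbasis.\<close>

definition growth_min_topology ::
    "(real \<Rightarrow> real) \<Rightarrow> ('n::{finite,linorder} paravec \<Rightarrow> 'n clifford) topology" where
  "growth_min_topology \<rho> = topology_generated_by
     {{g \<in> growth_min \<rho>. growth_norm \<rho> \<epsilon> (\<lambda>x. g x - f x) < ereal \<delta>} | f \<epsilon> \<delta>.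
        f \<in> growth_min \<rho> \<and> \<epsilon> > 0 \<and> \<delta> > 0}"


section \<open>Differential operators and homomorphisms\<close>

text \<open>An operator is its coefficient family \<open>u\<close>; \<open>\<rho>1'\<close> is the normalization of a proximate order
  for \<open>ord1\<close>.\<close>

definition diff_ops :: "(real \<Rightarrow> real) \<Rightarrow> real \<Rightarrow> (real \<Rightarrow> real) \<Rightarrow>
    ('n::{finite,linorder} multi \<Rightarrow> 'n paravec \<Rightarrow> 'n clifford) set" where
  "diff_ops \<rho>1' ord1 \<rho>2 = {u. (\<forall>m. u m \<in> growth_union \<rho>2) \<and>
     (\<forall>\<sigma>>0. \<exists>L>0. \<exists>C>0. \<forall>m. growth_norm \<rho>2 \<sigma> (u m) \<le>
        ereal (C * (G_seq \<rho>1' ord1 (msize m) / mfact m) * L ^ msize m))}"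

definition op_term :: "('n::{finite,linorder} multi \<Rightarrow> 'n paravec \<Rightarrow> 'n clifford) \<Rightarrow>
    ('n paravec \<Rightarrow> 'n clifford) \<Rightarrow> 'n multi \<Rightarrow> 'n paravec \<Rightarrow> 'n clifford" where
  "op_term u f m = u m \<odot>\<^sub>L mpd m f"

definition op_apply :: "('n::{finite,linorder} multi \<Rightarrow> 'n paravec \<Rightarrow> 'n clifford) \<Rightarrow>
    ('n paravec \<Rightarrow> 'n clifford) \<Rightarrow> 'n paravec \<Rightarrow> 'n clifford" where
  "op_apply u f x = (\<Sum>\<^sub>\<infinity>m. op_term u f m x)"

definition right_linear_on :: "('n::{finite,linorder} paravec \<Rightarrow> 'n clifford) set \<Rightarrow>
    (('n paravec \<Rightarrow> 'n clifford) \<Rightarrow> 'n paravec \<Rightarrow> 'n clifford) \<Rightarrow> bool" where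
  "right_linear_on S F \<longleftrightarrow>
     (\<forall>f\<in>S. \<forall>g\<in>S. F (\<lambda>x. f x + g x) = (\<lambda>x. F f x + F g x)) \<and>
     (\<forall>f\<in>S. \<forall>a. F (\<lambda>x. f x \<star> a) = (\<lambda>x. F f x \<star> a))"

text \<open>\<open>continuous_map\<close> includes that \<open>F\<close> maps the first space, the whole of its topological space,
  into the second.\<close>

definition continuous_hom :: "(real \<Rightarrow> real) \<Rightarrow> (real \<Rightarrow> real) \<Rightarrow>
    (('n::{finite,linorder} paravec \<Rightarrow> 'n clifford) \<Rightarrow> 'n paravec \<Rightarrow> 'n clifford) \<Rightarrow> bool" where
  "continuous_hom \<rho>1 \<rho>2 F \<longleftrightarrow> right_linear_on (growth_min \<rho>1) F \<and>
     continuous_map (growth_min_topology \<rho>1) (growth_min_topology \<rho>2) F"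

lemma topspace_growth_min_topology:
  "topspace (growth_min_topology \<rho>) =
    (growth_min \<rho> :: ('n::{finite,linorder} paravec \<Rightarrow> 'n clifford) set)"
proof
  show "topspace (growth_min_topology \<rho>) \<subseteq> (growth_min \<rho> :: ('n paravec \<Rightarrow> 'n clifford) set)"
    unfolding growth_min_topology_def topology_generated_by_topspace by blast
  show "(growth_min \<rho> :: ('n paravec \<Rightarrow> 'n clifford) set) \<subseteq> topspace (growth_min_topology \<rho>)"
  proof
    fix f :: "'n paravec \<Rightarrow> 'n clifford" assume f: "f \<in> growth_min \<rho>"
    let ?B = "{g \<in> growth_min \<rho>. growth_norm \<rho> 1 (\<lambda>x. g x - f x) < ereal 1}"
    have "f \<in> ?B" using f by (simp add: growth_norm_def flip: zero_ereal_def)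
    moreover have "openin (growth_min_topology \<rho>) ?B"
      unfolding growth_min_topology_def
      using f by (intro topology_generated_by_Basis CollectI exI[of _ f] exI[of _ 1]) simp
    ultimately show "f \<in> topspace (growth_min_topology \<rho>)"
      using openin_subset by blast
  qed
qed

end

theory Submission
  imports Defs
begin

text \<open>
  For a monogenic \<open>f\<close>, integration by parts against powers of \<open>max 0 (1 - \<parallel>x\<parallel>\<^sup>2)\<close> turns the Dirac equation
  into a mean value property with a compactly supported kernel. This represents \<open>f\<close> by an integral that
  can be differentiated under the integral sign, which gives \<open>\<parallel>\<partial>f(y)\<parallel> \<le> C/r sup \<parallel>f\<parallel>\<close> over the ball of radius \<open>r\<close>,
  the closedness of monogenic functions under locally uniform limits, and by iteration the Cauchy estimates.
  On monogenic functions \<open>x \<bullet> \<nabla> = \<Sum>\<^sub>j z\<^sub>j \<partial>\<^sub>j\<close>, so that Taylor's formula along the ray \<open>t x\<close> is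
  the expansion in Fueter polynomials.

  A proximate order enters only through two facts: \<open>r\<^bsup>\<rho>(r)\<^esup>\<close> grows at a dilated argument by at most a
  constant factor, and \<open>G\<^sub>q\<close> is, up to geometric factors, the supremum over \<open>r\<close> of \<open>r\<^bsup>q\<^esup> exp (- \<sigma> r\<^bsup>\<rho>(r)\<^esup>)\<close>.
  Geometric factors \<open>\<lambda>\<^bsup>|m|\<^esup>\<close> are harmless because the Cauchy estimates gain \<open>\<epsilon>\<^bsup>|m|\<^esup>\<close> for every \<open>\<epsilon> > 0\<close>
  on functions of minimal type; hence the terms \<open>u\<^sub>m \<odot> \<partial>\<^bsup>m\<^esup>f\<close> decay geometrically in every norm. Conversely, the
  coefficients of a homomorphism \<open>F\<close> are obtained by binomial inversion from the functions \<open>F V\<^sub>k\<close>,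
  and \<open>F\<close> is determined by these since the Taylor series converges in the topology of the space.
\<close>

subsection \<open>The mean value property\<close>

text \<open>The kernel is deliberately not the Cauchy kernel: integrals over fixed cubes have
  neither boundary terms nor singularities, and the square of \<open>bump\<close> is just smooth
  enough for one derivative under the integral. Higher derivatives come from difference quotients,
  which are again monogenic. The price is a Cauchy constant that is not sharp. The Clifford norm,
  the number of words and binomials add more losses, but all of them are geometric in |m| or dilate
  the radius. The obstacle is that the CK-product convolves Taylor coefficients, so values of the
  factors do not bound values of the product. Growth must pass through coefficients, and the Cauchy
  estimate for a derivative of order m, evaluated near x, must use one radius for two purposes:
  comparable to |x|, to sum over the remaining index, and comparable to \<phi>(|m|), to produce
  1/\<open>G_seq\<close>. The sum of two such radii does both, because the weight at the sum is
  controlled by the weights at the summands. The order of choices matters: the geometric constant of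
  the operator is known before \<epsilon> is chosen for the function.\<close>

type_synonym 'n clfun = "'n paravec \<Rightarrow> 'n clifford"

interpretation cl_mult: bounded_bilinear "(\<star>) :: 'n::{finite,linorder} clifford \<Rightarrow> _"
  using bilinear_cl_mult bilinear_conv_bounded_bilinear by blast

text \<open>The coefficient norm is in general not submultiplicative (from three generators on), so
  every estimate of a product carries a constant \<open>K\<close>.\<close>

lemma cl_mult_norm_bound:
  obtains K where "K \<ge> 1" "\<And>a b :: 'n::{finite,linorder} clifford. norm (a \<star> b) \<le> K * norm a * norm b"
proof -
  obtain K where K: "\<And>a b :: 'n clifford. norm (a \<star> b) \<le> norm a * norm b * K"
    using cl_mult.nonneg_bounded by blast
  have "norm (a \<star> b) \<le> max 1 K * norm a * norm b" for a b :: "'n clifford"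
  proof -
    have "norm a * norm b * K \<le> norm a * norm b * max 1 K" by (intro mult_left_mono) auto
    then show ?thesis using K[of a b] by (simp add: mult_ac)
  qed
  then show ?thesis using that[of "max 1 K"] by simp
qed

definition para :: "'n::{finite,linorder} clfun" where
  "para x = fst x *\<^sub>R cl_one + (\<Sum>i\<in>UNIV. (snd x $ i) *\<^sub>R cl_gen i)"

definition para_conj :: "'n::{finite,linorder} clfun" where
  "para_conj x = fst x *\<^sub>R cl_one - (\<Sum>i\<in>UNIV. (snd x $ i) *\<^sub>R cl_gen i)"

text \<open>Polarisation of the fact that a conjugate times its paravector is the squared length. It
  encodes the relations between the generators in the form needed for the mean value property: mixed
  terms of distinct orthonormal directions cancel.\<close>

lemma para_conj_polarization:
  "para_conj x \<star> para y + para_conj y \<star> para x = (2 * (x \<bullet> y)) *\<^sub>R (cl_one :: 'n::{finite,linorder} clifford)"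
proof -
  define X where "X = (\<Sum>i\<in>UNIV. (snd x $ i) *\<^sub>R (cl_gen i :: 'n clifford))"
  define Y where "Y = (\<Sum>i\<in>UNIV. (snd y $ i) *\<^sub>R (cl_gen i :: 'n clifford))"
  have 1: "X \<star> Y = (\<Sum>i\<in>UNIV. \<Sum>j\<in>UNIV. (snd x $ i * snd y $ j) *\<^sub>R (cl_gen i \<star> cl_gen j))"
    unfolding X_def Y_def cl_mult.sum_left cl_mult.scaleR_left
    by (simp add: cl_mult.sum_right cl_mult.scaleR_right scaleR_sum_right)
  have "Y \<star> X = (\<Sum>j\<in>UNIV. \<Sum>i\<in>UNIV. (snd x $ i * snd y $ j) *\<^sub>R (cl_gen j \<star> cl_gen i))"
    unfolding X_def Y_def cl_mult.sum_left cl_mult.scaleR_left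
    by (simp add: cl_mult.sum_right cl_mult.scaleR_right scaleR_sum_right mult.commute)
  then have 2: "Y \<star> X = (\<Sum>i\<in>UNIV. \<Sum>j\<in>UNIV. (snd x $ i * snd y $ j) *\<^sub>R (cl_gen j \<star> cl_gen i))"
    by (subst sum.swap)
  have g: "cl_gen i \<star> cl_gen j + cl_gen j \<star> cl_gen i = (if i = j then (- 2) *\<^sub>R cl_one else (0::'n clifford))" for i j
    using cl_gen_anticommute[of i j] by (auto simp: cl_gen_square scaleR_2)
  have "X \<star> Y + Y \<star> X = (\<Sum>i\<in>UNIV. \<Sum>j\<in>UNIV. (snd x $ i * snd y $ j) *\<^sub>R (cl_gen i \<star> cl_gen j + cl_gen j \<star> cl_gen i))"
    unfolding 1 2 by (simp add: sum.distrib scaleR_add_right)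
  also have "\<dots> = (- 2 * (snd x \<bullet> snd y)) *\<^sub>R cl_one"
    unfolding g by (simp add: if_distrib cong: if_cong)
      (simp add: inner_vec_def sum_distrib_left scaleR_sum_left[symmetric] sum_negf mult_ac)
  finally have XY: "X \<star> Y + Y \<star> X = (- 2 * (snd x \<bullet> snd y)) *\<^sub>R cl_one" .
  have "para_conj x \<star> para y + para_conj y \<star> para x = (2 * fst x * fst y) *\<^sub>R cl_one - (X \<star> Y + Y \<star> X)"
    unfolding para_def para_conj_def X_def[symmetric] Y_def[symmetric]
      cl_mult.add_left cl_mult.add_right cl_mult.diff_left cl_mult.scaleR_left
      cl_mult.scaleR_right cl_mult_one
    by (simp add: algebra_simps mult_2 flip: scaleR_2)
  then show ?thesis unfolding XY by (simp add: inner_prod_def scaleR_diff_left[symmetric] algebra_simps)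
qed

lemma sum_Basis_paravec:
  fixes F :: "'n::{finite,linorder} paravec \<Rightarrow> 'b::comm_monoid_add"
  shows "(\<Sum>b\<in>Basis. F b) = F (1, 0) + (\<Sum>i\<in>UNIV. F (0, axis i 1))"
proof -
  have B: "(Basis :: 'n paravec set) = insert (1, 0) (range (\<lambda>i. (0, axis i 1)))"
    unfolding Basis_prod_def Basis_vec_def by auto
  have "inj (\<lambda>i::'n. (0::real, axis i (1::real)))"
    by (auto simp: inj_on_def axis_eq_axis)
  moreover have "(1::real, 0::(real,'n) vec) \<notin> range (\<lambda>i. (0, axis i 1))" by auto
  ultimately show ?thesis unfolding B by (simp add: sum.reindex)
qed

lemma para_Basis [simp]: "para (1, 0) = cl_one" "para (0, axis i 1) = cl_gen i"
proof -
  show "para (1, 0) = cl_one" by (simp add: para_def)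
  have "(\<Sum>j\<in>UNIV. (axis i 1 $ j) *\<^sub>R cl_gen j) = (\<Sum>j\<in>UNIV. if j = i then cl_gen j else 0)"
    by (intro sum.cong) (auto simp: axis_def)
  then show "para (0, axis i 1) = cl_gen i" by (simp add: para_def)
qed

text \<open>Treats the direction of \<open>x_0\<close> like all others, so that the argument on
  moments can be symmetric in the basis vectors.\<close>

lemma dirac_eq:
  "pd0 f x + (\<Sum>i\<in>UNIV. cl_gen i \<star> pd i f x) = (\<Sum>b\<in>Basis. para b \<star> frechet_derivative f (at x) b)"
  by (simp add: sum_Basis_paravec pd0_def pd_def cl_mult_one)

lemma monogenicI:
  assumes "\<And>x. (f has_derivative f' x) (at x)" "\<And>v. continuous_on UNIV (\<lambda>x. f' x v)"
    "\<And>x. (\<Sum>b\<in>Basis. para b \<star> f' x b) = 0"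
  shows "f \<in> monogenic"
proof -
  have "frechet_derivative f (at x) = f' x" for x
    using assms(1) frechet_derivative_at by metis
  moreover have "f differentiable (at x)" for x
    using assms(1) unfolding differentiable_def by blast
  ultimately show ?thesis using assms(2,3)
    by (simp add: monogenic_def C1_entire_def dirac_eq)
qed

lemma monogenicD:
  assumes "f \<in> monogenic"
  shows "(f has_derivative frechet_derivative f (at x)) (at x)"
    "continuous_on UNIV (\<lambda>x. frechet_derivative f (at x) v)"
    "(\<Sum>b\<in>Basis. para b \<star> frechet_derivative f (at x) b) = 0"
  using assms unfolding monogenic_def C1_entire_def dirac_eq frechet_derivative_works by blast+

lemma monogenic_continuous: "f \<in> monogenic \<Longrightarrow> continuous_on S f"
  using monogenicD(1) has_derivative_continuous continuous_at_imp_continuous_on by metis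

section \<open>Integration by parts on cubes\<close>

lemma cbox_One_iff: "x \<in> cbox (- R *\<^sub>R One) (R *\<^sub>R One) \<longleftrightarrow> (\<forall>b\<in>Basis. \<bar>x \<bullet> b\<bar> \<le> (R::real))"
  by (auto simp: mem_box inner_sum_left_Basis abs_le_iff)

lemma norm_le_imp_mem_cbox_One:
  assumes "norm x \<le> R" shows "x \<in> cbox (- R *\<^sub>R One) (R *\<^sub>R One)"
  using assms Basis_le_norm order_trans unfolding cbox_One_iff by blast

text \<open>The integral of a translate of \<open>g\<close> does not depend on the translation;
  differentiate it at zero. The support lies in the cube of half-width 1, and a translation by at
  most 1 keeps it inside the cube of half-width 2.\<close>

lemma integral_derivative_compact_support:
  fixes g :: "'a::euclidean_space \<Rightarrow> 'b::euclidean_space"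
  assumes der: "\<And>x. (g has_derivative g' x) (at x)"
    and cont: "continuous_on UNIV (\<lambda>x. g' x b)"
    and supp: "\<And>x. norm x \<ge> 1 \<Longrightarrow> g x = 0" and b: "norm b \<le> 1"
  shows "integral (cbox (- 2 *\<^sub>R One) (2 *\<^sub>R One)) (\<lambda>x. g' x b) = 0"
proof -
  let ?Q = "cbox (- 2 *\<^sub>R One) (2 *\<^sub>R One) :: 'a set"
  define J where "J t = integral ?Q (\<lambda>x. g (x + t *\<^sub>R b))" for t :: real
  have contg: "continuous_on S g" for S
    using der has_derivative_continuous continuous_at_imp_continuous_on by metis
  have "J t = integral (cbox (- 1 *\<^sub>R One) (1 *\<^sub>R One)) g" if t: "t \<in> {-1..1}" for t
  proof -
    have "J t = integral (cbox (- 2 *\<^sub>R One + t *\<^sub>R b) (2 *\<^sub>R One + t *\<^sub>R b)) g"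
      unfolding J_def
      using integral_shift_cbox[of "- 2 *\<^sub>R One + t *\<^sub>R b" "t *\<^sub>R b" "2 *\<^sub>R One + t *\<^sub>R b" g] by simp
    also have "\<dots> = integral (cbox (- 1 *\<^sub>R One) (1 *\<^sub>R One)) g"
    proof (rule integral_unique, rule has_integral_on_superset)
      show "(g has_integral integral (cbox (- 1 *\<^sub>R One) (1 *\<^sub>R One)) g) (cbox (- 1 *\<^sub>R One) (1 *\<^sub>R One))"
        by (intro integrable_integral integrable_continuous contg)
      show "g x = 0" if "x \<notin> cbox (- 1 *\<^sub>R One) (1 *\<^sub>R One)" for x
        using that norm_le_imp_mem_cbox_One[of x 1] by (intro supp) (metis linear)
      have tb: "\<bar>t * (b \<bullet> i)\<bar> \<le> 1" if "i \<in> Basis" for i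
      proof -
        have "\<bar>b \<bullet> i\<bar> \<le> 1" using Basis_le_norm[OF that, of b] b by linarith
        then show ?thesis using t by (auto simp: abs_mult intro: mult_le_one)
      qed
      show "cbox (- 1 *\<^sub>R One) (1 *\<^sub>R One) \<subseteq> cbox (- 2 *\<^sub>R One + t *\<^sub>R b) (2 *\<^sub>R One + t *\<^sub>R b)"
      proof (rule subset_box_imp(1), intro ballI)
        fix i :: 'a assume i: "i \<in> Basis"
        show "(- 2 *\<^sub>R One + t *\<^sub>R b) \<bullet> i \<le> (- 1 *\<^sub>R One) \<bullet> i \<and> (1 *\<^sub>R One) \<bullet> i \<le> (2 *\<^sub>R One + t *\<^sub>R b) \<bullet> i"
          using tb[OF i] i by (auto simp: inner_add_left inner_diff_left inner_sum_left_Basis abs_le_iff)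
      qed
    qed
    finally show ?thesis .
  qed
  then have J: "J t = J 0" if "t \<in> {-1..1}" for t using that by simp
  have "(J has_vector_derivative integral ?Q (\<lambda>x. g' (x + 0 *\<^sub>R b) b)) (at 0 within {-1..1})"
    unfolding J_def
  proof (rule leibniz_rule_vector_derivative)
    fix t :: real and x :: 'a
    have "((\<lambda>t. g (x + t *\<^sub>R b)) has_derivative (\<lambda>h. g' (x + t *\<^sub>R b) (h *\<^sub>R b))) (at t within {-1..1})"
      by (rule has_derivative_compose[OF _ der]) (auto intro!: derivative_eq_intros)
    moreover have "g' (x + t *\<^sub>R b) (h *\<^sub>R b) = h *\<^sub>R g' (x + t *\<^sub>R b) b" for h
      using has_derivative_linear[OF der] by (simp add: linear_scale)
    ultimately show "((\<lambda>t. g (x + t *\<^sub>R b)) has_vector_derivative g' (x + t *\<^sub>R b) b) (at t within {-1..1})"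
      by (simp add: has_vector_derivative_def)
  next
    show "(\<lambda>x. g (x + t *\<^sub>R b)) integrable_on ?Q" for t
      by (intro integrable_continuous continuous_on_compose2[OF contg[of UNIV]] continuous_intros) auto
  next
    show "continuous_on ({- 1..1} \<times> ?Q) (\<lambda>(t, x). g' (x + t *\<^sub>R b) b)"
      unfolding split_beta by (intro continuous_on_compose2[OF cont] continuous_intros) auto
  qed auto
  then have D1: "(J has_vector_derivative integral ?Q (\<lambda>x. g' x b)) (at 0)"
    by (simp add: at_within_Icc_at)
  have "(J has_vector_derivative 0) (at 0)"
  proof (rule has_vector_derivative_transform_within_open[of "\<lambda>_. J 0" _ _ "{-1<..<1}"])
    show "J 0 = J t" if "t \<in> {-1<..<1}" for t using J[of t] that by simp
  qed (auto intro!: derivative_eq_intros)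
  with D1 show ?thesis using vector_derivative_unique_at by blast
qed

text \<open>The kink on the unit sphere disappears on squaring, and the derivative of the square is
  again a multiple of \<open>bump\<close>, hence continuous.\<close>

definition bump :: "'a::euclidean_space \<Rightarrow> real" where
  "bump x = max 0 (1 - x \<bullet> x)"

lemma bump_continuous [continuous_intros]:
  assumes "continuous_on S g" shows "continuous_on S (\<lambda>x. bump (g x))"
  unfolding bump_def by (intro continuous_intros assms)

lemma bump_eq_0: "norm x \<ge> 1 \<Longrightarrow> bump x = 0"
  by (simp add: bump_def dot_square_norm)

lemma bump_sq_has_derivative:
  "((\<lambda>x. (bump x)\<^sup>2) has_derivative (\<lambda>v. - 4 * bump x * (x \<bullet> v))) (at (x :: 'a::euclidean_space))"
proof -
  have *: "((\<lambda>s. (max 0 s)\<^sup>2) has_real_derivative 2 * max 0 s) (at s)" for s :: real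
  proof -
    consider "s > 0" | "s < 0" | "s = 0" by linarith
    then show ?thesis
    proof cases
      case 1
      have "((\<lambda>s. s\<^sup>2) has_real_derivative 2 * max 0 s) (at s)"
        using 1 by (auto intro!: derivative_eq_intros)
      then show ?thesis
        by (rule has_field_derivative_transform_within_open[of _ _ _ "{0<..}"]) (use 1 in auto)
    next
      case 2
      have "((\<lambda>s. 0) has_real_derivative 2 * max 0 s) (at s)"
        using 2 by auto
      then show ?thesis
        by (rule has_field_derivative_transform_within_open[of _ _ _ "{..<0}"]) (use 2 in auto)
    next
      case 3
      have "((\<lambda>h::real. (max 0 h)\<^sup>2 / h) \<longlongrightarrow> 0) (at 0)"
      proof (rule Lim_null_comparison[OF _ tendsto_rabs_zero[OF tendsto_ident_at]])
        have "norm ((max 0 h)\<^sup>2 / h) \<le> \<bar>h\<bar>" for h :: real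
          by (cases "h > 0") (auto simp: power2_eq_square max_def)
        then show "\<forall>\<^sub>F h in at 0. norm ((max 0 h)\<^sup>2 / h) \<le> \<bar>h\<bar>" by simp
      qed
      then show ?thesis using 3 by (simp add: has_field_derivative_iff)
    qed
  qed
  have "((\<lambda>x::'a. 1 - x \<bullet> x) has_derivative (\<lambda>v. - 2 * (x \<bullet> v))) (at x)"
    by (auto intro!: derivative_eq_intros simp: inner_commute)
  from has_derivative_compose[OF this has_field_derivative_imp_has_derivative[OF *]]
  show ?thesis unfolding bump_def by (simp add: mult_ac)
qed

text \<open>Integration by parts makes the moments \<open>\<integral> x\<^sub>b bump\<^sup>2 \<partial>\<^sub>c h\<close> symmetric in \<open>b\<close> and \<open>c\<close>,
  so the Dirac equation, multiplied by the conjugate of \<open>b\<close>, sees only their trace.\<close>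

lemma monogenic_radial_moment:
  fixes h :: "'n::{finite,linorder} clfun"
  assumes h: "h \<in> monogenic"
  shows "integral (cbox (- 2 *\<^sub>R One) (2 *\<^sub>R One)) (\<lambda>x. (bump x)\<^sup>2 *\<^sub>R frechet_derivative h (at x) x) = 0"
proof -
  let ?Q = "cbox (- 2 *\<^sub>R One) (2 *\<^sub>R One) :: 'n paravec set"
  define H where "H x = frechet_derivative h (at x)" for x
  note hD = monogenicD[OF h, folded H_def]
  have contH [continuous_intros]: "continuous_on S (\<lambda>x. H x v)" for S v
    using hD(2) continuous_on_subset by blast
  have conth [continuous_intros]: "continuous_on S h" for S using monogenic_continuous[OF h] .
  define J where "J b c = integral ?Q (\<lambda>x. ((x \<bullet> b) * (bump x)\<^sup>2) *\<^sub>R H x c)" for b c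
  have int_J: "(\<lambda>x. ((x \<bullet> b) * (bump x)\<^sup>2) *\<^sub>R H x c) integrable_on ?Q" for b c
    by (intro integrable_continuous continuous_intros)
  define S where "S b c = integral ?Q (\<lambda>x. (- 4 * bump x * (x \<bullet> b) * (x \<bullet> c)) *\<^sub>R h x)" for b c
  \<comment> \<open>The function integrated by parts is x_c \<open>bump\<close>^2 h. Off the
    diagonal the derivative of x_c in direction b vanishes, and what the kernel contributes is
    symmetric in b and c.\<close>
  have J_eq: "J c b = - S b c" if "b \<in> Basis" "c \<in> Basis" "b \<noteq> c" for b c
  proof -
    have "integral ?Q (\<lambda>x. ((b \<bullet> c) * (bump x)\<^sup>2 + (x \<bullet> c) * (- 4 * bump x * (x \<bullet> b))) *\<^sub>R h x
      + ((x \<bullet> c) * (bump x)\<^sup>2) *\<^sub>R H x b) = 0"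
    proof (rule integral_derivative_compact_support[where g = "\<lambda>x. ((x \<bullet> c) * (bump x)\<^sup>2) *\<^sub>R h x"
        and g' = "\<lambda>x v. ((v \<bullet> c) * (bump x)\<^sup>2 + (x \<bullet> c) * (- 4 * bump x * (x \<bullet> v))) *\<^sub>R h x
            + ((x \<bullet> c) * (bump x)\<^sup>2) *\<^sub>R H x v"])
      show "((\<lambda>x. ((x \<bullet> c) * (bump x)\<^sup>2) *\<^sub>R h x) has_derivative
        (\<lambda>v. ((v \<bullet> c) * (bump x)\<^sup>2 + (x \<bullet> c) * (- 4 * bump x * (x \<bullet> v))) *\<^sub>R h x
            + ((x \<bullet> c) * (bump x)\<^sup>2) *\<^sub>R H x v)) (at x)" for x
        by (rule has_derivative_eq_rhs, rule has_derivative_scaleR, rule has_derivative_mult,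
            rule bounded_linear_imp_has_derivative, rule bounded_linear_inner_left,
            rule bump_sq_has_derivative, rule hD(1)) (simp add: fun_eq_iff algebra_simps)
      show "continuous_on UNIV (\<lambda>x. ((b \<bullet> c) * (bump x)\<^sup>2 + (x \<bullet> c) * (- 4 * bump x * (x \<bullet> b))) *\<^sub>R h x
            + ((x \<bullet> c) * (bump x)\<^sup>2) *\<^sub>R H x b)"
        by (intro continuous_intros hD(2) monogenic_continuous[OF h])
    qed (use that in \<open>auto simp: bump_eq_0\<close>)
    also have "b \<bullet> c = 0" using that by (simp add: inner_not_same_Basis)
    finally have "integral ?Q (\<lambda>x. (- 4 * bump x * (x \<bullet> b) * (x \<bullet> c)) *\<^sub>R h x
      + ((x \<bullet> c) * (bump x)\<^sup>2) *\<^sub>R H x b) = 0" by (simp add: mult_ac)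
    then show ?thesis unfolding J_def S_def
      by (subst (asm) integral_add)
        (auto intro!: integrable_continuous continuous_intros simp: eq_neg_iff_add_eq_0 add.commute)
  qed
  have sym: "J b c = J c b" if "b \<in> Basis" "c \<in> Basis" for b c
  proof (cases "b = c")
    case False
    have "S b c = S c b" unfolding S_def by (simp add: mult_ac)
    then show ?thesis using J_eq[of b c] J_eq[of c b] that False by metis
  qed simp
  have row: "(\<Sum>c\<in>Basis. para c \<star> J b c) = 0" for b
  proof -
    have "(\<Sum>c\<in>Basis. para c \<star> J b c) =
        (\<Sum>c\<in>Basis. integral ?Q (\<lambda>x. para c \<star> (((x \<bullet> b) * (bump x)\<^sup>2) *\<^sub>R H x c)))"
      unfolding J_def
      using integral_linear[OF int_J cl_mult.bounded_linear_right] by (simp add: o_def)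
    also have "\<dots> = integral ?Q (\<lambda>x. \<Sum>c\<in>Basis. para c \<star> (((x \<bullet> b) * (bump x)\<^sup>2) *\<^sub>R H x c))"
      by (subst integral_sum)
        (auto intro!: integrable_continuous continuous_intros cl_mult.continuous_on)
    also have "\<dots> = 0"
      by (simp add: cl_mult.scaleR_right scaleR_sum_right[symmetric] hD(3))
    finally show ?thesis .
  qed
  \<comment> \<open>Each row is the Dirac equation integrated against x_b \<open>bump\<close>^2. The
    conjugates bring the double sum into the shape of one half of the polarisation identity.\<close>
  have "0 = (\<Sum>b\<in>Basis. para_conj b \<star> (\<Sum>c\<in>Basis. para c \<star> J b c))" by (simp add: row cl_mult.zero_right)
  also have "\<dots> = (\<Sum>b\<in>Basis. \<Sum>c\<in>Basis. para_conj b \<star> para c \<star> J b c)"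
    by (simp add: cl_mult.sum_right cl_mult_assoc)
  finally have z: "(\<Sum>b\<in>Basis. \<Sum>c\<in>Basis. para_conj b \<star> para c \<star> J b c) = 0" ..
  have "(\<Sum>b\<in>Basis. \<Sum>c\<in>Basis. para_conj c \<star> para b \<star> J b c) =
      (\<Sum>b\<in>Basis. \<Sum>c\<in>Basis. para_conj c \<star> para b \<star> J c b)"
    using sym by (intro sum.cong refl) metis
  also have "\<dots> = 0" by (subst sum.swap) (rule z)
  \<comment> \<open>By the symmetry of \<open>J\<close> the transposed double sum vanishes too;
    their sum is polarised and leaves only the diagonal.\<close>
  finally have "(\<Sum>b\<in>Basis. \<Sum>c\<in>Basis. (para_conj b \<star> para c + para_conj c \<star> para b) \<star> J b c) = 0"
    using z by (simp add: cl_mult.add_left sum.distrib)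
  moreover have "(\<Sum>c\<in>Basis. (para_conj b \<star> para c + para_conj c \<star> para b) \<star> J b c) = 2 *\<^sub>R J b b"
    if "b \<in> Basis" for b
  proof -
    have "(\<Sum>c\<in>Basis. (para_conj b \<star> para c + para_conj c \<star> para b) \<star> J b c) =
        (\<Sum>c\<in>Basis. if c = b then 2 *\<^sub>R J b b else 0)"
      using that by (intro sum.cong refl)
        (auto simp: para_conj_polarization cl_mult.scaleR_left cl_mult_one inner_not_same_Basis)
    then show ?thesis using that by simp
  qed
  ultimately have tr: "(\<Sum>b\<in>Basis. J b b) = 0"
    by (simp add: scaleR_sum_right[symmetric])
  have "integral ?Q (\<lambda>x. (bump x)\<^sup>2 *\<^sub>R H x x) = integral ?Q (\<lambda>x. \<Sum>b\<in>Basis. ((x \<bullet> b) * (bump x)\<^sup>2) *\<^sub>R H x b)"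
  proof (rule integral_cong)
    fix x
    have lin: "linear (H x)" using hD(1) has_derivative_linear by blast
    have "H x x = H x (\<Sum>b\<in>Basis. (x \<bullet> b) *\<^sub>R b)" by (simp only: euclidean_representation)
    then have "H x x = (\<Sum>b\<in>Basis. (x \<bullet> b) *\<^sub>R H x b)"
      by (simp add: linear_sum[OF lin] linear_scale[OF lin])
    then show "(bump x)\<^sup>2 *\<^sub>R H x x = (\<Sum>b\<in>Basis. ((x \<bullet> b) * (bump x)\<^sup>2) *\<^sub>R H x b)"
      by (simp add: scaleR_sum_right mult.commute)
  qed
  also have "\<dots> = (\<Sum>b\<in>Basis. J b b)"
    unfolding J_def by (subst integral_sum[OF finite_Basis int_J]) (rule refl)
  finally show ?thesis unfolding tr H_def .
qed

lemma monogenic_affine: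
  assumes f: "f \<in> monogenic"
  shows "(\<lambda>x. f (y + t *\<^sub>R x)) \<in> monogenic"
    and "frechet_derivative (\<lambda>x. f (y + t *\<^sub>R x)) (at x) v = t *\<^sub>R frechet_derivative f (at (y + t *\<^sub>R x)) v"
proof -
  let ?F = "\<lambda>x. frechet_derivative f (at x)"
  have lin: "linear (?F x)" for x using monogenicD(1)[OF f] has_derivative_linear by blast
  have "((\<lambda>x. f (y + t *\<^sub>R x)) has_derivative (\<lambda>v. ?F (y + t *\<^sub>R x) (t *\<^sub>R v))) (at x)" for x
    by (rule has_derivative_compose[OF _ monogenicD(1)[OF f]]) (auto intro!: derivative_eq_intros)
  then have d: "((\<lambda>x. f (y + t *\<^sub>R x)) has_derivative (\<lambda>v. t *\<^sub>R ?F (y + t *\<^sub>R x) v)) (at x)" for x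
    by (simp add: linear_scale[OF lin])
  then show "frechet_derivative (\<lambda>x. f (y + t *\<^sub>R x)) (at x) v = t *\<^sub>R ?F (y + t *\<^sub>R x) v"
    using frechet_derivative_at by metis
  show "(\<lambda>x. f (y + t *\<^sub>R x)) \<in> monogenic"
    by (rule monogenicI[OF d])
      (auto intro!: continuous_intros continuous_on_compose2[OF monogenicD(2)[OF f]]
        simp: cl_mult.scaleR_right scaleR_sum_right[symmetric] monogenicD(3)[OF f])
qed

text \<open>The weighted mean \<open>I t\<close> of \<open>f\<close> over the ball of radius t about
  y has as derivative 1/t times the radial moment of the rescaled function, which is monogenic. So
  the mean at t = 1 equals its value at t = 0.\<close>

lemma monogenic_mean_value:
  fixes f :: "'n::{finite,linorder} clfun"
  assumes f: "f \<in> monogenic"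
  shows "integral (cbox (- 2 *\<^sub>R One) (2 *\<^sub>R One)) (\<lambda>x. (bump x)\<^sup>2 *\<^sub>R f (y + x)) =
    integral (cbox (- 2 *\<^sub>R One) (2 *\<^sub>R One)) (\<lambda>x::'n paravec. (bump x)\<^sup>2) *\<^sub>R f y"
proof -
  let ?Q = "cbox (- 2 *\<^sub>R One) (2 *\<^sub>R One) :: 'n paravec set"
  let ?F = "\<lambda>x. frechet_derivative f (at x)"
  define I where "I t = integral ?Q (\<lambda>x. (bump x)\<^sup>2 *\<^sub>R f (y + t *\<^sub>R x))" for t :: real
  have lin: "linear (?F x)" for x using monogenicD(1)[OF f] has_derivative_linear by blast
  have Fxx: "?F z x = (\<Sum>b\<in>Basis. (x \<bullet> b) *\<^sub>R ?F z b)" for z x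
  proof -
    have "?F z x = ?F z (\<Sum>b\<in>Basis. (x \<bullet> b) *\<^sub>R b)" by (simp only: euclidean_representation)
    then show ?thesis by (simp add: linear_sum[OF lin] linear_scale[OF lin])
  qed
  \<comment> \<open>Monogenicity gives continuity of the derivative for each fixed direction only.
    Expanding the moving direction x in the basis yields joint continuity in (t, x).\<close>
  have eq: "(\<lambda>(t, x). (bump x)\<^sup>2 *\<^sub>R ?F (y + t *\<^sub>R x) x) =
      (\<lambda>p. (bump (snd p))\<^sup>2 *\<^sub>R (\<Sum>b\<in>Basis. (snd p \<bullet> b) *\<^sub>R ?F (y + fst p *\<^sub>R snd p) b))"
    by (rule ext, simp only: split_beta, subst Fxx, rule refl)
  have D: "(I has_vector_derivative integral ?Q (\<lambda>x. (bump x)\<^sup>2 *\<^sub>R ?F (y + t *\<^sub>R x) x)) (at t)" for t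
    unfolding I_def
  proof (rule leibniz_rule_vector_derivative[of UNIV, simplified])
    fix t and x :: "'n paravec"
    have "((\<lambda>t. (bump x)\<^sup>2 *\<^sub>R f (y + t *\<^sub>R x)) has_derivative (\<lambda>h. (bump x)\<^sup>2 *\<^sub>R ?F (y + t *\<^sub>R x) (h *\<^sub>R x))) (at t)"
      by (intro has_derivative_scaleR_right has_derivative_compose[OF _ monogenicD(1)[OF f]])
        (auto intro!: derivative_eq_intros)
    then show "((\<lambda>t. (bump x)\<^sup>2 *\<^sub>R f (y + t *\<^sub>R x)) has_vector_derivative (bump x)\<^sup>2 *\<^sub>R ?F (y + t *\<^sub>R x) x) (at t)"
      by (simp add: has_vector_derivative_def linear_scale[OF lin] mult.commute)
  next
    show "(\<lambda>x. (bump x)\<^sup>2 *\<^sub>R f (y + t *\<^sub>R x)) integrable_on ?Q" for t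
      by (intro integrable_continuous continuous_intros continuous_on_compose2[OF monogenic_continuous[OF f, of UNIV]]) auto
  next
    show "continuous_on (UNIV \<times> ?Q) (\<lambda>(t, x). (bump x)\<^sup>2 *\<^sub>R ?F (y + t *\<^sub>R x) x)"
      unfolding eq
      by (intro continuous_intros continuous_on_compose2[OF monogenicD(2)[OF f]]) auto
  qed
  have Z: "integral ?Q (\<lambda>x. (bump x)\<^sup>2 *\<^sub>R ?F (y + t *\<^sub>R x) x) = 0" if "t \<noteq> 0" for t
  proof -
    have "t *\<^sub>R integral ?Q (\<lambda>x. (bump x)\<^sup>2 *\<^sub>R ?F (y + t *\<^sub>R x) x) = 0"
      using monogenic_radial_moment[OF monogenic_affine(1)[OF f, of y t]]
      unfolding monogenic_affine(2)[OF f] by (simp add: mult.commute flip: integral_cmul)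
    then show ?thesis using that by simp
  qed
  \<comment> \<open>The intermediate point lies in the open interval, so it does not matter that
    \<open>Z\<close> excludes t = 0.\<close>
  have "\<exists>t\<in>{0<..<1}. norm (I 1 - I 0) \<le> norm ((1 - 0) *\<^sub>R integral ?Q (\<lambda>x. (bump x)\<^sup>2 *\<^sub>R ?F (y + t *\<^sub>R x) x))"
  proof (rule mvt_general)
    show "continuous_on {0..1} I"
      by (meson D continuous_at_imp_continuous_on has_vector_derivative_continuous)
  qed (use D in \<open>auto simp: has_vector_derivative_def\<close>)
  then have "I 1 = I 0" using Z by force
  moreover have "I 0 = integral ?Q (\<lambda>x. (bump x)\<^sup>2) *\<^sub>R f y"
    unfolding I_def
    by (simp, intro integral_unique has_integral_scaleR_left integrable_integral
        integrable_continuous continuous_intros)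
  ultimately show ?thesis by (simp add: I_def)
qed

text \<open>A change of variables moves y from the argument of \<open>f\<close> into the kernel,
  over a cube that no longer depends on y; therefore smoothness of the kernel passes to
  \<open>f\<close>. The margin 2 makes the cube of half-width 2 about y fit into the fixed
  one.\<close>

lemma monogenic_integral_representation:
  obtains \<kappa> where "\<kappa> > 0"
    "\<And>(f :: 'n::{finite,linorder} clfun) (y :: 'n paravec) R. f \<in> monogenic \<Longrightarrow> norm y + 2 \<le> R \<Longrightarrow>
      integral (cbox (- R *\<^sub>R One) (R *\<^sub>R One)) (\<lambda>x. (bump (x - y))\<^sup>2 *\<^sub>R f x) = \<kappa> *\<^sub>R f y"
proof
  let ?Q = "cbox (- 2 *\<^sub>R One) (2 *\<^sub>R One) :: 'n paravec set"
  let ?k = "integral ?Q (\<lambda>x. (bump x)\<^sup>2)"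
  have c: "continuous_on ?Q (\<lambda>x. (bump x)\<^sup>2)" by (intro continuous_intros)
  have 0: "0 \<in> box (- 2 *\<^sub>R One) (2 *\<^sub>R One :: 'n paravec)"
    by (simp add: mem_box inner_sum_left_Basis)
  then have ne: "box (- 2 *\<^sub>R One) (2 *\<^sub>R One :: 'n paravec) \<noteq> {}" by blast
  have "0 \<in> ?Q" using 0 box_subset_cbox by blast
  moreover have "(bump (0::'n paravec))\<^sup>2 \<noteq> 0" by (simp add: bump_def)
  ultimately have "?k \<noteq> 0" using integral_cbox_eq_0_iff[OF c ne] by auto
  moreover have "?k \<ge> 0" by (intro integral_nonneg integrable_continuous c) auto
  ultimately show "?k > 0" by simp
  fix f :: "'n clfun" and y :: "'n paravec" and R :: real
  assume f: "f \<in> monogenic" and R: "norm y + 2 \<le> R"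
  let ?g = "\<lambda>x. (bump (x - y))\<^sup>2 *\<^sub>R f x"
  have yb: "\<bar>y \<bullet> i\<bar> \<le> R - 2" if "i \<in> Basis" for i
    using Basis_le_norm[OF that, of y] R by linarith
  have cg: "continuous_on S ?g" for S by (intro continuous_intros monogenic_continuous f)
  have "(?g has_integral integral (cbox (- 2 *\<^sub>R One + y) (2 *\<^sub>R One + y)) ?g) (cbox (- R *\<^sub>R One) (R *\<^sub>R One))"
  proof (rule has_integral_on_superset)
    show "(?g has_integral integral (cbox (- 2 *\<^sub>R One + y) (2 *\<^sub>R One + y)) ?g) (cbox (- 2 *\<^sub>R One + y) (2 *\<^sub>R One + y))"
      by (intro integrable_integral integrable_continuous cg)
    show "?g x = 0" if "x \<notin> cbox (- 2 *\<^sub>R One + y) (2 *\<^sub>R One + y)" for x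
    proof -
      have "x - y \<notin> cbox (- 2 *\<^sub>R One) (2 *\<^sub>R One)"
        using that by (auto simp: mem_box inner_diff_left inner_add_left algebra_simps)
      then have "norm (x - y) \<ge> 2" using norm_le_imp_mem_cbox_One[of "x - y" 2] by fastforce
      then show ?thesis by (simp add: bump_eq_0)
    qed
    show "cbox (- 2 *\<^sub>R One + y) (2 *\<^sub>R One + y) \<subseteq> cbox (- R *\<^sub>R One) (R *\<^sub>R One)"
      using yb by (intro subset_box_imp(1))
        (auto simp: inner_add_left inner_diff_left inner_sum_left_Basis abs_le_iff, fastforce+)
  qed
  then have "integral (cbox (- R *\<^sub>R One) (R *\<^sub>R One)) ?g = integral (cbox (- 2 *\<^sub>R One + y) (2 *\<^sub>R One + y)) ?g"
    by (rule integral_unique)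
  also have "\<dots> = integral ?Q (\<lambda>x. ?g (x + y))"
    using integral_shift_cbox[of "- 2 *\<^sub>R One + y" y "2 *\<^sub>R One + y" ?g] by simp
  also have "\<dots> = ?k *\<^sub>R f y"
    using monogenic_mean_value[OF f, of y] by (simp add: add.commute)
  finally show "integral (cbox (- R *\<^sub>R One) (R *\<^sub>R One)) ?g = ?k *\<^sub>R f y" .
qed

subsection \<open>Limits and derivatives of monogenic functions\<close>

text \<open>Requiring the bound only where the kernel is nonzero allows integrating over a cube
  while knowing the function on a ball.\<close>

lemma kernel_integral_bound:
  fixes g :: "'a::euclidean_space \<Rightarrow> 'b::euclidean_space"
  assumes "continuous_on (cbox l u) a" "continuous_on (cbox l u) g"
    and M: "\<And>x. x \<in> cbox l u \<Longrightarrow> a x \<noteq> 0 \<Longrightarrow> norm (g x) \<le> M"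
  shows "norm (integral (cbox l u) (\<lambda>x. a x *\<^sub>R g x)) \<le> M * integral (cbox l u) (\<lambda>x. \<bar>a x\<bar>)"
proof -
  have "norm (integral (cbox l u) (\<lambda>x. a x *\<^sub>R g x)) \<le> integral (cbox l u) (\<lambda>x. M * \<bar>a x\<bar>)"
  proof (rule integral_norm_bound_integral)
    fix x assume x: "x \<in> cbox l u"
    show "norm (a x *\<^sub>R g x) \<le> M * \<bar>a x\<bar>"
      using mult_left_mono[OF M[OF x], of "\<bar>a x\<bar>"] by (cases "a x = 0") (auto simp: mult.commute)
  qed (intro integrable_continuous continuous_intros assms)+
  then show ?thesis by simp
qed

lemma kernel_integral_tendsto:
  fixes g :: "'a::euclidean_space \<Rightarrow> 'b::euclidean_space"
  assumes a: "continuous_on (cbox l u) a" and f: "\<And>k. continuous_on (cbox l u) (f k)"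
    and g: "continuous_on (cbox l u) g" and lim: "uniform_limit (cbox l u) f g F"
  shows "((\<lambda>k. integral (cbox l u) (\<lambda>x. a x *\<^sub>R f k x)) \<longlongrightarrow> integral (cbox l u) (\<lambda>x. a x *\<^sub>R g x)) F"
proof (rule tendstoI)
  fix e :: real assume e: "e > 0"
  let ?A = "integral (cbox l u) (\<lambda>x. \<bar>a x\<bar>)"
  have A: "?A \<ge> 0" by (intro integral_nonneg integrable_continuous continuous_intros a) auto
  define d where "d = e / (?A + 1)"
  have d: "d > 0" using A e by (simp add: d_def)
  have dA: "d * ?A < e" using A e by (simp add: d_def field_simps)
  from uniform_limitD[OF lim d] show "\<forall>\<^sub>F k in F. dist (integral (cbox l u) (\<lambda>x. a x *\<^sub>R f k x)) (integral (cbox l u) (\<lambda>x. a x *\<^sub>R g x)) < e"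
  proof (rule eventually_mono)
    fix k assume k: "\<forall>x\<in>cbox l u. dist (f k x) (g x) < d"
    have "integral (cbox l u) (\<lambda>x. a x *\<^sub>R f k x) - integral (cbox l u) (\<lambda>x. a x *\<^sub>R g x) =
        integral (cbox l u) (\<lambda>x. a x *\<^sub>R (f k x - g x))"
      by (subst integral_diff[symmetric])
        (auto simp: scaleR_diff_right intro!: integrable_continuous continuous_intros a f g)
    also have "norm \<dots> \<le> d * ?A"
      by (rule kernel_integral_bound) (use k in \<open>auto intro!: continuous_intros a f g simp: dist_norm less_imp_le\<close>)
    finally show "dist (integral (cbox l u) (\<lambda>x. a x *\<^sub>R f k x)) (integral (cbox l u) (\<lambda>x. a x *\<^sub>R g x)) < e"
      using dA by (simp add: dist_norm)
  qed
qed

lemma bump_integral_has_derivative: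
  fixes f :: "'a::euclidean_space \<Rightarrow> 'b::euclidean_space"
  assumes f: "continuous_on (cbox l u) f"
  shows "((\<lambda>y. integral (cbox l u) (\<lambda>x. (bump (x - y))\<^sup>2 *\<^sub>R f x)) has_derivative
    (\<lambda>v. integral (cbox l u) (\<lambda>x. (4 * bump (x - y) * ((x - y) \<bullet> v)) *\<^sub>R f x))) (at y)"
proof -
  \<comment> \<open>Differentiation under the integral sign needs the derivative to be continuous in
    operator norm, hence the encoding as a bounded linear map.\<close>
  define D where "D y x = (4 * bump (x - y)) *\<^sub>R (blinfun_scaleR_left (f x) o\<^sub>L blinfun_inner_right (x - y))"
    for x y :: 'a
  have D_apply: "blinfun_apply (D y x) v = (4 * bump (x - y) * ((x - y) \<bullet> v)) *\<^sub>R f x" for x y v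
    by (simp add: D_def blinfun.scaleR_left)
  have f': "continuous_on (UNIV \<times> cbox l u) (\<lambda>p :: 'a \<times> 'a. f (snd p))"
    by (rule continuous_on_compose2[OF f]) (auto intro!: continuous_intros)
  have contD: "continuous_on (UNIV \<times> cbox l u) (\<lambda>(y, x). D y x)"
    unfolding D_def split_beta by (intro continuous_intros f')
  have contD': "continuous_on (cbox l u) (\<lambda>x. D y x)" for y
    unfolding D_def by (intro continuous_intros f)
  have "((\<lambda>y. integral (cbox l u) (\<lambda>x. (bump (x - y))\<^sup>2 *\<^sub>R f x)) has_derivative
      blinfun_apply (integral (cbox l u) (D y))) (at y)"
  proof (rule leibniz_rule[of UNIV, simplified])
    fix x y :: 'a
    have "((\<lambda>y. x - y) has_derivative (\<lambda>v. - v)) (at y)"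
      by (auto intro!: derivative_eq_intros)
    from has_derivative_compose[OF this bump_sq_has_derivative]
    show "((\<lambda>y. (bump (x - y))\<^sup>2 *\<^sub>R f x) has_derivative blinfun_apply (D y x)) (at y)"
      unfolding D_apply by (rule has_derivative_eq_rhs[OF has_derivative_scaleR_left]) (simp add: fun_eq_iff)
  qed (auto intro!: integrable_continuous continuous_intros f contD[simplified])
  moreover have "blinfun_apply (integral (cbox l u) (D y)) =
     (\<lambda>v. integral (cbox l u) (\<lambda>x. (4 * bump (x - y) * ((x - y) \<bullet> v)) *\<^sub>R f x))"
    using blinfun_apply_integral[OF integrable_continuous[OF contD']] by (simp add: D_apply fun_eq_iff)
  ultimately show ?thesis by simp
qed

text \<open>Only continuity and the representation formula are assumed. A locally uniform limit
  inherits both before anything is known about its differentiability.\<close>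

lemma bump_repr_has_derivative:
  fixes f :: "'a::euclidean_space \<Rightarrow> 'b::euclidean_space"
  assumes f: "continuous_on UNIV f" and \<kappa>: "\<kappa> > 0"
    and rep: "\<And>y. norm y + 2 \<le> R \<Longrightarrow> integral (cbox (- R *\<^sub>R One) (R *\<^sub>R One)) (\<lambda>x. (bump (x - y))\<^sup>2 *\<^sub>R f x) = \<kappa> *\<^sub>R f y"
    and y: "norm y + 2 < R"
  shows "(f has_derivative (\<lambda>v. (1 / \<kappa>) *\<^sub>R
    integral (cbox (- R *\<^sub>R One) (R *\<^sub>R One)) (\<lambda>x. (4 * bump (x - y) * ((x - y) \<bullet> v)) *\<^sub>R f x))) (at y)"
proof (rule has_derivative_transform_within_open)
  show "((\<lambda>y. (1 / \<kappa>) *\<^sub>R integral (cbox (- R *\<^sub>R One) (R *\<^sub>R One)) (\<lambda>x. (bump (x - y))\<^sup>2 *\<^sub>R f x)) has_derivative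
    (\<lambda>v. (1 / \<kappa>) *\<^sub>R integral (cbox (- R *\<^sub>R One) (R *\<^sub>R One)) (\<lambda>x. (4 * bump (x - y) * ((x - y) \<bullet> v)) *\<^sub>R f x))) (at y)"
    using f continuous_on_subset by (intro has_derivative_scaleR_right bump_integral_has_derivative) blast
  show "open (ball 0 (R - 2) :: 'a set)" by simp
  show "y \<in> ball 0 (R - 2)" using y by simp
  show "(1 / \<kappa>) *\<^sub>R integral (cbox (- R *\<^sub>R One) (R *\<^sub>R One)) (\<lambda>x. (bump (x - z))\<^sup>2 *\<^sub>R f x) = f z"
    if "z \<in> ball 0 (R - 2)" for z
    using rep[of z] that \<kappa> by simp
qed

lemma frechet_derivative_eqI:
  "(f has_derivative f') (at x) \<Longrightarrow> frechet_derivative f (at x) = f'"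
  using frechet_derivative_at by metis

text \<open>The representation formula survives the limit and supplies a derivative, in which the
  Dirac equation passes to the limit under the integral. An arbitrary filter covers both sequences
  and the nets of finite partial sums.\<close>

lemma monogenic_limit:
  fixes g :: "'n::{finite,linorder} clfun"
  assumes F: "F \<noteq> bot" and f: "\<And>k. f k \<in> monogenic" and lim: "\<And>R. uniform_limit (cball 0 R) f g F"
  shows "g \<in> monogenic"
proof -
  let ?Q = "\<lambda>R. cbox (- R *\<^sub>R One) (R *\<^sub>R One) :: 'n paravec set"
  obtain \<kappa> where \<kappa>: "\<kappa> > 0" and rep: "\<And>(f :: 'n clfun) (y :: 'n paravec) R.
      f \<in> monogenic \<Longrightarrow> norm y + 2 \<le> R \<Longrightarrow> integral (?Q R) (\<lambda>x. (bump (x - y))\<^sup>2 *\<^sub>R f x) = \<kappa> *\<^sub>R f y"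
    using monogenic_integral_representation by blast
  have contf: "continuous_on S (f k)" for S k by (rule monogenic_continuous[OF f])
  have "continuous_on (cball 0 R) g" for R
    by (rule uniform_limit_theorem[OF _ lim F]) (simp add: contf)
  then have "continuous_on (ball 0 R) g" for R
    using ball_subset_cball continuous_on_subset by blast
  then have "isCont g x" for x
    using continuous_on_eq_continuous_at[OF open_ball, of 0 "norm x + 1" g] by auto
  then have g: "continuous_on S g" for S using continuous_at_imp_continuous_on by blast
  have limQ: "uniform_limit (?Q R) f g F" for R
  proof -
    obtain B where "\<forall>x\<in>?Q R. norm x \<le> B" using bounded_cbox unfolding bounded_iff by blast
    then have "?Q R \<subseteq> cball 0 B" by auto
    then show ?thesis using uniform_limit_on_subset[OF lim] by blast
  qed
  have pt: "((\<lambda>k. f k y) \<longlongrightarrow> g y) F" for y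
    by (rule tendsto_uniform_limitI[OF lim[of "norm y"]]) simp
  have rep_g: "integral (?Q R) (\<lambda>x. (bump (x - y))\<^sup>2 *\<^sub>R g x) = \<kappa> *\<^sub>R g y"
    if "norm y + 2 \<le> R" for y R
  proof (rule tendsto_unique[OF F])
    show "((\<lambda>k. integral (?Q R) (\<lambda>x. (bump (x - y))\<^sup>2 *\<^sub>R f k x)) \<longlongrightarrow> integral (?Q R) (\<lambda>x. (bump (x - y))\<^sup>2 *\<^sub>R g x)) F"
      by (rule kernel_integral_tendsto[OF _ contf g limQ]) (intro continuous_intros)
    show "((\<lambda>k. integral (?Q R) (\<lambda>x. (bump (x - y))\<^sup>2 *\<^sub>R f k x)) \<longlongrightarrow> \<kappa> *\<^sub>R g y) F"
      using that rep[OF f] by (simp add: tendsto_scaleR[OF tendsto_const pt])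
  qed
  define T where "T R h y v = (1 / \<kappa>) *\<^sub>R integral (?Q R) (\<lambda>x. (4 * bump (x - y) * ((x - y) \<bullet> v)) *\<^sub>R h x)"
    for R y v and h :: "'n clfun"
  have der: "(h has_derivative T R h y) (at y)"
    if "continuous_on UNIV h" "\<And>y R. norm y + 2 \<le> R \<Longrightarrow> integral (?Q R) (\<lambda>x. (bump (x - y))\<^sup>2 *\<^sub>R h x) = \<kappa> *\<^sub>R h y"
      "norm y + 2 < R" for h y R
    unfolding T_def by (rule bump_repr_has_derivative[OF that(1) \<kappa> that(2,3)])
  have derg: "(g has_derivative T R g y) (at y)" if "norm y + 2 < R" for R y
    using der[OF g rep_g that] .
  have derf: "(f k has_derivative T R (f k) y) (at y)" if "norm y + 2 < R" for R y k
    using der[OF contf rep[OF f] that] .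
  show ?thesis
  proof (rule monogenicI)
    show "(g has_derivative T (norm y + 3) g y) (at y)" for y by (rule derg) simp
    show "continuous_on UNIV (\<lambda>y. T (norm y + 3) g y v)" for v
    proof (rule continuous_at_imp_continuous_on, rule ballI)
      fix y0 :: "'n paravec"
      \<comment> \<open>The cube in the derivative formula moves with y. Near \<open>y0\<close> one
        common cube serves all y, and uniqueness of the derivative identifies the two
        formulas.\<close>
      define R where "R = norm y0 + 4"
      have "continuous_on (ball y0 1) (\<lambda>y. T R g y v)"
        unfolding T_def
      proof (intro continuous_intros integral_continuous_on_param)
        show "continuous_on (ball y0 1 \<times> ?Q R) (\<lambda>(y, x). (4 * bump (x - y) * ((x - y) \<bullet> v)) *\<^sub>R g x)"
          unfolding split_beta
          by (intro continuous_intros continuous_on_compose2[OF g[of UNIV]]) auto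
      qed
      moreover have "T R g y v = T (norm y + 3) g y v" if "y \<in> ball y0 1" for y
      proof -
        have "norm y < norm y0 + 1" using that norm_triangle_sub[of y y0] by (simp add: dist_norm norm_minus_commute)
        then have "(g has_derivative T R g y) (at y)" "(g has_derivative T (norm y + 3) g y) (at y)"
          by (auto intro!: derg simp: R_def)
        then show ?thesis using has_derivative_unique by metis
      qed
      ultimately have "continuous_on (ball y0 1) (\<lambda>y. T (norm y + 3) g y v)"
        using continuous_on_cong[OF refl] by (metis (no_types, lifting))
      then show "isCont (\<lambda>y. T (norm y + 3) g y v) y0"
        by (rule continuous_on_interior) simp
    qed
    fix y :: "'n paravec"
    let ?R = "norm y + 3"
    have "((\<lambda>k. \<Sum>b\<in>Basis. para b \<star> T ?R (f k) y b) \<longlongrightarrow> (\<Sum>b\<in>Basis. para b \<star> T ?R g y b)) F"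
      unfolding T_def
      by (intro tendsto_sum cl_mult.tendsto tendsto_scaleR tendsto_const kernel_integral_tendsto contf g limQ continuous_intros)
    moreover have "(\<Sum>b\<in>Basis. para b \<star> T ?R (f k) y b) = 0" for k
      using monogenicD(3)[OF f, of k y] frechet_derivative_eqI[OF derf[of y ?R k]] by simp
    ultimately show "(\<Sum>b\<in>Basis. para b \<star> T ?R g y b) = 0"
      using tendsto_unique[OF F _ tendsto_const] by simp
  qed
qed

text \<open>Rescale the ball to the unit ball about 0 and estimate the differentiated kernel, which
  vanishes outside it.\<close>

lemma monogenic_deriv_bound:
  obtains C where "C \<ge> 1"
    "\<And>(f :: 'n::{finite,linorder} clfun) (y :: 'n paravec) r M v. f \<in> monogenic \<Longrightarrow> r > 0 \<Longrightarrow>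
      (\<And>x. x \<in> cball y r \<Longrightarrow> norm (f x) \<le> M) \<Longrightarrow> norm (frechet_derivative f (at y) v) \<le> C * M / r * norm v"
proof -
  let ?Q = "\<lambda>R. cbox (- R *\<^sub>R One) (R *\<^sub>R One) :: 'n paravec set"
  obtain \<kappa> where \<kappa>: "\<kappa> > 0" and rep: "\<And>(f :: 'n clfun) (y :: 'n paravec) R.
      f \<in> monogenic \<Longrightarrow> norm y + 2 \<le> R \<Longrightarrow> integral (?Q R) (\<lambda>x. (bump (x - y))\<^sup>2 *\<^sub>R f x) = \<kappa> *\<^sub>R f y"
    using monogenic_integral_representation by blast
  define A where "A = integral (?Q 3) (\<lambda>x. 4 * bump x * norm x)"
  have "norm (frechet_derivative f (at y) v) \<le> max 1 (A / \<kappa>) * M / r * norm v"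
    if f: "f \<in> monogenic" and r: "r > 0" and M: "\<And>x. x \<in> cball y r \<Longrightarrow> norm (f x) \<le> M"
    for f :: "'n clfun" and y v :: "'n paravec" and r M
  proof -
    define h where "h x = f (y + r *\<^sub>R x)" for x
    have h: "h \<in> monogenic" unfolding h_def by (rule monogenic_affine(1)[OF f])
    have M0: "M \<ge> 0" using M[of y] r norm_ge_zero order_trans by (metis centre_in_cball less_imp_le)
    have "(h has_derivative (\<lambda>v. (1 / \<kappa>) *\<^sub>R integral (?Q 3) (\<lambda>x. (4 * bump (x - 0) * ((x - 0) \<bullet> v)) *\<^sub>R h x))) (at 0)"
      by (rule bump_repr_has_derivative[OF monogenic_continuous[OF h] \<kappa> rep[OF h]]) auto
    then have eq: "frechet_derivative h (at 0) v = (1 / \<kappa>) *\<^sub>R integral (?Q 3) (\<lambda>x. (4 * bump x * (x \<bullet> v)) *\<^sub>R h x)"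
      by (simp add: frechet_derivative_eqI)
    have "norm (integral (?Q 3) (\<lambda>x. (4 * bump x * (x \<bullet> v)) *\<^sub>R h x)) \<le> M * integral (?Q 3) (\<lambda>x. \<bar>4 * bump x * (x \<bullet> v)\<bar>)"
    proof (rule kernel_integral_bound)
      fix x :: "'n paravec" assume "4 * bump x * (x \<bullet> v) \<noteq> 0"
      then have "norm x < 1" using bump_eq_0[of x] by fastforce
      then have "y + r *\<^sub>R x \<in> cball y r" using r by (simp add: dist_norm mult_left_le)
      then show "norm (h x) \<le> M" using M by (simp add: h_def)
    qed (intro continuous_intros monogenic_continuous[OF h])+
    also have "integral (?Q 3) (\<lambda>x. \<bar>4 * bump x * (x \<bullet> v)\<bar>) \<le> integral (?Q 3) (\<lambda>x. 4 * bump x * norm x * norm v)"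
    proof (rule integral_le)
      fix x :: "'n paravec"
      have "bump x \<ge> 0" by (simp add: bump_def)
      then show "\<bar>4 * bump x * (x \<bullet> v)\<bar> \<le> 4 * bump x * norm x * norm v"
        using Cauchy_Schwarz_ineq2[of x v] by (simp add: abs_mult mult.assoc mult_left_mono)
    qed (intro integrable_continuous continuous_intros)+
    also have "\<dots> = A * norm v" by (simp add: A_def)
    finally have "norm (integral (?Q 3) (\<lambda>x. (4 * bump x * (x \<bullet> v)) *\<^sub>R h x)) \<le> M * (A * norm v)"
      using M0 by (simp add: mult_left_mono)
    then have "norm (frechet_derivative h (at 0) v) \<le> (A / \<kappa>) * M * norm v"
      unfolding eq using \<kappa> by (simp add: field_simps)
    also have "\<dots> \<le> max 1 (A / \<kappa>) * M * norm v"
      using M0 by (intro mult_right_mono) auto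
    finally have "norm (frechet_derivative h (at 0) v) \<le> max 1 (A / \<kappa>) * M * norm v" .
    moreover have "frechet_derivative h (at 0) v = r *\<^sub>R frechet_derivative f (at y) v"
      unfolding h_def monogenic_affine(2)[OF f] by simp
    ultimately show ?thesis using r by (simp add: field_simps)
  qed
  then show ?thesis using that[of "max 1 (A / \<kappa>)"] by simp
qed

section \<open>Linear operations and locally uniform limits\<close>

lemma monogenic_add:
  assumes f: "f \<in> monogenic" and g: "g \<in> monogenic"
  shows "(\<lambda>x. f x + g x) \<in> monogenic"
    and "frechet_derivative (\<lambda>x. f x + g x) (at x) v = frechet_derivative f (at x) v + frechet_derivative g (at x) v"
proof -
  have d: "((\<lambda>x. f x + g x) has_derivative (\<lambda>v. frechet_derivative f (at x) v + frechet_derivative g (at x) v)) (at x)" for x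
    by (intro has_derivative_add monogenicD(1) f g)
  show "(\<lambda>x. f x + g x) \<in> monogenic"
    by (rule monogenicI[OF d])
      (auto intro!: continuous_intros monogenicD(2) f g
        simp: cl_mult.add_right sum.distrib monogenicD(3)[OF f] monogenicD(3)[OF g])
  show "frechet_derivative (\<lambda>x. f x + g x) (at x) v = frechet_derivative f (at x) v + frechet_derivative g (at x) v"
    using frechet_derivative_eqI[OF d] by simp
qed

lemma monogenic_mult_right:
  assumes f: "f \<in> monogenic"
  shows "(\<lambda>x. f x \<star> a) \<in> monogenic"
    and "frechet_derivative (\<lambda>x. f x \<star> a) (at x) v = frechet_derivative f (at x) v \<star> a"
proof -
  have d: "((\<lambda>x. f x \<star> a) has_derivative (\<lambda>v. frechet_derivative f (at x) v \<star> a)) (at x)" for x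
    by (rule bounded_linear.has_derivative[OF cl_mult.bounded_linear_left monogenicD(1)[OF f]])
  show "(\<lambda>x. f x \<star> a) \<in> monogenic"
    by (rule monogenicI[OF d])
      (auto intro!: cl_mult.continuous_on continuous_intros monogenicD(2)[OF f]
        simp: cl_mult_assoc[symmetric] cl_mult.sum_left[symmetric] monogenicD(3)[OF f] cl_mult.zero_left)
  show "frechet_derivative (\<lambda>x. f x \<star> a) (at x) v = frechet_derivative f (at x) v \<star> a"
    using frechet_derivative_eqI[OF d] by simp
qed

text \<open>Lets right linearity over the algebra account for real scalars as well.\<close>

lemma cl_mult_scaleR_one: "a \<star> (c *\<^sub>R cl_one) = c *\<^sub>R a"
  by (simp add: cl_mult.scaleR_right cl_mult_one)

lemma monogenic_scaleR:
  assumes f: "f \<in> monogenic"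
  shows "(\<lambda>x. c *\<^sub>R f x) \<in> monogenic"
    and "frechet_derivative (\<lambda>x. c *\<^sub>R f x) (at x) v = c *\<^sub>R frechet_derivative f (at x) v"
  using monogenic_mult_right[OF f, of "c *\<^sub>R cl_one"] by (simp_all add: cl_mult_scaleR_one)

lemma monogenic_diff:
  assumes f: "f \<in> monogenic" and g: "g \<in> monogenic"
  shows "(\<lambda>x. f x - g x) \<in> monogenic"
    and "frechet_derivative (\<lambda>x. f x - g x) (at x) v = frechet_derivative f (at x) v - frechet_derivative g (at x) v"
  using monogenic_add[OF f monogenic_scaleR(1)[OF g, of "-1"]] monogenic_scaleR(2)[OF g, of "-1"]
  by simp_all

lemma monogenic_const: "(\<lambda>x. a) \<in> monogenic"
  by (rule monogenicI[of _ "\<lambda>x v. 0"]) (auto simp: cl_mult.zero_right)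

lemma monogenic_sum:
  assumes "\<And>i. i \<in> I \<Longrightarrow> f i \<in> monogenic"
  shows "(\<lambda>x. \<Sum>i\<in>I. f i x) \<in> monogenic"
  using assms
  by (induction I rule: infinite_finite_induct) (auto intro!: monogenic_const monogenic_add(1))

text \<open>The first-order Cauchy estimate on balls of radius 1, applied to the difference from the
  limit; enlarging R by 1 leaves room for these balls.\<close>

lemma monogenic_limit_deriv:
  fixes g :: "'n::{finite,linorder} clfun"
  assumes F: "F \<noteq> bot" and f: "\<And>k. f k \<in> monogenic" and lim: "\<And>R. uniform_limit (cball 0 R) f g F"
  shows "uniform_limit (cball 0 R) (\<lambda>k x. frechet_derivative (f k) (at x) v) (\<lambda>x. frechet_derivative g (at x) v) F"
proof (rule uniform_limitI)
  fix e :: real assume e: "e > 0"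
  obtain C where C: "C \<ge> 1" "\<And>(f :: 'n clfun) (y :: 'n paravec) r M v. f \<in> monogenic \<Longrightarrow> r > 0 \<Longrightarrow>
      (\<And>x. x \<in> cball y r \<Longrightarrow> norm (f x) \<le> M) \<Longrightarrow> norm (frechet_derivative f (at y) v) \<le> C * M / r * norm v"
    using monogenic_deriv_bound by blast
  have g: "g \<in> monogenic" by (rule monogenic_limit[OF F f lim])
  define d where "d = e / (C * (norm v + 1))"
  have d: "d > 0" using e C(1) by (simp add: d_def add_nonneg_pos)
  have "C * d * norm v < C * d * (norm v + 1)" using C(1) d by simp
  also have "\<dots> = e"
  proof -
    have "C * (norm v + 1) \<noteq> 0" using C(1) by (simp add: add_nonneg_eq_0_iff)
    then show ?thesis unfolding d_def by (metis mult.commute mult.left_commute nonzero_mult_div_cancel_left times_divide_eq_right)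
  qed
  finally have de: "C * d * norm v < e" .
  from uniform_limitD[OF lim[of "R + 1"] d]
  show "\<forall>\<^sub>F k in F. \<forall>x\<in>cball 0 R. dist (frechet_derivative (f k) (at x) v) (frechet_derivative g (at x) v) < e"
  proof (rule eventually_mono, intro ballI)
    fix k and x :: "'n paravec" assume k: "\<forall>x\<in>cball 0 (R + 1). dist (f k x) (g x) < d" and x: "x \<in> cball 0 R"
    have "norm (frechet_derivative (\<lambda>x. f k x - g x) (at x) v) \<le> C * d / 1 * norm v"
    proof (rule C(2)[OF monogenic_diff(1)[OF f g]])
      fix z assume "z \<in> cball x 1"
      then have "norm z \<le> R + 1"
        using norm_triangle_sub[of z x] x by (simp add: dist_norm norm_minus_commute)
      then show "norm (f k z - g z) \<le> d" using k by (auto simp: dist_norm less_imp_le)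
    qed simp
    then show "dist (frechet_derivative (f k) (at x) v) (frechet_derivative g (at x) v) < e"
      using de by (simp add: dist_norm monogenic_diff(2)[OF f g])
  qed
qed

lemma monogenic_difference_quotient:
  assumes f: "f \<in> monogenic"
  shows "(\<lambda>x. t *\<^sub>R (f (x + s *\<^sub>R v) - f x)) \<in> monogenic"
    and "frechet_derivative (\<lambda>x. t *\<^sub>R (f (x + s *\<^sub>R v) - f x)) (at x) w =
      t *\<^sub>R (frechet_derivative f (at (x + s *\<^sub>R v)) w - frechet_derivative f (at x) w)"
proof -
  have 1: "(\<lambda>x. f (x + s *\<^sub>R v)) \<in> monogenic"
    "frechet_derivative (\<lambda>x. f (x + s *\<^sub>R v)) (at x) w = frechet_derivative f (at (x + s *\<^sub>R v)) w" for x w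
    using monogenic_affine[OF f, of "s *\<^sub>R v" 1] by (simp_all add: add.commute)
  show "(\<lambda>x. t *\<^sub>R (f (x + s *\<^sub>R v) - f x)) \<in> monogenic"
    by (intro monogenic_scaleR monogenic_diff 1 f)
  show "frechet_derivative (\<lambda>x. t *\<^sub>R (f (x + s *\<^sub>R v) - f x)) (at x) w =
      t *\<^sub>R (frechet_derivative f (at (x + s *\<^sub>R v)) w - frechet_derivative f (at x) w)"
    by (simp add: monogenic_scaleR(2)[OF monogenic_diff(1)[OF 1(1) f]] monogenic_diff(2)[OF 1(1) f] 1(2))
qed

text \<open>After subtracting the linear part along the segment, the mean value theorem bounds the
  error by the oscillation of the derivative, which uniform continuity on a compact ball makes
  uniformly small. The step lengths are at most 1, so a ball enlarged by |v| contains all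
  segments.\<close>

lemma difference_quotient_uniform_limit:
  fixes f :: "'a::euclidean_space \<Rightarrow> 'b::euclidean_space"
  assumes f: "\<And>x. (f has_derivative f' x) (at x)" and cont: "continuous_on UNIV (\<lambda>x. f' x v)"
  shows "uniform_limit (cball 0 R) (\<lambda>k x. real (Suc k) *\<^sub>R (f (x + (1 / real (Suc k)) *\<^sub>R v) - f x)) (\<lambda>x. f' x v) sequentially"
proof (rule uniform_limitI)
  fix e :: real assume e: "e > 0"
  let ?K = "cball 0 (R + norm v)"
  have "uniformly_continuous_on ?K (\<lambda>x. f' x v)"
    by (rule compact_uniformly_continuous[OF continuous_on_subset[OF cont]]) auto
  then obtain d where d: "d > 0" "\<And>x y. x \<in> ?K \<Longrightarrow> y \<in> ?K \<Longrightarrow> dist x y < d \<Longrightarrow> dist (f' x v) (f' y v) < e"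
    using e unfolding uniformly_continuous_on_def by meson
  have "(\<lambda>k. (1 / real (Suc k)) * norm v) \<longlonglongrightarrow> 0 * norm v"
    by (intro tendsto_mult tendsto_const lim_1_over_n[THEN LIMSEQ_Suc])
  then have "\<forall>\<^sub>F k in sequentially. (1 / real (Suc k)) * norm v < d"
    using d(1) by (intro order_tendstoD) simp_all
  then show "\<forall>\<^sub>F k in sequentially. \<forall>x\<in>cball 0 R.
      dist (real (Suc k) *\<^sub>R (f (x + (1 / real (Suc k)) *\<^sub>R v) - f x)) (f' x v) < e"
  proof (rule eventually_mono, intro ballI)
    fix k and x :: 'a
    assume k: "(1 / real (Suc k)) * norm v < d" and x: "x \<in> cball 0 R"
    define t where "t = 1 / real (Suc k)"
    have t: "0 < t" "t \<le> 1" by (auto simp: t_def)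
    have lin: "linear (f' z)" for z using f has_derivative_linear by blast
    define p where "p s = f (x + s *\<^sub>R v) - s *\<^sub>R f' x v" for s
    have p: "(p has_derivative (\<lambda>h. h *\<^sub>R (f' (x + s *\<^sub>R v) v - f' x v))) (at s)" for s
    proof -
      have "((\<lambda>s. f (x + s *\<^sub>R v)) has_derivative (\<lambda>h. f' (x + s *\<^sub>R v) (h *\<^sub>R v))) (at s)"
        by (rule has_derivative_compose[OF _ f]) (auto intro!: derivative_eq_intros)
      then show ?thesis unfolding p_def
        by (rule has_derivative_eq_rhs[OF has_derivative_diff])
          (auto intro!: derivative_eq_intros simp: linear_scale[OF lin] scaleR_diff_right)
    qed
    have "\<exists>s\<in>{0<..<t}. norm (p t - p 0) \<le> norm ((t - 0) *\<^sub>R (f' (x + s *\<^sub>R v) v - f' x v))"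
      by (rule mvt_general[OF t(1)])
        (auto intro!: continuous_at_imp_continuous_on has_derivative_continuous[OF p] p)
    then obtain s where s: "0 < s" "s < t" and le: "norm (p t - p 0) \<le> t * norm (f' (x + s *\<^sub>R v) v - f' x v)"
      using t by auto
    have sv: "norm (s *\<^sub>R v) \<le> t * norm v" using s by (simp add: mult_right_mono)
    also have "t * norm v \<le> norm v" using t by (simp add: mult_left_le_one_le)
    finally have "norm (s *\<^sub>R v) \<le> norm v" .
    then have "x + s *\<^sub>R v \<in> ?K" using norm_triangle_ineq[of x "s *\<^sub>R v"] x by simp
    moreover have "x \<in> ?K" using x by (simp add: add_increasing2)
    moreover have "dist (x + s *\<^sub>R v) x < d" using sv k by (simp add: dist_norm t_def)
    ultimately have "dist (f' (x + s *\<^sub>R v) v) (f' x v) < e" by (rule d(2))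
    then have "norm (f' (x + s *\<^sub>R v) v - f' x v) < e" by (simp add: dist_norm)
    moreover have "real (Suc k) *\<^sub>R (f (x + t *\<^sub>R v) - f x) - f' x v = (1 / t) *\<^sub>R (p t - p 0)"
      using t by (simp add: p_def t_def scaleR_diff_right)
    then have "norm (real (Suc k) *\<^sub>R (f (x + t *\<^sub>R v) - f x) - f' x v) \<le> norm (f' (x + s *\<^sub>R v) v - f' x v)"
      using le t by (simp only: norm_scaleR) (simp add: field_simps)
    ultimately show "dist (real (Suc k) *\<^sub>R (f (x + (1 / real (Suc k)) *\<^sub>R v) - f x)) (f' x v) < e"
      by (simp add: dist_norm t_def)
  qed
qed

text \<open>This is where regularity is gained: difference quotients are monogenic and converge
  locally uniformly, so the derivative is monogenic again, and by iteration all derivatives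
  exist.\<close>

lemma monogenic_directional_derivative:
  assumes f: "f \<in> monogenic" shows "(\<lambda>x. frechet_derivative f (at x) v) \<in> monogenic"
  by (rule monogenic_limit[OF sequentially_bot monogenic_difference_quotient(1)[OF f]
        difference_quotient_uniform_limit[OF monogenicD(1,2)[OF f]]])

text \<open>The derivative along w of a difference quotient along v is the difference quotient along
  v of the derivative along w. Its limit can be computed in two ways, which give the two
  sides.\<close>

lemma monogenic_derivatives_commute:
  assumes f: "f \<in> monogenic"
  shows "frechet_derivative (\<lambda>x. frechet_derivative f (at x) v) (at x) w =
    frechet_derivative (\<lambda>x. frechet_derivative f (at x) w) (at x) v"
proof -
  let ?q = "\<lambda>g k x. real (Suc k) *\<^sub>R (g (x + (1 / real (Suc k)) *\<^sub>R v) - g x)"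
  let ?D = "\<lambda>w x. frechet_derivative f (at x) w"
  have "uniform_limit (cball 0 (norm x)) (\<lambda>k x. frechet_derivative (?q f k) (at x) w)
      (\<lambda>x. frechet_derivative (?D v) (at x) w) sequentially"
    by (rule monogenic_limit_deriv[OF sequentially_bot monogenic_difference_quotient(1)[OF f]
        difference_quotient_uniform_limit[OF monogenicD(1,2)[OF f]]])
  then have 1: "(\<lambda>k. ?q (?D w) k x) \<longlonglongrightarrow> frechet_derivative (?D v) (at x) w"
    unfolding monogenic_difference_quotient(2)[OF f] by (rule tendsto_uniform_limitI) simp
  note m = monogenic_directional_derivative[OF f, of w]
  have "uniform_limit (cball 0 (norm x)) (?q (?D w)) (\<lambda>x. frechet_derivative (?D w) (at x) v) sequentially"
    by (rule difference_quotient_uniform_limit[OF monogenicD(1,2)[OF m]])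
  then have "(\<lambda>k. ?q (?D w) k x) \<longlonglongrightarrow> frechet_derivative (?D w) (at x) v"
    by (rule tendsto_uniform_limitI) simp
  with 1 show ?thesis using LIMSEQ_unique by blast
qed

subsection \<open>Iterated partial derivatives\<close>

lemma pd_eq: "pd i f = (\<lambda>x. frechet_derivative f (at x) (0, axis i 1))"
  by (simp add: pd_def fun_eq_iff)

lemma monogenic_pd: "f \<in> monogenic \<Longrightarrow> pd i f \<in> monogenic"
  unfolding pd_eq by (rule monogenic_directional_derivative)

lemma pd_commute: "f \<in> monogenic \<Longrightarrow> pd i (pd j f) = pd j (pd i f)"
  unfolding pd_eq using monogenic_derivatives_commute by (auto simp: fun_eq_iff)

text \<open>Words of indices instead of multi-indices: they match the words in the Fueter
  polynomials and allow induction letter by letter. The head of the word is the outermost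
  derivative.\<close>

definition pdl :: "'n::{finite,linorder} list \<Rightarrow> 'n clfun \<Rightarrow> 'n clfun" where
  "pdl js f = foldr pd js f"

lemma pdl_simps [simp]: "pdl [] f = f" "pdl (j # js) f = pd j (pdl js f)"
  by (simp_all add: pdl_def)

lemma pdl_append: "pdl (js @ ks) f = pdl js (pdl ks f)"
  by (simp add: pdl_def)

lemma monogenic_pdl: "f \<in> monogenic \<Longrightarrow> pdl js f \<in> monogenic"
  by (induction js) (auto intro: monogenic_pd)

lemma pd_pdl: "f \<in> monogenic \<Longrightarrow> pd i (pdl js f) = pdl js (pd i f)"
  by (induction js) (auto simp: pd_commute monogenic_pdl)

lemma pdl_cong_count:
  assumes f: "f \<in> monogenic" and "\<And>i. count_list js i = count_list ks i"
  shows "pdl js f = pdl ks f"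
  using assms(2)
proof (induction js arbitrary: ks)
  case Nil
  then have "set ks = {}" by (metis count_list.simps(1) count_list_0_iff subsetI subset_empty empty_iff)
  then show ?case by simp
next
  case (Cons j js)
  have "j \<in> set ks" using Cons.prems[of j] by (metis count_list.simps(2) count_list_0_iff Suc_eq_plus1 nat.distinct(1))
  then obtain as bs where ks: "ks = as @ j # bs" by (meson split_list)
  have "count_list js i = count_list (as @ bs) i" for i
    using Cons.prems[of i] by (simp add: ks split: if_splits)
  then have "pdl js f = pdl (as @ bs) f" by (rule Cons.IH)
  then have "pdl (j # js) f = pd j (pdl (as @ bs) f)" by simp
  also have "\<dots> = pdl ks f" by (simp add: ks pdl_append pd_pdl monogenic_pdl f)
  finally show ?case .
qed

lemma mpd_eq_pdl:
  assumes f: "f \<in> monogenic" and js: "js \<in> mseqs m"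
  shows "mpd m f = pdl js f"
proof -
  define ks where "ks = concat (map (\<lambda>i. replicate (m i) i) (sorted_list_of_set (UNIV :: 'a set)))"
  have "foldr (\<lambda>i g. (pd i ^^ m i) g) xs f = pdl (concat (map (\<lambda>i. replicate (m i) i) xs)) f" for xs :: "'a list"
    by (induction xs) (simp_all add: pdl_def foldr_replicate)
  then have "mpd m f = pdl ks f" by (simp add: mpd_def ks_def)
  also have "\<dots> = pdl js f"
  proof (rule pdl_cong_count[OF f])
    fix i
    have rep: "count_list (replicate n j) i = (if i = j then n else 0)" for n and j :: 'a
      by (induction n) auto
    have "count_list (concat (map (\<lambda>i. replicate (m i) i) xs)) i = (if i \<in> set xs then m i else 0)"
      if "distinct xs" for xs
      using that by (induction xs) (auto simp: rep)
    then show "count_list ks i = count_list js i"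
      using js by (simp add: ks_def mseqs_def)
  qed
  finally show ?thesis .
qed

lemma mseqs_nonempty: "mseqs (m :: 'n::{finite,linorder} multi) \<noteq> {}"
proof -
  obtain M :: "'n multiset" where M: "\<And>i. count M i = m i"
    using count_Abs_multiset[of m] finite_subset[OF subset_UNIV] by (metis finite_class.finite_UNIV)
  obtain xs where "mset xs = M" using ex_mset by blast
  then have "xs \<in> mseqs m" using M by (auto simp: mseqs_def simp flip: count_mset)
  then show ?thesis by blast
qed

lemma mpd_pdlE:
  fixes m :: "'n::{finite,linorder} multi"
  obtains js where "js \<in> mseqs m" "length js = msize m" "\<And>f. f \<in> monogenic \<Longrightarrow> mpd m f = pdl js f"
proof -
  obtain js where js: "js \<in> mseqs m" using mseqs_nonempty by blast
  then have "(\<Sum>i\<in>UNIV. count_list js i) = msize m" by (simp add: mseqs_def msize_def)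
  moreover have "(\<Sum>i\<in>UNIV. count_list js i) = length js"
    by (rule sum_count_set) simp_all
  ultimately show ?thesis using that[OF js] mpd_eq_pdl[OF _ js] by simp
qed

lemma monogenic_mpd: "f \<in> monogenic \<Longrightarrow> mpd m f \<in> monogenic"
  by (metis mpd_pdlE monogenic_pdl)

lemma mpd_mpd:
  assumes "f \<in> monogenic" shows "mpd k (mpd m f) = mpd (madd m k) f"
proof -
  obtain js where js: "js \<in> mseqs m" "\<And>f. f \<in> monogenic \<Longrightarrow> mpd m f = pdl js f" using mpd_pdlE[of m] by blast
  obtain ks where ks: "ks \<in> mseqs k" "\<And>f. f \<in> monogenic \<Longrightarrow> mpd k f = pdl ks f" using mpd_pdlE[of k] by blast
  have "ks @ js \<in> mseqs (madd m k)" using js(1) ks(1) by (simp add: mseqs_def madd_def)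
  then show ?thesis using assms by (simp add: js ks monogenic_pdl mpd_eq_pdl pdl_append)
qed

lemma pdl_linear:
  assumes f: "f \<in> monogenic" and g: "g \<in> monogenic"
  shows "pdl js (\<lambda>x. f x + g x) = (\<lambda>x. pdl js f x + pdl js g x)"
    and "pdl js (\<lambda>x. f x \<star> a) = (\<lambda>x. pdl js f x \<star> a)"
    and "pdl js (\<lambda>x. f x - g x) = (\<lambda>x. pdl js f x - pdl js g x)"
proof (induction js)
  case (Cons j js)
  { case 1 then show ?case
      using monogenic_add(2)[OF monogenic_pdl[OF f, of js] monogenic_pdl[OF g, of js]] by (simp add: Cons pd_eq) }
  { case 2 then show ?case
      using monogenic_mult_right(2)[OF monogenic_pdl[OF f, of js]] by (simp add: Cons pd_eq) }
  { case 3 then show ?case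
      using monogenic_diff(2)[OF monogenic_pdl[OF f, of js] monogenic_pdl[OF g, of js]] by (simp add: Cons pd_eq) }
qed simp_all

lemma mpd_linear:
  assumes f: "f \<in> monogenic" and g: "g \<in> monogenic"
  shows "mpd m (\<lambda>x. f x + g x) = (\<lambda>x. mpd m f x + mpd m g x)"
    and "mpd m (\<lambda>x. f x \<star> a) = (\<lambda>x. mpd m f x \<star> a)"
    and "mpd m (\<lambda>x. f x - g x) = (\<lambda>x. mpd m f x - mpd m g x)"
proof -
  obtain js where js: "\<And>f. f \<in> monogenic \<Longrightarrow> mpd m f = pdl js f" using mpd_pdlE[of m] by blast
  show "mpd m (\<lambda>x. f x + g x) = (\<lambda>x. mpd m f x + mpd m g x)"
    "mpd m (\<lambda>x. f x \<star> a) = (\<lambda>x. mpd m f x \<star> a)"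
    "mpd m (\<lambda>x. f x - g x) = (\<lambda>x. mpd m f x - mpd m g x)"
    using pdl_linear[OF f g] by (simp_all add: js f g monogenic_add monogenic_mult_right monogenic_diff)
qed

subsection \<open>Cauchy estimates\<close>

text \<open>One term of the exponential series at k; a crude Stirling estimate.\<close>

lemma power_self_le_exp_fact: "real k ^ k \<le> exp 1 ^ k * fact k"
proof -
  have "real k ^ k /\<^sub>R fact k \<le> exp (real k)"
    using sum_le_suminf[OF summable_exp_generic[of "real k"], of "{k}"] by (simp add: exp_def)
  then show ?thesis by (simp add: field_simps exp_of_nat_mult[symmetric])
qed

text \<open>Reach a derivative of order k in k steps of radius R/k, each costing the first-order
  estimate. The resulting power k^k becomes a factorial at the price of e^k, which is absorbed into
  \<open>C\<close>.\<close>

lemma monogenic_pdl_bound: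
  obtains C where "C \<ge> 1"
    "\<And>(f :: 'n::{finite,linorder} clfun) (y :: 'n paravec) R M js. f \<in> monogenic \<Longrightarrow> R > 0 \<Longrightarrow>
      (\<And>x. x \<in> cball y R \<Longrightarrow> norm (f x) \<le> M) \<Longrightarrow>
      norm (pdl js f y) \<le> (C / R) ^ length js * fact (length js) * M"
proof -
  obtain C where C: "C \<ge> 1" "\<And>(f :: 'n clfun) (y :: 'n paravec) r M v. f \<in> monogenic \<Longrightarrow> r > 0 \<Longrightarrow>
      (\<And>x. x \<in> cball y r \<Longrightarrow> norm (f x) \<le> M) \<Longrightarrow> norm (frechet_derivative f (at y) v) \<le> C * M / r * norm v"
    using monogenic_deriv_bound by blast
  have step: "norm (pdl js f y) \<le> (C / r) ^ length js * M"
    if f: "f \<in> monogenic" and r: "r > 0" and M: "\<And>x. x \<in> cball y (real (length js) * r) \<Longrightarrow> norm (f x) \<le> M"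
    for f :: "'n clfun" and y :: "'n paravec" and r M js
    using M
  proof (induction js arbitrary: y)
    case Nil
    then show ?case by simp
  next
    case (Cons j js)
    have "norm (pd j (pdl js f) y) \<le> C * ((C / r) ^ length js * M) / r * norm (0::real, axis j (1::real))"
      unfolding pd_eq
    proof (rule C(2)[OF monogenic_pdl[OF f] r])
      fix x assume x: "x \<in> cball y r"
      show "norm (pdl js f x) \<le> (C / r) ^ length js * M"
      proof (rule Cons.IH)
        fix z assume z: "z \<in> cball x (real (length js) * r)"
        have "dist y z \<le> dist y x + dist x z" by (rule dist_triangle)
        then show "norm (f z) \<le> M" using x z by (intro Cons.prems) (simp add: algebra_simps)
      qed
    qed
    then show ?case by (simp add: norm_Pair norm_axis_1 field_simps)
  qed
  have "norm (pdl js f y) \<le> (C * exp 1 / R) ^ length js * fact (length js) * M"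
    if f: "f \<in> monogenic" and R: "R > 0" and M: "\<And>x. x \<in> cball y R \<Longrightarrow> norm (f x) \<le> M"
    for f :: "'n clfun" and y :: "'n paravec" and R M js
  proof (cases js)
    case Nil
    then show ?thesis using M[of y] R by simp
  next
    case (Cons j ks)
    define k where "k = length js"
    have k: "k > 0" by (simp add: k_def Cons)
    have M0: "M \<ge> 0" using M[of y] R norm_ge_zero order_trans by (metis centre_in_cball less_imp_le)
    have "norm (pdl js f y) \<le> (C / (R / real k)) ^ k * M"
      unfolding k_def using k R by (intro step f) (auto simp: k_def intro!: M)
    also have "\<dots> = (C / R) ^ k * real k ^ k * M"
      using k by (simp add: power_divide power_mult_distrib)
    also have "\<dots> \<le> (C / R) ^ k * (exp 1 ^ k * fact k) * M"
      using M0 C(1) R by (intro mult_right_mono mult_left_mono power_self_le_exp_fact) auto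
    also have "\<dots> = (C * exp 1 / R) ^ k * fact k * M"
      by (simp add: power_divide power_mult_distrib)
    finally show ?thesis unfolding k_def .
  qed
  moreover have "C * exp 1 \<ge> 1" using C(1) by (simp add: mult_ge1_I)
  ultimately show ?thesis using that[of "C * exp 1"] by blast
qed

subsection \<open>Fueter polynomials\<close>

text \<open>If \<open>m i = 0\<close> the truncated subtraction returns \<open>m\<close> itself;
  such terms always carry the factor \<open>m i\<close>, so sums may run over all indices.\<close>

definition dec :: "'n multi \<Rightarrow> 'n \<Rightarrow> 'n multi" where
  "dec m i = m(i := m i - 1)"

lemma msize_dec: "m i > 0 \<Longrightarrow> msize m = Suc (msize (dec m i))"
  unfolding msize_def dec_def by (simp add: sum.remove[of UNIV i])

lemma mfact_dec: "m i > 0 \<Longrightarrow> mfact m = real (m i) * mfact (dec m i)"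
  unfolding mfact_def dec_def by (simp add: prod.remove[of UNIV i] fact_reduce[of "m i"])

lemma mfact_pos: "mfact m > 0"
  by (simp add: mfact_def prod_pos)

lemma dec_dec: "real (m i) * real (dec m i j) = real (m j) * real (dec m j i)" "dec (dec m i) j = dec (dec m j) i"
  by (auto simp: dec_def fun_eq_iff)

lemma msize_eq_0_iff: "msize m = 0 \<longleftrightarrow> m = (\<lambda>i. 0)"
  by (auto simp: msize_def fun_eq_iff)

lemma multi_induct [case_names step]:
  assumes "\<And>m. (\<And>i. m i > 0 \<Longrightarrow> P (dec m i)) \<Longrightarrow> P m"
  shows "P (m :: 'n::{finite,linorder} multi)"
proof (induction "msize m" arbitrary: m rule: less_induct)
  case less
  show ?case by (rule assms, rule less) (simp add: msize_dec)
qed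

lemma mseqs_zero: "mseqs (\<lambda>i. 0) = {[]}"
  by (auto simp: mseqs_def) (metis count_list_0_iff list.set_intros(1) list.exhaust)

lemma length_mseqs: "js \<in> mseqs m \<Longrightarrow> length js = msize (m :: 'n::{finite,linorder} multi)"
  using sum_count_set[of js UNIV] by (simp add: mseqs_def msize_def)

text \<open>Sorts the words by their first letter; positive size excludes the empty word.\<close>

lemma sum_mseqs:
  fixes m :: "'n::{finite,linorder} multi"
  assumes "msize m > 0"
  shows "(\<Sum>js\<in>mseqs m. F js) = (\<Sum>i | m i > 0. \<Sum>ks\<in>mseqs (dec m i). F (i # ks))"
proof -
  have "(\<Sum>i | m i > 0. \<Sum>ks\<in>mseqs (dec m i). F (i # ks)) =
      (\<Sum>(i, ks)\<in>(SIGMA i:{i. m i > 0}. mseqs (dec m i)). F (i # ks))"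
    by (rule sum.Sigma) (auto intro: finite_mseqs)
  also have "\<dots> = (\<Sum>js\<in>mseqs m. F js)"
  proof (rule sum.reindex_bij_witness[where i = "\<lambda>js. (hd js, tl js)" and j = "\<lambda>(i, ks). i # ks"], goal_cases)
    case (2 a)
    then obtain i ks where a: "a = (i, ks)" "m i > 0" and c: "\<And>j. count_list ks j = dec m i j"
      by (auto simp: mseqs_def)
    then show ?case by (simp add: mseqs_def dec_def)
  next
    case (3 js)
    then show ?case using length_mseqs[OF 3] assms by (cases js) auto
  next
    case (4 js)
    then obtain i ks where js: "js = i # ks" using length_mseqs[OF 4] assms by (cases js) auto
    have c: "count_list (i # ks) j = m j" for j using 4 by (simp add: mseqs_def js)
    have "m i > 0" using c[of i] by simp
    moreover have "count_list ks j = dec m i j" for j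
      using c[of j] by (auto simp: dec_def)
    ultimately show ?case by (simp add: js mseqs_def)
  qed auto
  finally show ?thesis ..
qed

lemma fueter_zero: "fueter (\<lambda>i. 0) x = cl_one"
  by (simp add: fueter_def mseqs_zero cl_prod_list_def mfact_def msize_def)

text \<open>Splits off the first factor of each product. This recursion takes the place of the sum
  over words in the proofs on derivatives and bounds.\<close>

lemma fueter_recursion:
  "real (msize m) *\<^sub>R fueter m x = (\<Sum>i\<in>UNIV. real (m i) *\<^sub>R (fueter_var x i \<star> fueter (dec m i) x))"
proof (cases "msize m")
  case 0
  then have "m = (\<lambda>i. 0)" using msize_eq_0_iff by blast
  then show ?thesis using 0 by simp
next
  case (Suc k)
  let ?P = "\<lambda>js. cl_prod_list (map (fueter_var x) js)"
  have "real (msize m) *\<^sub>R fueter m x = (mfact m / fact k) *\<^sub>R (\<Sum>js\<in>mseqs m. ?P js)"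
    unfolding fueter_def Suc scaleR_scaleR fact_Suc by simp
  also have "\<dots> = (\<Sum>i | m i > 0. (mfact m / fact k) *\<^sub>R (fueter_var x i \<star> (\<Sum>ks\<in>mseqs (dec m i). ?P ks)))"
    using Suc by (subst sum_mseqs) (simp_all add: cl_prod_list_def cl_mult.sum_right scaleR_sum_right)
  also have "\<dots> = (\<Sum>i | m i > 0. real (m i) *\<^sub>R (fueter_var x i \<star> fueter (dec m i) x))"
  proof (intro sum.cong refl)
    fix i assume i: "i \<in> {i. m i > 0}"
    then have "msize (dec m i) = k" using msize_dec[of m i] Suc by simp
    then show "(mfact m / fact k) *\<^sub>R (fueter_var x i \<star> (\<Sum>ks\<in>mseqs (dec m i). ?P ks)) =
        real (m i) *\<^sub>R (fueter_var x i \<star> fueter (dec m i) x)"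
      using i mfact_dec[of m i] by (simp add: fueter_def cl_mult.scaleR_right)
  qed
  also have "\<dots> = (\<Sum>i\<in>UNIV. real (m i) *\<^sub>R (fueter_var x i \<star> fueter (dec m i) x))"
    by (rule sum.mono_neutral_left) auto
  finally show ?thesis .
qed

lemma fueter_var_bounded_linear: "bounded_linear (\<lambda>x. fueter_var x i)"
proof -
  have "linear (\<lambda>x. fueter_var x i)"
    by (simp add: fueter_var_def linear_iff algebra_simps)
  then show ?thesis by (simp add: linear_conv_bounded_linear)
qed

lemma fueter_var_mult:
  "fueter_var x i \<star> fueter_var v j = (snd x $ i * snd v $ j) *\<^sub>R cl_one + (fst x * fst v) *\<^sub>R (cl_gen i \<star> cl_gen j)
     - ((snd x $ i * fst v) *\<^sub>R cl_gen j + (fst x * snd v $ j) *\<^sub>R cl_gen i)"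
  unfolding fueter_var_def cl_mult.diff_left cl_mult.diff_right cl_mult.scaleR_left cl_mult.scaleR_right cl_mult_one
    scaleR_diff_right scaleR_scaleR
  by (simp add: mult.commute)

text \<open>The variables z_i do not commute, but the commutator of z_i(x) with z_j(v) is x_0 v_0
  times that of e_i with e_j, which is antisymmetric in i and j. Hence it cancels after
  symmetrisation.\<close>

lemma fueter_var_commutator:
  "fueter_var x i \<star> fueter_var v j + fueter_var x j \<star> fueter_var v i =
   fueter_var v j \<star> fueter_var x i + fueter_var v i \<star> fueter_var x j"
proof -
  have *: "(a1 + b1 - (c1 + d1)) + (a2 + b2 - (c2 + d2)) = (a1 + b2 - (d1 + c1)) + (a2 + b1 - (d2 + c2))"
    for a1 a2 b1 b2 c1 c2 d1 d2 :: "'a clifford" by (simp add: algebra_simps)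
  show ?thesis unfolding fueter_var_mult
    by (subst *) (simp only: mult.commute)
qed

text \<open>Differentiate the recursion by the product rule. The terms in which the derivative falls
  on the second factor have v in the inner position; once v is moved to the front, the recursion can
  be applied backwards.\<close>

lemma fueter_has_derivative:
  "(fueter m has_derivative (\<lambda>v. \<Sum>i\<in>UNIV. real (m i) *\<^sub>R (fueter_var v i \<star> fueter (dec m i) x))) (at x)"
proof (induction m arbitrary: x rule: multi_induct)
  case (step m)
  show ?case
  proof (cases "msize m")
    case 0
    then have m: "m = (\<lambda>i. 0)" using msize_eq_0_iff by blast
    have "fueter m = (\<lambda>x. cl_one)" unfolding m by (simp add: fun_eq_iff fueter_zero)
    then show ?thesis by (simp add: m)
  next
    case (Suc k)
    let ?z = "fueter_var" and ?V = "\<lambda>i. fueter (dec m i)" and ?W = "\<lambda>i j. fueter (dec (dec m i) j)"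
    have eq: "fueter m = (\<lambda>x. (1 / real (Suc k)) *\<^sub>R (\<Sum>i\<in>UNIV. real (m i) *\<^sub>R (?z x i \<star> ?V i x)))"
      unfolding fueter_recursion[symmetric] Suc by (simp add: fun_eq_iff)
    have d: "((\<lambda>x. real (m i) *\<^sub>R (?z x i \<star> ?V i x)) has_derivative
      (\<lambda>v. real (m i) *\<^sub>R (?z x i \<star> (\<Sum>j\<in>UNIV. real (dec m i j) *\<^sub>R (?z v j \<star> ?W i j x)) + ?z v i \<star> ?V i x))) (at x)" for i
    proof (cases "m i = 0")
      case False
      then show ?thesis
        by (intro has_derivative_scaleR_right cl_mult.FDERIV step
            bounded_linear.has_derivative[OF fueter_var_bounded_linear has_derivative_ident]) auto
    qed simp
    have "(fueter m has_derivative (\<lambda>v. (1 / real (Suc k)) *\<^sub>R (\<Sum>i\<in>UNIV.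
        real (m i) *\<^sub>R (?z x i \<star> (\<Sum>j\<in>UNIV. real (dec m i j) *\<^sub>R (?z v j \<star> ?W i j x)) + ?z v i \<star> ?V i x)))) (at x)"
      unfolding eq by (intro has_derivative_scaleR_right has_derivative_sum d)
    moreover have "(\<Sum>i\<in>UNIV. real (m i) *\<^sub>R (?z x i \<star> (\<Sum>j\<in>UNIV. real (dec m i j) *\<^sub>R (?z v j \<star> ?W i j x)) + ?z v i \<star> ?V i x))
        = real (Suc k) *\<^sub>R (\<Sum>i\<in>UNIV. real (m i) *\<^sub>R (?z v i \<star> ?V i x))" (is "?L = ?R") for v
    proof -
      \<comment> \<open>The weight of lowering first i and then j. By \<open>dec_dec\<close> this
        weight and the remaining polynomial are symmetric in i and j.\<close>
      define w where "w i j = real (m i) * real (dec m i j)" for i j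
      have w: "w i j = w j i" for i j unfolding w_def by (rule dec_dec)
      define A where "A = (\<Sum>i\<in>UNIV. \<Sum>j\<in>UNIV. w i j *\<^sub>R (?z x i \<star> ?z v j \<star> ?W i j x))"
      define B where "B = (\<Sum>i\<in>UNIV. \<Sum>j\<in>UNIV. w i j *\<^sub>R (?z v j \<star> ?z x i \<star> ?W i j x))"
      have A': "A = (\<Sum>i\<in>UNIV. \<Sum>j\<in>UNIV. w i j *\<^sub>R (?z x j \<star> ?z v i \<star> ?W i j x))"
        unfolding A_def by (subst sum.swap) (intro sum.cong refl, subst w, subst dec_dec(2), rule refl)
      have B': "B = (\<Sum>i\<in>UNIV. \<Sum>j\<in>UNIV. w i j *\<^sub>R (?z v i \<star> ?z x j \<star> ?W i j x))"
        unfolding B_def by (subst sum.swap) (intro sum.cong refl, subst w, subst dec_dec(2), rule refl)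
      \<comment> \<open>Doubling symmetrises in i and j, which is exactly the form in which the two
        variables may be exchanged.\<close>
      have "A + A = (\<Sum>i\<in>UNIV. \<Sum>j\<in>UNIV. w i j *\<^sub>R ((?z x i \<star> ?z v j + ?z x j \<star> ?z v i) \<star> ?W i j x))"
        by (subst A', subst A_def) (simp add: sum.distrib cl_mult.add_left scaleR_add_right)
      also have "\<dots> = B + B" unfolding fueter_var_commutator
        by (subst B', subst B_def) (simp add: sum.distrib cl_mult.add_left scaleR_add_right)
      finally have AB: "A = B" by (simp flip: scaleR_2)
      have L: "?L = A + (\<Sum>i\<in>UNIV. real (m i) *\<^sub>R (?z v i \<star> ?V i x))"
        by (simp add: A_def w_def scaleR_add_right sum.distrib cl_mult.sum_right cl_mult.scaleR_right
            scaleR_sum_right cl_mult_assoc)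
      \<comment> \<open>With v in front, the inner sum is the recursion for the polynomial lowered
        at j, which has degree k and so contributes the factor k.\<close>
      have "B = (\<Sum>j\<in>UNIV. real (m j) *\<^sub>R (?z v j \<star> (\<Sum>i\<in>UNIV. real (dec m j i) *\<^sub>R (?z x i \<star> ?W j i x))))"
        unfolding B'
        by (simp add: w_def cl_mult.sum_right cl_mult.scaleR_right scaleR_sum_right cl_mult_assoc)
      then have "A = (\<Sum>j\<in>UNIV. real (m j) *\<^sub>R (?z v j \<star> (real (msize (dec m j)) *\<^sub>R ?V j x)))"
        unfolding AB by (simp add: fueter_recursion)
      also have "\<dots> = (\<Sum>j\<in>UNIV. real k *\<^sub>R real (m j) *\<^sub>R (?z v j \<star> ?V j x))"
      proof (intro sum.cong refl)
        fix j
        show "real (m j) *\<^sub>R (?z v j \<star> (real (msize (dec m j)) *\<^sub>R ?V j x)) = real k *\<^sub>R real (m j) *\<^sub>R (?z v j \<star> ?V j x)"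
          using msize_dec[of m j] Suc by (cases "m j = 0") (auto simp: cl_mult.scaleR_right mult.commute)
      qed
      finally have "A = real k *\<^sub>R (\<Sum>i\<in>UNIV. real (m i) *\<^sub>R (?z v i \<star> ?V i x))"
        by (simp only: scaleR_sum_right)
      then show ?thesis unfolding L by (simp add: scaleR_add_left add.commute)
    qed
    ultimately show ?thesis by simp
  qed
qed

lemma fueter_var_basis: "fueter_var (1, 0) i = - cl_gen i" "fueter_var (0, axis j 1) i = (if i = j then cl_one else 0)"
  by (auto simp: fueter_var_def axis_def)

text \<open>On the basis, z_i is -e_i in direction \<open>x_0\<close> and 1 or 0 in direction x_j.
  The \<open>x_0\<close>-derivative is therefore the negative of the sum of the other Dirac
  terms.\<close>

lemma monogenic_fueter: "fueter m \<in> monogenic"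
proof (rule monogenicI[OF fueter_has_derivative])
  have "continuous_on UNIV (fueter (m :: 'a multi))" for m
    by (intro continuous_at_imp_continuous_on ballI has_derivative_continuous[OF fueter_has_derivative])
  then show "continuous_on UNIV (\<lambda>x. \<Sum>i\<in>UNIV. real (m i) *\<^sub>R (fueter_var v i \<star> fueter (dec m i) x))" for v :: "'a paravec"
    by (intro continuous_intros cl_mult.continuous_on)
  fix x
  have "(\<Sum>i\<in>UNIV. cl_gen j \<star> (real (m i) *\<^sub>R (fueter_var (0, axis j 1) i \<star> fueter (dec m i) x))) =
      (\<Sum>i\<in>UNIV. if i = j then real (m j) *\<^sub>R (cl_gen j \<star> fueter (dec m j) x) else 0)" for j
    by (intro sum.cong refl) (auto simp: fueter_var_basis cl_mult_one cl_mult.zero_left cl_mult.zero_right cl_mult.scaleR_right)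
  then show "(\<Sum>b\<in>Basis. para b \<star> (\<Sum>i\<in>UNIV. real (m i) *\<^sub>R (fueter_var b i \<star> fueter (dec m i) x))) = 0"
    by (simp add: sum_Basis_paravec cl_mult_one cl_mult.sum_right fueter_var_basis(1) cl_mult.minus_left sum_negf)
qed

text \<open>The integer factor is written as a right multiplication so that
  \<open>pdl_linear\<close> moves it through further derivatives.\<close>

lemma pd_fueter: "pd i (fueter m) = (\<lambda>x. fueter (dec m i) x \<star> (real (m i) *\<^sub>R cl_one))"
proof
  fix x
  have "pd i (fueter m) x = (\<Sum>j\<in>UNIV. real (m j) *\<^sub>R (fueter_var (0, axis i 1) j \<star> fueter (dec m j) x))"
    by (simp add: pd_eq frechet_derivative_eqI[OF fueter_has_derivative])
  also have "\<dots> = (\<Sum>j\<in>UNIV. if j = i then real (m i) *\<^sub>R fueter (dec m i) x else 0)"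
    by (intro sum.cong refl) (auto simp: fueter_var_basis cl_mult_one cl_mult.zero_left)
  finally show "pd i (fueter m) x = fueter (dec m i) x \<star> (real (m i) *\<^sub>R cl_one)"
    by (simp add: cl_mult_scaleR_one)
qed

subsection \<open>The Taylor expansion\<close>

lemma norm_cl_one [simp]: "norm (cl_one :: 'n::{finite,linorder} clifford) = 1"
  and norm_cl_gen [simp]: "norm (cl_gen i :: 'n clifford) = 1"
  by (simp_all add: cl_one_def cl_gen_def cl_basis_def)

lemma norm_fueter_var_le: "norm (fueter_var x i) \<le> 2 * norm x"
proof -
  have "norm (fueter_var x i) \<le> \<bar>snd x $ i\<bar> + \<bar>fst x\<bar>"
    unfolding fueter_var_def by (rule order_trans[OF norm_triangle_ineq4]) simp
  also have "\<bar>snd x $ i\<bar> \<le> norm x"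
    using component_le_norm_cart[of "snd x" i] norm_snd_le[of "snd x" "fst x"] by simp
  also have "\<bar>fst x\<bar> \<le> norm x" using norm_fst_le[of "fst x" "snd x"] by simp
  finally show ?thesis by simp
qed

text \<open>In the recursion the weights \<open>m i\<close> add up to the degree, so each degree
  costs only the bound for one variable, 2|x|, and one factor \<open>K\<close>. Carrying
  \<open>a\<close> through the induction avoids a further constant when Taylor terms are
  estimated.\<close>

lemma fueter_norm_bound:
  obtains A where "A \<ge> 1" "\<And>(m :: 'n::{finite,linorder} multi) x a. norm (fueter m x \<star> a) \<le> (A * norm x) ^ msize m * norm a"
proof -
  obtain K where K: "K \<ge> 1" "\<And>a b :: 'n clifford. norm (a \<star> b) \<le> K * norm a * norm b"
    using cl_mult_norm_bound by blast
  define A where "A = K * 2"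
  have "norm (fueter m x \<star> a) \<le> (A * norm x) ^ msize m * norm a" for m :: "'n multi" and x a
  proof (induction m rule: multi_induct)
    case (step m)
    show ?case
    proof (cases "msize m")
      case 0
      then have "m = (\<lambda>i. 0)" using msize_eq_0_iff by blast
      then show ?thesis using 0 by (simp add: fueter_zero cl_mult_one)
    next
      case (Suc k)
      let ?B = "(A * norm x) ^ Suc k * norm a"
      have "norm (real (m i) *\<^sub>R (fueter_var x i \<star> fueter (dec m i) x \<star> a)) \<le> real (m i) * ?B" for i
      proof (cases "m i = 0")
        case False
        then have k: "msize (dec m i) = k" using msize_dec[of m i] Suc by simp
        have "norm (fueter_var x i \<star> (fueter (dec m i) x \<star> a)) \<le> K * norm (fueter_var x i) * norm (fueter (dec m i) x \<star> a)"
          by (rule K(2))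
        also have "\<dots> \<le> K * (2 * norm x) * ((A * norm x) ^ k * norm a)"
          using step[of i] False K(1) k by (intro mult_mono norm_fueter_var_le) auto
        also have "\<dots> = ?B" by (simp add: A_def)
        finally show ?thesis by (simp add: cl_mult_assoc mult_left_mono)
      qed simp
      then have "norm (\<Sum>i\<in>UNIV. real (m i) *\<^sub>R (fueter_var x i \<star> fueter (dec m i) x \<star> a)) \<le> (\<Sum>i\<in>UNIV. real (m i) * ?B)"
        by (rule sum_norm_le)
      also have "(\<Sum>i\<in>UNIV. real (m i) *\<^sub>R (fueter_var x i \<star> fueter (dec m i) x \<star> a)) = real (Suc k) *\<^sub>R (fueter m x \<star> a)"
        unfolding Suc[symmetric] cl_mult.scaleR_left[symmetric] fueter_recursion
        by (simp only: cl_mult.sum_left)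
      also have "(\<Sum>i\<in>UNIV. real (m i) * ?B) = real (Suc k) * ?B"
        unfolding Suc[symmetric] by (simp add: msize_def sum_distrib_right)
      finally show ?thesis unfolding Suc by simp
    qed
  qed
  moreover have "A \<ge> 1" using K(1) by (simp add: A_def)
  ultimately show ?thesis using that by blast
qed

text \<open>The innermost derivative is the last letter of the word, so the induction peels words
  from the right. This duality gives the Taylor coefficients of the Fueter polynomials.\<close>

lemma pdl_fueter_at_0:
  fixes m :: "'n::{finite,linorder} multi"
  shows "pdl js (fueter m) 0 = (if js \<in> mseqs m then mfact m else 0) *\<^sub>R cl_one"
proof (induction js arbitrary: m rule: rev_induct)
  case Nil
  show ?case
  proof (cases "m = (\<lambda>i. 0)")
    case True
    then show ?thesis by (simp add: fueter_zero mseqs_zero mfact_def)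
  next
    case False
    then have m: "msize m > 0" using msize_eq_0_iff by blast
    have "fueter_var (0 :: 'n paravec) i = 0" for i by (simp add: fueter_var_def)
    then have "real (msize m) *\<^sub>R fueter m 0 = 0" by (simp add: fueter_recursion cl_mult.zero_left)
    moreover have "[] \<notin> mseqs m" using m length_mseqs[of "[]" m] by auto
    ultimately show ?thesis using m by simp
  qed
next
  case (snoc i js)
  have "pdl (js @ [i]) (fueter m) 0 = pdl js (fueter (dec m i)) 0 \<star> (real (m i) *\<^sub>R cl_one)"
    by (simp add: pdl_append pd_fueter pdl_linear(2)[OF monogenic_fueter monogenic_fueter])
  also have "\<dots> = (real (m i) * (if js \<in> mseqs (dec m i) then mfact (dec m i) else 0)) *\<^sub>R cl_one"
    by (simp only: snoc cl_mult_scaleR_one scaleR_scaleR)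
  also have "real (m i) * (if js \<in> mseqs (dec m i) then mfact (dec m i) else 0) = (if js @ [i] \<in> mseqs m then mfact m else 0)"
  proof (cases "m i = 0")
    case True
    then have "js @ [i] \<notin> mseqs m" by (auto simp: mseqs_def dest: spec[of _ i])
    then show ?thesis using True by simp
  next
    case False
    have "js @ [i] \<in> mseqs m \<longleftrightarrow> js \<in> mseqs (dec m i)"
    proof -
      have "(count_list (js @ [i]) j = m j) = (count_list js j = dec m i j)" for j
        using False by (auto simp: dec_def)
      then show ?thesis by (simp add: mseqs_def)
    qed
    then show ?thesis using mfact_dec[of m i] False by simp
  qed
  finally show ?case .
qed

lemma taylor_coeff_fueter: "taylor_coeff (fueter m) k = (if k = m then cl_one else 0)"
proof -
  obtain js where js: "js \<in> mseqs k" "mpd k (fueter m) = pdl js (fueter m)"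
    using mpd_pdlE[of k] monogenic_fueter by metis
  have "js \<in> mseqs m \<longleftrightarrow> k = m" using js(1) by (auto simp: mseqs_def)
  then show ?thesis using mfact_pos[of m] by (simp add: taylor_coeff_def js(2) pdl_fueter_at_0)
qed

lemma taylor_coeff_linear:
  assumes f: "f \<in> monogenic" and g: "g \<in> monogenic"
  shows "taylor_coeff (\<lambda>x. f x + g x) m = taylor_coeff f m + taylor_coeff g m"
    and "taylor_coeff (\<lambda>x. f x \<star> a) m = taylor_coeff f m \<star> a"
    and "taylor_coeff (\<lambda>x. f x - g x) m = taylor_coeff f m - taylor_coeff g m"
  unfolding taylor_coeff_def mpd_linear[OF f g]
  by (simp_all add: scaleR_add_right scaleR_diff_right cl_mult.scaleR_left)

text \<open>A multinomial coefficient is at most n^|m|, by the recursion that removes one element.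
  It makes the Cauchy estimate for Taylor coefficients purely geometric.\<close>

lemma fact_msize_le: "fact (msize m) \<le> real CARD('n) ^ msize m * mfact (m :: 'n::{finite,linorder} multi)"
proof (induction m rule: multi_induct)
  case (step m)
  show ?case
  proof (cases "msize m")
    case 0
    then have "m = (\<lambda>i. 0)" using msize_eq_0_iff by blast
    then show ?thesis using 0 by (simp add: mfact_def)
  next
    case (Suc k)
    have "(fact (msize m) :: real) = (\<Sum>i\<in>UNIV. real (m i) * fact k)"
      unfolding Suc by (simp add: sum_distrib_right[symmetric] of_nat_sum[symmetric] msize_def[symmetric] Suc
          del: of_nat_sum)
    also have "\<dots> \<le> (\<Sum>i\<in>(UNIV::'n set). real CARD('n) ^ k * mfact m)"
    proof (rule sum_mono)
      fix i
      show "real (m i) * fact k \<le> real CARD('n) ^ k * mfact m"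
      proof (cases "m i = 0")
        case True
        then show ?thesis using mfact_pos[of m] by simp
      next
        case False
        then have k: "msize (dec m i) = k" using msize_dec[of m i] Suc by simp
        have "real (m i) * fact k \<le> real (m i) * (real CARD('n) ^ k * mfact (dec m i))"
          using step[of i] False k by (intro mult_left_mono) auto
        then show ?thesis using mfact_dec[of m i] False by (simp add: mult_ac)
      qed
    qed
    finally show ?thesis unfolding Suc by (simp add: mult_ac)
  qed
qed

lemma taylor_coeff_bound:
  obtains C where "C \<ge> 1"
    "\<And>(f :: 'n::{finite,linorder} clfun) R M m. f \<in> monogenic \<Longrightarrow> R > 0 \<Longrightarrow>
      (\<And>x. norm x \<le> R \<Longrightarrow> norm (f x) \<le> M) \<Longrightarrow> norm (taylor_coeff f m) \<le> (C / R) ^ msize m * M"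
proof -
  obtain C where C: "C \<ge> 1" "\<And>(f :: 'n clfun) (y :: 'n paravec) R M js. f \<in> monogenic \<Longrightarrow> R > 0 \<Longrightarrow>
      (\<And>x. x \<in> cball y R \<Longrightarrow> norm (f x) \<le> M) \<Longrightarrow>
      norm (pdl js f y) \<le> (C / R) ^ length js * fact (length js) * M"
    using monogenic_pdl_bound by blast
  let ?n = "real CARD('n)"
  have "norm (taylor_coeff f m) \<le> (C * ?n / R) ^ msize m * M"
    if f: "f \<in> monogenic" and R: "R > 0" and M: "\<And>x. norm x \<le> R \<Longrightarrow> norm (f x) \<le> M"
    for f :: "'n clfun" and R M m
  proof -
    have M0: "M \<ge> 0" using order_trans[OF norm_ge_zero M[of 0]] R by simp
    obtain js where js: "length js = msize m" "mpd m f = pdl js f"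
      using mpd_pdlE[of m] f by metis
    have "norm (mpd m f 0) \<le> (C / R) ^ msize m * fact (msize m) * M"
      using C(2)[OF f R, of 0 M js] M by (simp add: js)
    also have "\<dots> \<le> (C / R) ^ msize m * (?n ^ msize m * mfact m) * M"
      using M0 C(1) R by (intro mult_right_mono mult_left_mono fact_msize_le) auto
    finally have "norm (mpd m f 0) \<le> (C * ?n / R) ^ msize m * M * mfact m"
      by (simp add: power_divide power_mult_distrib mult_ac)
    then show ?thesis using mfact_pos[of m] by (simp add: taylor_coeff_def field_simps)
  qed
  moreover have "C * ?n \<ge> 1" using C(1) by (intro mult_ge1_I) auto
  ultimately show ?thesis using that[of "C * ?n"] by blast
qed

section \<open>Counting multi-indices and geometric series over them\<close>

lemma finite_msize: "finite {m :: 'n::{finite,linorder} multi. msize m = k}"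
  and card_msize_le: "card {m :: 'n multi. msize m = k} \<le> CARD('n) ^ k"
proof -
  have *: "{m :: 'n multi. msize m = k} \<subseteq> count_list ` {js. set js \<subseteq> UNIV \<and> length js = k}"
  proof
    fix m :: "'n multi" assume m: "m \<in> {m. msize m = k}"
    obtain js where js: "js \<in> mseqs m" using mseqs_nonempty by blast
    then have "m = count_list js" by (auto simp: mseqs_def)
    then show "m \<in> count_list ` {js. set js \<subseteq> UNIV \<and> length js = k}"
      using length_mseqs[OF js] m by auto
  qed
  have fin: "finite {js :: 'n list. set js \<subseteq> UNIV \<and> length js = k}" by (rule finite_lists_length_eq) simp
  show "finite {m :: 'n multi. msize m = k}" by (rule finite_subset[OF * finite_imageI[OF fin]])
  have "card {m :: 'n multi. msize m = k} \<le> card {js :: 'n list. set js \<subseteq> UNIV \<and> length js = k}"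
    by (rule order_trans[OF card_mono[OF finite_imageI[OF fin] *] card_image_le[OF fin]])
  then show "card {m :: 'n multi. msize m = k} \<le> CARD('n) ^ k"
    using card_lists_length_eq[of "UNIV :: 'n set" k] by simp
qed

lemma finite_msize_less: "finite {m :: 'n::{finite,linorder} multi. msize m < N}"
proof -
  have "{m :: 'n multi. msize m < N} = (\<Union>k<N. {m. msize m = k})" by auto
  then show ?thesis by (simp add: finite_msize)
qed

lemma sum_msize_less:
  "(\<Sum>m | msize (m :: 'n::{finite,linorder} multi) < N. F m) = (\<Sum>k<N. \<Sum>m | msize m = k. F m)"
proof -
  have "{m :: 'n multi. msize m < N} = (\<Union>k<N. {m. msize m = k})" by auto
  then show ?thesis by (simp only:) (rule sum.UNION_disjoint, auto simp: finite_msize)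
qed

lemma geometric_multi_sum_le:
  assumes "0 \<le> q" "real CARD('n) * q \<le> 1 / 2" "finite S"
  shows "(\<Sum>m\<in>S. q ^ msize (m :: 'n::{finite,linorder} multi)) \<le> 2"
proof -
  define N where "N = Suc (Max (insert 0 (msize ` S)))"
  have "S \<subseteq> {m. msize m < N}" using assms(3) by (auto simp: N_def less_Suc_eq_le)
  then have "(\<Sum>m\<in>S. q ^ msize m) \<le> (\<Sum>m | msize (m :: 'n multi) < N. q ^ msize m)"
    using assms(1) by (intro sum_mono2 finite_msize_less) auto
  also have "\<dots> = (\<Sum>k<N. real (card {m :: 'n multi. msize m = k}) * q ^ k)"
    by (subst sum_msize_less) (intro sum.cong refl, simp)
  also have "\<dots> \<le> (\<Sum>k<N. (1 / 2) ^ k)"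
  proof (rule sum_mono)
    fix k
    have "real (card {m :: 'n multi. msize m = k}) * q ^ k \<le> real (CARD('n) ^ k) * q ^ k"
      using assms(1) by (intro mult_right_mono of_nat_mono card_msize_le) auto
    also have "\<dots> = (real CARD('n) * q) ^ k" by (simp add: power_mult_distrib)
    also have "\<dots> \<le> (1 / 2) ^ k" using assms by (intro power_mono) auto
    finally show "real (card {m :: 'n multi. msize m = k}) * q ^ k \<le> (1 / 2) ^ k" .
  qed
  also have "\<dots> \<le> (\<Sum>k. (1 / 2) ^ k)" by (intro sum_le_suminf summable_geometric) auto
  also have "\<dots> = 2" by (simp add: suminf_geometric)
  finally show ?thesis .
qed

lemma geometric_multi_summable:
  assumes "0 \<le> q" "real CARD('n) * q \<le> 1 / 2"
  shows "(\<lambda>m. q ^ msize (m :: 'n::{finite,linorder} multi)) summable_on UNIV"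
  using geometric_multi_sum_le[OF assms] assms(1)
  by (intro nonneg_bdd_above_summable_on bdd_aboveI[of _ 2]) auto

lemma monogenic_bounded_on_cball:
  assumes "f \<in> monogenic" obtains M where "M \<ge> 0" "\<And>x. norm x \<le> R \<Longrightarrow> norm (f x) \<le> M"
proof -
  have "bounded (f ` cball 0 R)"
    by (intro compact_imp_bounded compact_continuous_image monogenic_continuous assms) simp
  then obtain M where "\<forall>y\<in>f ` cball 0 R. norm y \<le> M" unfolding bounded_iff by blast
  then show ?thesis using that[of "max 0 M"] by (simp add: max.coboundedI2)
qed

text \<open>The Dirac equation eliminates the \<open>x_0\<close>-derivative, and the coefficient of
  the i-th derivative becomes x_i - x_0 e_i.\<close>

lemma monogenic_radial_derivative:
  assumes f: "f \<in> monogenic"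
  shows "frechet_derivative f (at y) x = (\<Sum>i\<in>UNIV. fueter_var x i \<star> pd i f y)"
proof -
  let ?F = "frechet_derivative f (at y)"
  have lin: "linear ?F" using monogenicD(1)[OF f] has_derivative_linear by blast
  have "?F x = ?F (\<Sum>b\<in>Basis. (x \<bullet> b) *\<^sub>R b)" by (simp only: euclidean_representation)
  also have "\<dots> = (\<Sum>b\<in>Basis. (x \<bullet> b) *\<^sub>R ?F b)" by (simp only: linear_sum[OF lin] linear_scale[OF lin])
  finally have "?F x = (\<Sum>b\<in>Basis. (x \<bullet> b) *\<^sub>R ?F b)" .
  then have 1: "?F x = fst x *\<^sub>R pd0 f y + (\<Sum>i\<in>UNIV. (snd x $ i) *\<^sub>R pd i f y)"
    by (simp add: sum_Basis_paravec pd0_def pd_def inner_prod_def inner_axis)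
  have "pd0 f y + (\<Sum>i\<in>UNIV. cl_gen i \<star> pd i f y) = 0"
    using monogenicD(3)[OF f, of y] by (simp add: dirac_eq)
  then have 2: "pd0 f y = - (\<Sum>i\<in>UNIV. cl_gen i \<star> pd i f y)" by (simp add: eq_neg_iff_add_eq_0)
  show ?thesis unfolding 1 2
    by (simp add: fueter_var_def cl_mult.diff_left cl_mult.scaleR_left cl_mult_one sum_subtractf scaleR_sum_right)
qed

text \<open>Taylor's formula with integral remainder for t -> f(t x) on the unit interval. The
  remainder is at most a constant times (k+1) 2^-(k+1); the factor k+1 is the quotient of (k+1)!
  from the Cauchy estimate and k! from the formula.\<close>

lemma monogenic_taylor_tendsto:
  assumes f: "f \<in> monogenic"
  shows "(\<lambda>N. \<Sum>m | msize m < N. fueter m x \<star> taylor_coeff f m) \<longlonglongrightarrow> (f x :: 'n::{finite,linorder} clifford)"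
proof -
  let ?L = "\<lambda>k. {js :: 'n list. length js = k}"
  let ?z = "fueter_var x"
  have finL: "finite (?L k)" for k using finite_lists_length_eq[of "UNIV :: 'n set" k] by simp
  have cardL: "card (?L k) = CARD('n) ^ k" for k using card_lists_length_eq[of "UNIV :: 'n set" k] by simp
  define Z where "Z js = cl_prod_list (map ?z js)" for js
  have Z_snoc: "Z (js @ [i]) = Z js \<star> ?z i" for js i
    unfolding Z_def by (induction js) (simp_all add: cl_prod_list_def cl_mult_one cl_mult_assoc)
  \<comment> \<open>The k-th derivative along the ray as a sum over words of length k.
    Differentiating once more inserts z_i next to the derivative, that is, appends a letter.\<close>
  define G where "G k t = (\<Sum>js\<in>?L k. Z js \<star> pdl js f (t *\<^sub>R x))" for k and t :: real
  have G: "(G k has_vector_derivative G (Suc k) t) (at t within S)" for k t S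
  proof -
    have "((\<lambda>t. pdl js f (t *\<^sub>R x)) has_derivative (\<lambda>h. h *\<^sub>R (\<Sum>i\<in>UNIV. ?z i \<star> pd i (pdl js f) (t *\<^sub>R x)))) (at t within S)"
      for js
    proof -
      note m = monogenic_pdl[OF f, of js]
      have "((\<lambda>t. pdl js f (t *\<^sub>R x)) has_derivative (\<lambda>h. frechet_derivative (pdl js f) (at (t *\<^sub>R x)) (h *\<^sub>R x))) (at t within S)"
        by (rule has_derivative_compose[OF _ monogenicD(1)[OF m]]) (auto intro!: derivative_eq_intros)
      then show ?thesis
        unfolding linear_scale[OF has_derivative_linear[OF monogenicD(1)[OF m]]]
        by (simp only: monogenic_radial_derivative[OF m])
    qed
    then have "(G k has_derivative (\<lambda>h. \<Sum>js\<in>?L k. Z js \<star> (h *\<^sub>R (\<Sum>i\<in>UNIV. ?z i \<star> pd i (pdl js f) (t *\<^sub>R x))))) (at t within S)"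
      unfolding G_def
      by (intro has_derivative_sum bounded_linear.has_derivative[OF cl_mult.bounded_linear_right])
    moreover have "(\<Sum>js\<in>?L k. Z js \<star> (h *\<^sub>R (\<Sum>i\<in>UNIV. ?z i \<star> pd i (pdl js f) (t *\<^sub>R x)))) = h *\<^sub>R G (Suc k) t" for h
    proof -
      have "(\<Sum>js\<in>?L k. Z js \<star> (\<Sum>i\<in>UNIV. ?z i \<star> pd i (pdl js f) (t *\<^sub>R x))) =
          (\<Sum>js\<in>?L k. \<Sum>i\<in>UNIV. Z (js @ [i]) \<star> pdl (js @ [i]) f (t *\<^sub>R x))"
        by (simp add: cl_mult.sum_right Z_snoc cl_mult_assoc pd_pdl[OF f] pdl_append)
      also have "\<dots> = (\<Sum>(js, i)\<in>?L k \<times> UNIV. Z (js @ [i]) \<star> pdl (js @ [i]) f (t *\<^sub>R x))"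
        by (rule sum.cartesian_product)
      also have "\<dots> = G (Suc k) t"
        unfolding G_def
        by (rule sum.reindex_bij_witness[where i = "\<lambda>js. (butlast js, last js)" and j = "\<lambda>(js, i). js @ [i]"])
          (auto simp: length_Suc_conv_rev)
      finally show ?thesis
        by (simp add: cl_mult.scaleR_right scaleR_sum_right[symmetric])
    qed
    ultimately show ?thesis by (simp add: has_vector_derivative_def)
  qed
  \<comment> \<open>Words with equal letter counts give equal derivatives. Their products sum to
    k!/m! times the Fueter polynomial, and the derivative at 0 is m! times the coefficient.\<close>
  have G0: "G k 0 = fact k *\<^sub>R (\<Sum>m | msize m = k. fueter m x \<star> taylor_coeff f m)" for k
  proof -
    have "?L k = (\<Union>m\<in>{m. msize m = k}. mseqs m)"
    proof -
      have c: "js \<in> mseqs (count_list js)" for js :: "'n list" by (simp add: mseqs_def)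
      then have "msize (count_list js) = length js" for js :: "'n list" by (rule length_mseqs[symmetric])
      then show ?thesis using c length_mseqs by (intro set_eqI iffI) (force, auto)
    qed
    then have "G k 0 = (\<Sum>m | msize m = k. \<Sum>js\<in>mseqs m. Z js \<star> pdl js f 0)"
      unfolding G_def
      by (simp, intro sum.UNION_disjoint ballI impI finite_msize finite_mseqs)
        (auto simp: mseqs_def)
    also have "\<dots> = (\<Sum>m | msize m = k. fact k *\<^sub>R (fueter m x \<star> taylor_coeff f m))"
    proof (intro sum.cong refl)
      fix m :: "'n multi" assume m: "m \<in> {m. msize m = k}"
      have "(\<Sum>js\<in>mseqs m. Z js \<star> pdl js f 0) = (\<Sum>js\<in>mseqs m. Z js) \<star> mpd m f 0"
        by (simp add: cl_mult.sum_left mpd_eq_pdl[OF f])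
      then show "(\<Sum>js\<in>mseqs m. Z js \<star> pdl js f 0) = fact k *\<^sub>R (fueter m x \<star> taylor_coeff f m)"
        using m mfact_pos[of m] by (simp add: fueter_def taylor_coeff_def Z_def cl_mult.scaleR_left cl_mult.scaleR_right)
    qed
    finally show ?thesis by (simp add: scaleR_sum_right)
  qed
  obtain K where K: "K \<ge> 1" "\<And>a b :: 'n clifford. norm (a \<star> b) \<le> K * norm a * norm b"
    using cl_mult_norm_bound by blast
  obtain C where C: "C \<ge> 1" "\<And>(f :: 'n clfun) (y :: 'n paravec) R M js. f \<in> monogenic \<Longrightarrow> R > 0 \<Longrightarrow>
      (\<And>x. x \<in> cball y R \<Longrightarrow> norm (f x) \<le> M) \<Longrightarrow>
      norm (pdl js f y) \<le> (C / R) ^ length js * fact (length js) * M"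
    using monogenic_pdl_bound by blast
  \<comment> \<open>\<open>D\<close> collects the number of words, the bound for one variable and
    the Cauchy constant, each per letter. The radius \<open>R\<close> then makes D/R at most
    1/2.\<close>
  define D where "D = real CARD('n) * (K * 2 * norm x) * C"
  define R where "R = 2 * D + 1"
  have D0: "D \<ge> 0" using K(1) C(1) by (simp add: D_def)
  obtain M where M: "M \<ge> 0" "\<And>y. norm y \<le> norm x + R \<Longrightarrow> norm (f y) \<le> M"
    using monogenic_bounded_on_cball[OF f] by blast
  have normZ: "norm (Z js) \<le> (K * 2 * norm x) ^ length js" for js
  proof (induction js)
    case (Cons i js)
    have "norm (?z i \<star> Z js) \<le> K * norm (?z i) * norm (Z js)" by (rule K(2))
    also have "\<dots> \<le> K * (2 * norm x) * (K * 2 * norm x) ^ length js"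
      using K(1) Cons by (intro mult_mono norm_fueter_var_le) auto
    finally show ?case by (simp add: Z_def cl_prod_list_def mult_ac)
  qed (simp add: Z_def cl_prod_list_def)
  have normG: "norm (G k t) \<le> K * M * fact k * (D / R) ^ k" if t: "t \<in> {0..1}" for k t
  proof -
    have "norm (Z js \<star> pdl js f (t *\<^sub>R x)) \<le> K * (K * 2 * norm x) ^ k * ((C / R) ^ k * fact k * M)"
      if js: "js \<in> ?L k" for js
    proof -
      have "norm (pdl js f (t *\<^sub>R x)) \<le> (C / R) ^ length js * fact (length js) * M"
      proof (rule C(2)[OF f])
        fix y assume "y \<in> cball (t *\<^sub>R x) R"
        moreover have "norm (t *\<^sub>R x) \<le> norm x" using t by (simp add: mult_left_le_one_le)
        ultimately show "norm (f y) \<le> M"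
          using norm_triangle_sub[of y "t *\<^sub>R x"] by (intro M(2)) (simp add: dist_norm norm_minus_commute)
      qed (use D0 in \<open>simp add: R_def\<close>)
      then have "K * norm (Z js) * norm (pdl js f (t *\<^sub>R x)) \<le> K * (K * 2 * norm x) ^ k * ((C / R) ^ k * fact k * M)"
        using normZ[of js] js K(1) by (intro mult_mono mult_nonneg_nonneg) auto
      then show ?thesis using K(2)[of "Z js" "pdl js f (t *\<^sub>R x)"] by linarith
    qed
    then have "norm (G k t) \<le> real (card (?L k)) * (K * (K * 2 * norm x) ^ k * ((C / R) ^ k * fact k * M))"
      unfolding G_def by (intro sum_norm_bound) auto
    also have "\<dots> = K * M * fact k * (D / R) ^ k"
      unfolding cardL D_def by (simp add: power_mult_distrib power_divide)
    finally show ?thesis .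
  qed
  have err: "norm (f x - (\<Sum>m | msize m < Suc k. fueter m x \<star> taylor_coeff f m)) \<le> K * M * (real (Suc k) * (1 / 2) ^ Suc k)" for k
  proof -
    have f1: "G 0 1 = f x"
    proof -
      have "?L 0 = {[]}" by auto
      then show ?thesis by (simp add: G_def Z_def cl_prod_list_def cl_mult_one)
    qed
    have "((\<lambda>t. ((1 - t) ^ (Suc k - 1) / fact (Suc k - 1)) *\<^sub>R G (Suc k) t) has_integral
        G 0 1 - (\<Sum>i<Suc k. ((1 - 0) ^ i / fact i) *\<^sub>R G i 0)) {0..1}"
      by (rule Taylor_has_integral[where f = "G 0" and Df = G]) (auto intro: G)
    moreover have "(\<Sum>i<Suc k. ((1 - 0) ^ i / fact i) *\<^sub>R G i 0) = (\<Sum>m | msize m < Suc k. fueter m x \<star> taylor_coeff f m)"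
      unfolding sum_msize_less by (intro sum.cong refl) (simp add: G0)
    ultimately have I: "((\<lambda>t. ((1 - t) ^ k / fact k) *\<^sub>R G (Suc k) t) has_integral
        f x - (\<Sum>m | msize m < Suc k. fueter m x \<star> taylor_coeff f m)) (cbox 0 1)"
      by (simp add: f1)
    have b: "norm (((1 - t) ^ k / fact k) *\<^sub>R G (Suc k) t) \<le> K * M * (real (Suc k) * (1 / 2) ^ Suc k)"
      if t: "t \<in> cbox 0 1" for t :: real
    proof -
      have t': "t \<in> {0..1}" using t by simp
      have "norm (((1 - t) ^ k / fact k) *\<^sub>R G (Suc k) t) = (1 - t) ^ k / fact k * norm (G (Suc k) t)"
        using t' by simp
      also have "\<dots> \<le> 1 / fact k * (K * M * fact (Suc k) * (D / R) ^ Suc k)"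
        using t' by (intro mult_mono divide_right_mono power_le_one normG) auto
      also have "\<dots> = K * M * real (Suc k) * (D / R) ^ Suc k" by (simp add: fact_Suc del: power_Suc of_nat_Suc)
      also have "\<dots> \<le> K * M * real (Suc k) * (1 / 2) ^ Suc k"
        using K(1) M(1) D0 by (intro mult_left_mono power_mono) (auto simp: R_def field_simps)
      finally show ?thesis by (simp only: mult.assoc)
    qed
    have "0 \<le> K * M * (real (Suc k) * (1 / 2) ^ Suc k)" using K(1) M(1) by simp
    from has_integral_bound[OF this I b] show ?thesis by simp
  qed
  have "(\<lambda>k. real (Suc k) * (1 / 2) ^ Suc k) \<longlonglongrightarrow> 0"
    using powser_times_n_limit_0[of "1 / 2 :: real", THEN LIMSEQ_Suc] by simp
  then have "(\<lambda>k. K * M * (real (Suc k) * (1 / 2) ^ Suc k)) \<longlonglongrightarrow> K * M * 0"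
    by (intro tendsto_mult tendsto_const)
  then have Z: "(\<lambda>k. K * M * (real (Suc k) * (1 / 2) ^ Suc k)) \<longlonglongrightarrow> 0" by (simp only: mult_zero_right)
  have "(\<lambda>k. (\<Sum>m | msize m < Suc k. fueter m x \<star> taylor_coeff f m) - f x) \<longlonglongrightarrow> 0"
  proof (rule Lim_null_comparison[OF always_eventually Z], rule allI)
    show "norm ((\<Sum>m | msize m < Suc k. fueter m x \<star> taylor_coeff f m) - f x) \<le> K * M * (real (Suc k) * (1 / 2) ^ Suc k)" for k
      using err[of k] by (simp only: norm_minus_commute)
  qed
  from LIM_zero_cancel[OF this] show ?thesis by (rule LIMSEQ_imp_Suc)
qed

subsection \<open>Series of monogenic functions\<close>

text \<open>There are at most \<open>n\<^sup>q\<close> multi-indices of size \<open>q\<close>, so that \<open>geo\<close> has total mass at most \<open>2\<close>.\<close>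

definition geo :: "'n::{finite,linorder} multi \<Rightarrow> real" where
  "geo m = (1 / (2 * real CARD('n))) ^ msize m"

lemma geo_pos: "geo m > 0"
  by (simp add: geo_def)

lemma geo_summable: "geo summable_on UNIV"
  unfolding geo_def by (rule geometric_multi_summable) auto

lemma geo_sum_le: "finite S \<Longrightarrow> sum geo S \<le> 2"
  unfolding geo_def by (rule geometric_multi_sum_le) auto

lemma geo_infsum_le: "infsum geo UNIV \<le> 2"
  by (rule infsum_le_finite_sums[OF geo_summable]) (rule geo_sum_le)

lemma power_le_geo: "0 \<le> a \<Longrightarrow> a * (2 * real CARD('n)) \<le> 1 \<Longrightarrow> a ^ msize (m :: 'n::{finite,linorder} multi) \<le> geo m"
  unfolding geo_def by (intro power_mono) (auto simp: field_simps)

lemma geo_bounded_summable: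
  fixes g :: "'n::{finite,linorder} multi \<Rightarrow> 'b::banach"
  assumes "\<And>m. norm (g m) \<le> B * geo m"
  shows "(\<lambda>m. norm (g m)) summable_on UNIV" and "(\<Sum>\<^sub>\<infinity>m. norm (g m)) \<le> 2 * B"
proof -
  have s: "(\<lambda>m. B * geo m) summable_on UNIV" by (rule summable_on_cmult_right[OF geo_summable])
  then show 1: "(\<lambda>m. norm (g m)) summable_on UNIV" by (rule Infinite_Sum.abs_summable_on_comparison_test') (rule assms)
  have "0 \<le> B * geo (\<lambda>i::'n. 0)" using assms[of "\<lambda>i. 0"] norm_ge_zero order_trans by blast
  then have B: "B \<ge> 0" using geo_pos[of "\<lambda>i::'n. 0"] by (simp add: zero_le_mult_iff)
  have "(\<Sum>\<^sub>\<infinity>m. norm (g m)) \<le> (\<Sum>\<^sub>\<infinity>m::'n multi. B * geo m)"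
    by (rule infsum_mono) (use 1 s assms in auto)
  also have "\<dots> = B * infsum geo (UNIV :: 'n multi set)" by (rule infsum_cmult_right[OF geo_summable])
  also have "\<dots> \<le> 2 * B" using mult_left_mono[OF geo_infsum_le B] by (simp add: mult.commute)
  finally show "(\<Sum>\<^sub>\<infinity>m. norm (g m)) \<le> 2 * B" .
qed

text \<open>The scalar power series of the coefficient norms. Up to a constant it is
  submultiplicative for the CK-product, which pointwise norms are not.\<close>

definition majorant :: "'n::{finite,linorder} clfun \<Rightarrow> real \<Rightarrow> real" where
  "majorant f t = (\<Sum>\<^sub>\<infinity>m. t ^ msize m * norm (taylor_coeff f m))"

lemma majorant_summable:
  fixes f :: "'n::{finite,linorder} clfun"
  assumes f: "f \<in> monogenic" and t: "t \<ge> 0"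
  shows "(\<lambda>m. t ^ msize m * norm (taylor_coeff f m)) summable_on UNIV"
proof -
  obtain C where C: "C \<ge> 1" "\<And>(f :: 'n clfun) R M m. f \<in> monogenic \<Longrightarrow> R > 0 \<Longrightarrow>
      (\<And>x. norm x \<le> R \<Longrightarrow> norm (f x) \<le> M) \<Longrightarrow> norm (taylor_coeff f m) \<le> (C / R) ^ msize m * M"
    using taylor_coeff_bound by blast
  \<comment> \<open>Brings t C / R below 1/(2n), the ratio of \<open>geo\<close>.\<close>
  define R where "R = C * t * (2 * real CARD('n)) + 1"
  have R: "R > 0" using C(1) t by (simp add: R_def add_nonneg_pos)
  obtain M where M: "M \<ge> 0" "\<And>x. norm x \<le> R \<Longrightarrow> norm (f x) \<le> M"
    using monogenic_bounded_on_cball[OF f] by blast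
  have "norm (t ^ msize m * norm (taylor_coeff f m)) \<le> M * geo m" for m
  proof -
    have "t ^ msize m * norm (taylor_coeff f m) \<le> t ^ msize m * ((C / R) ^ msize m * M)"
      using t by (intro mult_left_mono C(2)[OF f R] M(2)) auto
    also have "\<dots> = (t * C / R) ^ msize m * M" by (simp add: power_mult_distrib power_divide)
    also have "\<dots> \<le> geo m * M"
      using C(1) t R M(1) by (intro mult_right_mono power_le_geo) (auto simp: R_def field_simps)
    finally show ?thesis using t by (simp add: mult.commute)
  qed
  from geo_bounded_summable(1)[of "\<lambda>m. t ^ msize m * norm (taylor_coeff f m)", OF this]
  show ?thesis by (rule Infinite_Sum.abs_summable_summable)
qed

lemma majorant_le:
  fixes f :: "'n::{finite,linorder} clfun"
  assumes "t \<ge> 0" "\<And>m. t ^ msize m * norm (taylor_coeff f m) \<le> B * geo m"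
  shows "majorant f t \<le> 2 * B"
  using geo_bounded_summable(2)[of "\<lambda>m. t ^ msize m * norm (taylor_coeff f m)" B] assms
  by (simp add: majorant_def)

lemma majorant_nonneg: "t \<ge> 0 \<Longrightarrow> majorant f t \<ge> 0"
  unfolding majorant_def by (intro infsum_nonneg) auto

lemma filterlim_msize_less:
  "filterlim (\<lambda>N. {m :: 'n::{finite,linorder} multi. msize m < N}) (finite_subsets_at_top UNIV) sequentially"
  unfolding filterlim_finite_subsets_at_top
proof (intro allI impI, elim conjE)
  fix X :: "'n multi set" assume X: "finite X"
  define N where "N = Suc (Max (insert 0 (msize ` X)))"
  have "X \<subseteq> {m. msize m < N}" using X by (auto simp: N_def less_Suc_eq_le)
  then show "\<forall>\<^sub>F y in sequentially. finite {m :: 'n multi. msize m < y} \<and> X \<subseteq> {m. msize m < y} \<and> {m :: 'n multi. msize m < y} \<subseteq> UNIV"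
    by (intro eventually_sequentiallyI[of N]) (auto simp: finite_msize_less)
qed

text \<open>The majorant gives absolute summability, and the partial sums by degree are cofinal
  among the finite ones, so the unordered sum has the same value.\<close>

lemma monogenic_taylor_has_sum:
  fixes f :: "'n::{finite,linorder} clfun"
  assumes f: "f \<in> monogenic"
  shows "((\<lambda>m. fueter m x \<star> taylor_coeff f m) has_sum f x) UNIV"
proof -
  obtain A where A: "A \<ge> 1" "\<And>(m :: 'n multi) x a. norm (fueter m x \<star> a) \<le> (A * norm x) ^ msize m * norm a"
    using fueter_norm_bound by blast
  have "(\<lambda>m. norm (fueter m x \<star> taylor_coeff f m)) summable_on UNIV"
    using A by (intro Infinite_Sum.abs_summable_on_comparison_test'[OF majorant_summable[OF f, of "A * norm x"]]) auto
  then have s: "((\<lambda>m. fueter m x \<star> taylor_coeff f m) has_sum (\<Sum>\<^sub>\<infinity>m. fueter m x \<star> taylor_coeff f m)) UNIV"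
    by (rule has_sum_infsum[OF Infinite_Sum.abs_summable_summable])
  then have "(\<lambda>N. \<Sum>m | msize m < N. fueter m x \<star> taylor_coeff f m) \<longlonglongrightarrow> (\<Sum>\<^sub>\<infinity>m. fueter m x \<star> taylor_coeff f m)"
    unfolding has_sum_def by (rule filterlim_compose[OF _ filterlim_msize_less])
  then have "(\<Sum>\<^sub>\<infinity>m. fueter m x \<star> taylor_coeff f m) = f x"
    using monogenic_taylor_tendsto[OF f] LIMSEQ_unique by blast
  then show ?thesis using s by simp
qed

lemma monogenic_eqI:
  assumes "f \<in> monogenic" "g \<in> monogenic" "\<And>m. taylor_coeff f m = taylor_coeff g m"
  shows "f = g"
proof
  fix x
  show "f x = g x"
    using monogenic_taylor_has_sum[OF assms(1), of x] monogenic_taylor_has_sum[OF assms(2), of x] assms(3)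
    by (simp add: has_sum_unique)
qed

lemma taylor_coeff_scaleR:
  "f \<in> monogenic \<Longrightarrow> taylor_coeff (\<lambda>x. c *\<^sub>R f x) m = c *\<^sub>R taylor_coeff f m"
  using taylor_coeff_linear(2)[of f f "c *\<^sub>R cl_one" m] by (simp add: cl_mult_scaleR_one)

lemma taylor_coeff_0: "taylor_coeff (\<lambda>x. 0) m = 0"
  using taylor_coeff_scaleR[OF monogenic_const[of 0], of 0] by simp

lemma taylor_coeff_sum:
  assumes "\<And>i. i \<in> I \<Longrightarrow> f i \<in> monogenic"
  shows "taylor_coeff (\<lambda>x. \<Sum>i\<in>I. f i x) m = (\<Sum>i\<in>I. taylor_coeff (f i) m)"
  using assms
proof (induction I rule: infinite_finite_induct)
  case (insert i I)
  then show ?case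
    by (simp add: taylor_coeff_linear(1)[OF _ monogenic_sum])
qed (simp_all add: taylor_coeff_0)

text \<open>The M-test gives locally uniform convergence of the net of finite sums. Coefficients
  follow because each is bounded, through the Cauchy estimate, by the supremum over the unit
  ball.\<close>

lemma monogenic_infsum:
  fixes g :: "'i \<Rightarrow> 'n::{finite,linorder} clfun"
  assumes g: "\<And>i. g i \<in> monogenic"
    and bound: "\<And>R. \<exists>b. b summable_on UNIV \<and> (\<forall>i x. norm x \<le> R \<longrightarrow> norm (g i x) \<le> b i)"
  shows "(\<lambda>x. \<Sum>\<^sub>\<infinity>i. g i x) \<in> monogenic"
    and "((\<lambda>i. taylor_coeff (g i) m) has_sum taylor_coeff (\<lambda>x. \<Sum>\<^sub>\<infinity>i. g i x) m) UNIV"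
proof -
  let ?F = "finite_subsets_at_top (UNIV :: 'i set)"
  let ?G = "\<lambda>x. \<Sum>\<^sub>\<infinity>i. g i x"
  have lim: "uniform_limit (cball 0 R) (\<lambda>S x. \<Sum>i\<in>S. g i x) ?G ?F" for R
  proof -
    obtain b where b: "b summable_on UNIV" "\<And>i x. norm x \<le> R \<Longrightarrow> norm (g i x) \<le> b i"
      using bound by blast
    show ?thesis by (rule Weierstrass_m_test_general[OF _ b(1)]) (use b(2) in auto)
  qed
  have gs: "(\<lambda>x. \<Sum>i\<in>S. g i x) \<in> monogenic" for S by (rule monogenic_sum[OF g])
  show G: "?G \<in> monogenic"
    by (rule monogenic_limit[OF finite_subsets_at_top_neq_bot gs lim])
  obtain C where C: "C \<ge> 1" "\<And>(f :: 'n clfun) R M m. f \<in> monogenic \<Longrightarrow> R > 0 \<Longrightarrow>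
      (\<And>x. norm x \<le> R \<Longrightarrow> norm (f x) \<le> M) \<Longrightarrow> norm (taylor_coeff f m) \<le> (C / R) ^ msize m * M"
    using taylor_coeff_bound by blast
  show "((\<lambda>i. taylor_coeff (g i) m) has_sum taylor_coeff ?G m) UNIV"
    unfolding has_sum_def
  proof (rule tendstoI)
    fix e :: real assume e: "e > 0"
    define d where "d = e / (2 * C ^ msize m)"
    have d: "d > 0" using e C(1) by (simp add: d_def)
    from uniform_limitD[OF lim[of 1] d]
    show "\<forall>\<^sub>F S in ?F. dist (\<Sum>i\<in>S. taylor_coeff (g i) m) (taylor_coeff ?G m) < e"
    proof (rule eventually_mono)
      fix S assume S: "\<forall>x\<in>cball 0 1. dist (\<Sum>i\<in>S. g i x) (?G x) < d"
      have "norm (taylor_coeff (\<lambda>x. (\<Sum>i\<in>S. g i x) - ?G x) m) \<le> (C / 1) ^ msize m * d"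
        using S by (intro C(2) monogenic_diff(1) gs G) (auto simp: dist_norm less_imp_le)
      also have "\<dots> < e" using e C(1) by (simp add: d_def)
      finally show "dist (\<Sum>i\<in>S. taylor_coeff (g i) m) (taylor_coeff ?G m) < e"
        by (simp add: taylor_coeff_linear(3)[OF gs G] taylor_coeff_sum[OF g] dist_norm)
    qed
  qed
qed

subsection \<open>The CK-product\<close>

lemma nonneg_product_summable:
  fixes c :: "'a \<Rightarrow> real" and d :: "'b \<Rightarrow> real"
  assumes c: "c summable_on UNIV" "\<And>i. c i \<ge> 0" and d: "d summable_on UNIV" "\<And>j. d j \<ge> 0"
  shows "(\<lambda>(i, j). c i * d j) summable_on UNIV"
    and "(\<Sum>\<^sub>\<infinity>(i, j). c i * d j) = infsum c UNIV * infsum d UNIV"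
proof -
  have row: "(\<Sum>\<^sub>\<infinity>j. c i * d j) = c i * infsum d UNIV" for i by (rule infsum_cmult_right[OF d(1)])
  have "(\<lambda>p. norm (case p of (i, j) \<Rightarrow> c i * d j)) summable_on (UNIV \<times> UNIV)"
    unfolding Infinite_Sum.abs_summable_on_Sigma_iff
    using c d by (auto simp: abs_mult row infsum_nonneg intro!: summable_on_cmult_right summable_on_cmult_left)
  then show s: "(\<lambda>(i, j). c i * d j) summable_on UNIV" using Infinite_Sum.abs_summable_summable by fastforce
  have "(\<Sum>\<^sub>\<infinity>(i, j). c i * d j) = (\<Sum>\<^sub>\<infinity>i. \<Sum>\<^sub>\<infinity>j. c i * d j)"
    using infsum_Sigma_banach[of "\<lambda>(i, j). c i * d j" UNIV "\<lambda>_. UNIV"] s by simp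
  then show "(\<Sum>\<^sub>\<infinity>(i, j). c i * d j) = infsum c UNIV * infsum d UNIV"
    unfolding row by (simp add: infsum_cmult_left[OF c(1)])
qed

lemma msize_madd: "msize (madd m k) = msize m + msize k"
  by (simp add: msize_def madd_def sum.distrib)

text \<open>Everything rests on absolute summability of the double series, dominated by the product
  of the two majorants at \<open>A\<close> |x|; it permits passing between iterated and double sums.
  The constants do not depend on the functions.\<close>

lemma ck_prod_properties:
  obtains A K where "A \<ge> 1" "K \<ge> 1"
    "\<And>(f :: 'n::{finite,linorder} clfun) g x. f \<in> monogenic \<Longrightarrow> g \<in> monogenic \<Longrightarrow>
      ((\<lambda>(m, k). fueter (madd m k) x \<star> taylor_coeff f m \<star> taylor_coeff g k) has_sum (f \<odot>\<^sub>L g) x) UNIV"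
    "\<And>(f :: 'n clfun) g x. f \<in> monogenic \<Longrightarrow> g \<in> monogenic \<Longrightarrow>
      norm ((f \<odot>\<^sub>L g) x) \<le> K * majorant f (A * norm x) * majorant g (A * norm x)"
    "\<And>(f :: 'n clfun) g. f \<in> monogenic \<Longrightarrow> g \<in> monogenic \<Longrightarrow> f \<odot>\<^sub>L g \<in> monogenic"
proof -
  obtain A where A: "A \<ge> 1" "\<And>(m :: 'n multi) x a. norm (fueter m x \<star> a) \<le> (A * norm x) ^ msize m * norm a"
    using fueter_norm_bound by blast
  obtain K where K: "K \<ge> 1" "\<And>a b :: 'n clifford. norm (a \<star> b) \<le> K * norm a * norm b"
    using cl_mult_norm_bound by blast
  let ?t = "\<lambda>f g x (m, k). fueter (madd m k) x \<star> taylor_coeff f m \<star> taylor_coeff g k"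
  let ?c = "\<lambda>f r m. (A * r) ^ msize m * norm (taylor_coeff f m)"
  have bound: "norm (?t f g x p) \<le> K * (case p of (m, k) \<Rightarrow> ?c f r m * ?c g r k)" if "norm x \<le> r"
    for f g :: "'n clfun" and x r p
  proof -
    obtain m k where p: "p = (m, k)" by force
    have "norm (fueter (madd m k) x \<star> (taylor_coeff f m \<star> taylor_coeff g k)) \<le>
        (A * norm x) ^ msize (madd m k) * norm (taylor_coeff f m \<star> taylor_coeff g k)" by (rule A(2))
    also have "\<dots> \<le> (A * r) ^ msize (madd m k) * (K * norm (taylor_coeff f m) * norm (taylor_coeff g k))"
      using A(1) that order_trans[OF norm_ge_zero that]
      by (intro mult_mono power_mono K(2) zero_le_power mult_nonneg_nonneg) auto
    finally show ?thesis by (simp add: p cl_mult_assoc msize_madd power_add mult_ac)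
  qed
  have prod: "(\<lambda>(m, k). ?c f r m * ?c g r k) summable_on UNIV"
      "(\<Sum>\<^sub>\<infinity>(m, k). ?c f r m * ?c g r k) = majorant f (A * r) * majorant g (A * r)"
    if "f \<in> monogenic" "g \<in> monogenic" "r \<ge> 0" for f g :: "'n clfun" and r
    unfolding majorant_def
    using A(1) that by (intro nonneg_product_summable majorant_summable; simp)+
  have sum: "(\<lambda>p. norm (?t f g x p)) summable_on UNIV" if "f \<in> monogenic" "g \<in> monogenic" for f g :: "'n clfun" and x
    by (rule Infinite_Sum.abs_summable_on_comparison_test'[OF summable_on_cmult_right[OF prod(1)[OF that norm_ge_zero[of x]]] bound])
      simp
  have has_sum: "(?t f g x has_sum (f \<odot>\<^sub>L g) x) UNIV" if "f \<in> monogenic" "g \<in> monogenic" for f g :: "'n clfun" and x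
  proof -
    have s: "?t f g x summable_on UNIV" by (rule Infinite_Sum.abs_summable_summable[OF sum[OF that]])
    then have "(f \<odot>\<^sub>L g) x = infsum (?t f g x) UNIV"
      using infsum_Sigma_banach[of "?t f g x" UNIV "\<lambda>_. UNIV"] by (simp add: ck_prod_def)
    then show ?thesis using s by simp
  qed
  have norm: "norm ((f \<odot>\<^sub>L g) x) \<le> K * majorant f (A * norm x) * majorant g (A * norm x)"
    if "f \<in> monogenic" "g \<in> monogenic" for f g :: "'n clfun" and x
  proof -
    have "norm ((f \<odot>\<^sub>L g) x) \<le> K * (\<Sum>\<^sub>\<infinity>(m, k). ?c f (norm x) m * ?c g (norm x) k)"
      by (rule norm_infsum_le[OF has_sum[OF that] has_sum_cmult_right[OF has_sum_infsum[OF prod(1)[OF that norm_ge_zero[of x]]]] bound]) simp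
    then show ?thesis unfolding prod(2)[OF that norm_ge_zero[of x]] by (simp add: mult.assoc)
  qed
  have mono: "f \<odot>\<^sub>L g \<in> monogenic" if "f \<in> monogenic" "g \<in> monogenic" for f g :: "'n clfun"
  proof -
    have "f \<odot>\<^sub>L g = (\<lambda>x. \<Sum>\<^sub>\<infinity>p. ?t f g x p)"
      by (rule ext, rule infsumI[symmetric], rule has_sum[OF that])
    moreover have "(\<lambda>x. \<Sum>\<^sub>\<infinity>p. ?t f g x p) \<in> monogenic"
    proof (rule monogenic_infsum(1))
      show "(\<lambda>x. ?t f g x p) \<in> monogenic" for p
        by (cases p) (simp add: monogenic_mult_right(1) monogenic_fueter)
      fix R :: real
      show "\<exists>b. b summable_on UNIV \<and> (\<forall>p x. norm x \<le> R \<longrightarrow> norm (?t f g x p) \<le> b p)"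
      proof (intro exI conjI allI impI)
        show "(\<lambda>p. K * (case p of (m, k) \<Rightarrow> ?c f (max 0 R) m * ?c g (max 0 R) k)) summable_on UNIV"
          by (intro summable_on_cmult_right prod(1) that) simp
        show "norm (?t f g x p) \<le> K * (case p of (m, k) \<Rightarrow> ?c f (max 0 R) m * ?c g (max 0 R) k)"
          if "norm x \<le> R" for p x
          by (rule bound) (use that in simp)
      qed
    qed
    ultimately show ?thesis by simp
  qed
  show ?thesis
  proof (rule that[of A K])
    show "A \<ge> 1" "K \<ge> 1" by (rule A(1) K(1))+
    fix f g :: "'n clfun" assume fg: "f \<in> monogenic" "g \<in> monogenic"
    show "f \<odot>\<^sub>L g \<in> monogenic" by (rule mono[OF fg])
    show "(?t f g x has_sum (f \<odot>\<^sub>L g) x) UNIV" for x by (rule has_sum[OF fg])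
    show "norm ((f \<odot>\<^sub>L g) x) \<le> K * majorant f (A * norm x) * majorant g (A * norm x)" for x by (rule norm[OF fg])
  qed
qed

text \<open>The CK-product of \<open>w\<close> with the Fueter polynomial of index \<open>j\<close>:
  it moves the coefficient at k to k + j.\<close>

definition shift :: "'n multi \<Rightarrow> 'n::{finite,linorder} clfun \<Rightarrow> 'n clfun" where
  "shift j w x = (\<Sum>\<^sub>\<infinity>k. fueter (madd k j) x \<star> taylor_coeff w k)"

text \<open>The formula for Taylor coefficients reduces identities between such products to index
  arithmetic, since coefficients determine a monogenic function.\<close>

lemma shift_properties:
  obtains A where "A \<ge> 1"
    "\<And>(w :: 'n::{finite,linorder} clfun) j x. w \<in> monogenic \<Longrightarrow>
      norm (shift j w x) \<le> (A * norm x) ^ msize j * majorant w (A * norm x)"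
    "\<And>(w :: 'n clfun) j. w \<in> monogenic \<Longrightarrow> shift j w \<in> monogenic"
    "\<And>(w :: 'n clfun) j p. w \<in> monogenic \<Longrightarrow>
      taylor_coeff (shift j w) p = (if j \<le> p then taylor_coeff w (\<lambda>i. p i - j i) else 0)"
proof -
  obtain A where A: "A \<ge> 1" "\<And>(m :: 'n multi) x a. norm (fueter m x \<star> a) \<le> (A * norm x) ^ msize m * norm a"
    using fueter_norm_bound by blast
  have bound: "norm (fueter (madd k j) x \<star> taylor_coeff w k) \<le> (A * r) ^ msize j * ((A * r) ^ msize k * norm (taylor_coeff w k))"
    if "norm x \<le> r" for w :: "'n clfun" and j k x r
  proof -
    have "norm (fueter (madd k j) x \<star> taylor_coeff w k) \<le> (A * norm x) ^ msize (madd k j) * norm (taylor_coeff w k)"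
      by (rule A(2))
    also have "\<dots> \<le> (A * r) ^ msize (madd k j) * norm (taylor_coeff w k)"
      using A(1) that by (intro mult_right_mono power_mono) auto
    finally show ?thesis by (simp add: msize_madd power_add mult_ac)
  qed
  have sm: "(\<lambda>k. (A * r) ^ msize j * ((A * r) ^ msize k * norm (taylor_coeff w k))) summable_on UNIV"
    if "w \<in> monogenic" "r \<ge> 0" for w :: "'n clfun" and j r
    using A(1) that by (intro summable_on_cmult_right majorant_summable) auto
  have norm: "norm (shift j w x) \<le> (A * norm x) ^ msize j * majorant w (A * norm x)"
    if w: "w \<in> monogenic" for w :: "'n clfun" and j x
  proof -
    have "(\<lambda>k. fueter (madd k j) x \<star> taylor_coeff w k) summable_on UNIV"
      by (rule Infinite_Sum.abs_summable_summable, rule Infinite_Sum.abs_summable_on_comparison_test'[OF sm[OF w norm_ge_zero[of x]] bound]) simp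
    then have "((\<lambda>k. fueter (madd k j) x \<star> taylor_coeff w k) has_sum shift j w x) UNIV"
      by (simp add: shift_def)
    then have "norm (shift j w x) \<le> (\<Sum>\<^sub>\<infinity>k. (A * norm x) ^ msize j * ((A * norm x) ^ msize k * norm (taylor_coeff w k)))"
      by (rule norm_infsum_le[OF _ has_sum_infsum[OF sm[OF w norm_ge_zero[of x]]] bound]) simp
    also have "\<dots> = (A * norm x) ^ msize j * majorant w (A * norm x)"
      unfolding majorant_def using A(1) w by (intro infsum_cmult_right majorant_summable) auto
    finally show ?thesis .
  qed
  have g: "(\<lambda>x. fueter (madd k j) x \<star> taylor_coeff w k) \<in> monogenic" for w :: "'n clfun" and j k
    by (rule monogenic_mult_right(1)[OF monogenic_fueter])
  have b: "\<exists>b. b summable_on UNIV \<and> (\<forall>k x. norm x \<le> R \<longrightarrow> norm (fueter (madd k j) x \<star> taylor_coeff w k) \<le> b k)"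
    if "w \<in> monogenic" for w :: "'n clfun" and R j
  proof (intro exI conjI allI impI)
    show "(\<lambda>k. (A * max 0 R) ^ msize j * ((A * max 0 R) ^ msize k * norm (taylor_coeff w k))) summable_on UNIV"
      by (rule sm[OF that]) simp
    show "norm (fueter (madd k j) x \<star> taylor_coeff w k) \<le> (A * max 0 R) ^ msize j * ((A * max 0 R) ^ msize k * norm (taylor_coeff w k))"
      if "norm x \<le> R" for k x
      by (rule bound) (use that in simp)
  qed
  have mono: "shift j w \<in> monogenic" if w: "w \<in> monogenic" for w :: "'n clfun" and j
    unfolding shift_def by (rule monogenic_infsum(1)[OF g b[OF w]])
  have tc: "taylor_coeff (shift j w) p = (if j \<le> p then taylor_coeff w (\<lambda>i. p i - j i) else 0)"
    if w: "w \<in> monogenic" for w :: "'n clfun" and j p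
  proof -
    have 1: "((\<lambda>k. taylor_coeff (\<lambda>x. fueter (madd k j) x \<star> taylor_coeff w k) p) has_sum taylor_coeff (shift j w) p) UNIV"
      unfolding shift_def by (rule monogenic_infsum(2)[OF g b[OF w]])
    have eq: "taylor_coeff (\<lambda>x. fueter (madd k j) x \<star> taylor_coeff w k) p = (if p = madd k j then taylor_coeff w k else 0)" for k
      by (simp add: taylor_coeff_linear(2)[OF monogenic_fueter monogenic_fueter] taylor_coeff_fueter cl_mult_one cl_mult.zero_left)
    let ?q = "\<lambda>i. p i - j i"
    have pk: "p = madd k j \<longleftrightarrow> j \<le> p \<and> k = ?q" for k
      by (auto simp: madd_def le_fun_def fun_eq_iff)
    have "((\<lambda>k. if p = madd k j then taylor_coeff w k else 0) has_sum (if j \<le> p then taylor_coeff w ?q else 0)) UNIV"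
    proof -
      have "((\<lambda>k. if p = madd k j then taylor_coeff w k else 0) has_sum (\<Sum>k\<in>{?q}. if p = madd k j then taylor_coeff w k else 0)) {?q}"
        by (rule has_sum_finite) simp
      also have "(\<Sum>k\<in>{?q}. if p = madd k j then taylor_coeff w k else 0) = (if j \<le> p then taylor_coeff w ?q else 0)"
        by (simp add: pk)
      finally show ?thesis
        by (rule has_sum_cong_neutral[THEN iffD1, rotated -1]) (auto simp: pk)
    qed
    then show ?thesis using 1 unfolding eq by (rule has_sum_unique[rotated])
  qed
  show ?thesis by (rule that[OF A(1)]) (fact norm mono tc)+
qed

lemma ck_prod_single:
  assumes "\<And>l. taylor_coeff g l = (if l = j then c *\<^sub>R cl_one else 0)"
  shows "(w \<odot>\<^sub>L g) x = c *\<^sub>R shift j w x"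
proof -
  have "(\<Sum>\<^sub>\<infinity>l. fueter (madd k l) x \<star> taylor_coeff w k \<star> taylor_coeff g l) = c *\<^sub>R (fueter (madd k j) x \<star> taylor_coeff w k)" for k
  proof -
    have "(\<Sum>\<^sub>\<infinity>l. fueter (madd k l) x \<star> taylor_coeff w k \<star> taylor_coeff g l) =
        (\<Sum>\<^sub>\<infinity>l\<in>{j}. fueter (madd k l) x \<star> taylor_coeff w k \<star> taylor_coeff g l)"
      by (rule infsum_cong_neutral) (auto simp: assms cl_mult.zero_right)
    then show ?thesis by (simp add: assms cl_mult_scaleR_one)
  qed
  then show ?thesis by (simp add: ck_prod_def shift_def infsum_scaleR_right)
qed

subsection \<open>Proximate orders\<close>

definition weight :: "(real \<Rightarrow> real) \<Rightarrow> real \<Rightarrow> real" where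
  "weight \<rho> r = r powr \<rho> r"

lemma weight_nonneg: "weight \<rho> r \<ge> 0"
  by (simp add: weight_def)

text \<open>With h(t) = \<rho>(t) ln t, the logarithm of the weight, t h'(t) = \<rho>'(t) t ln t +
  \<rho>(t) tends to \<rho>0. Tolerances of \<rho>0/4 for both summands place it between \<rho>0/2
  and 3\<rho>0/2, so comparison with multiples of ln t gives power bounds for the quotient of two
  weights.\<close>

lemma proximate_order_regular:
  assumes po: "proximate_order \<rho> \<rho>0" and pos: "\<rho>0 > 0"
  shows "\<exists>r0\<ge>1. \<forall>r s. r0 \<le> r \<longrightarrow> r \<le> s \<longrightarrow>
    (s / r) powr (\<rho>0 / 2) * weight \<rho> r \<le> weight \<rho> s \<and> weight \<rho> s \<le> (s / r) powr (2 * \<rho>0) * weight \<rho> r"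
proof -
  have "\<forall>\<^sub>F r in at_top. dist (\<rho> r) \<rho>0 < \<rho>0 / 4"
    using po pos unfolding proximate_order_def by (intro tendstoD) auto
  moreover have "\<forall>\<^sub>F r in at_top. dist (deriv \<rho> r * r * ln r) 0 < \<rho>0 / 4"
    using po pos unfolding proximate_order_def by (intro tendstoD) auto
  ultimately have "\<forall>\<^sub>F r in at_top. dist (\<rho> r) \<rho>0 < \<rho>0 / 4 \<and> dist (deriv \<rho> r * r * ln r) 0 < \<rho>0 / 4"
    by (rule eventually_conj)
  then obtain r1 where r1: "\<And>r. r \<ge> r1 \<Longrightarrow> dist (\<rho> r) \<rho>0 < \<rho>0 / 4 \<and> dist (deriv \<rho> r * r * ln r) 0 < \<rho>0 / 4"
    unfolding eventually_at_top_linorder by blast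
  define r0 where "r0 = max 1 r1"
  define h where "h t = \<rho> t * ln t" for t
  have D: "(h has_real_derivative (deriv \<rho> t * t * ln t + \<rho> t) / t) (at t)" if "t \<ge> r0" for t
  proof -
    have t: "t > 0" using that by (simp add: r0_def)
    have "\<rho> differentiable (at t within {0..})" using po t by (simp add: proximate_order_def differentiable_on_def)
    moreover have "at t within {0..} = at t" using t by (intro at_within_interior) simp
    ultimately have "(\<rho> has_real_derivative deriv \<rho> t) (at t)"
      using DERIV_deriv_iff_real_differentiable by metis
    then have "(h has_real_derivative deriv \<rho> t * ln t + (1 / t) * \<rho> t) (at t)"
      unfolding h_def using t by (auto intro!: derivative_eq_intros)
    then show ?thesis using t by (simp add: field_simps)
  qed
  have w: "weight \<rho> t = exp (h t)" if "t \<ge> r0" for t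
    using that by (simp add: weight_def h_def powr_def r0_def)
  have lower: "(s / r) powr (\<rho>0 / 2) * weight \<rho> r \<le> weight \<rho> s" if "r0 \<le> r" "r \<le> s" for r s
  proof -
    have rs: "r > 0" "s > 0" using that by (auto simp: r0_def)
    have "h r - \<rho>0 / 2 * ln r \<le> h s - \<rho>0 / 2 * ln s"
    proof (rule DERIV_nonneg_imp_nondecreasing[OF that(2)])
      fix t assume t: "r \<le> t" "t \<le> s"
      have "((\<lambda>t. h t - \<rho>0 / 2 * ln t) has_real_derivative (deriv \<rho> t * t * ln t + \<rho> t) / t - \<rho>0 / 2 * (1 / t)) (at t)"
        using t that rs by (auto intro!: derivative_eq_intros D)
      moreover have "(deriv \<rho> t * t * ln t + \<rho> t) / t - \<rho>0 / 2 * (1 / t) = (deriv \<rho> t * t * ln t + \<rho> t - \<rho>0 / 2) / t"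
        by (simp add: diff_divide_distrib)
      moreover have "deriv \<rho> t * t * ln t + \<rho> t - \<rho>0 / 2 \<ge> 0"
        using r1[of t] t that unfolding r0_def dist_real_def by linarith
      ultimately show "\<exists>y. ((\<lambda>t. h t - \<rho>0 / 2 * ln t) has_real_derivative y) (at t) \<and> 0 \<le> y"
        using t rs by (intro exI conjI) auto
    qed
    then have "\<rho>0 / 2 * ln (s / r) + h r \<le> h s" using rs by (simp add: ln_div field_simps)
    then show ?thesis using that rs by (simp add: w powr_def flip: exp_add)
  qed
  have upper: "weight \<rho> s \<le> (s / r) powr (2 * \<rho>0) * weight \<rho> r" if "r0 \<le> r" "r \<le> s" for r s
  proof -
    have rs: "r > 0" "s > 0" using that by (auto simp: r0_def)
    have "2 * \<rho>0 * ln r - h r \<le> 2 * \<rho>0 * ln s - h s"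
    proof (rule DERIV_nonneg_imp_nondecreasing[OF that(2)])
      fix t assume t: "r \<le> t" "t \<le> s"
      have "((\<lambda>t. 2 * \<rho>0 * ln t - h t) has_real_derivative 2 * \<rho>0 * (1 / t) - (deriv \<rho> t * t * ln t + \<rho> t) / t) (at t)"
        using t that rs by (auto intro!: derivative_eq_intros D)
      moreover have "2 * \<rho>0 * (1 / t) - (deriv \<rho> t * t * ln t + \<rho> t) / t = (2 * \<rho>0 - (deriv \<rho> t * t * ln t + \<rho> t)) / t"
        by (simp add: diff_divide_distrib)
      moreover have "2 * \<rho>0 - (deriv \<rho> t * t * ln t + \<rho> t) \<ge> 0"
        using r1[of t] t that unfolding r0_def dist_real_def by linarith
      ultimately show "\<exists>y. ((\<lambda>t. 2 * \<rho>0 * ln t - h t) has_real_derivative y) (at t) \<and> 0 \<le> y"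
        using t rs by (intro exI conjI) auto
    qed
    then have "h s \<le> 2 * \<rho>0 * ln (s / r) + h r" using rs by (simp add: ln_div field_simps)
    then show ?thesis using that rs by (simp add: w powr_def flip: exp_add)
  qed
  have "r0 \<ge> 1" by (simp add: r0_def)
  with lower upper show ?thesis by blast
qed

lemma weight_bounded:
  assumes po: "proximate_order \<rho> \<rho>0"
  obtains C where "C \<ge> 0" "\<And>r. 0 \<le> r \<Longrightarrow> r \<le> R \<Longrightarrow> weight \<rho> r \<le> C"
proof -
  have "continuous_on {0..} \<rho>" using po unfolding proximate_order_def by (intro differentiable_imp_continuous_on) blast
  then have "continuous_on {0..R} \<rho>" by (rule continuous_on_subset) auto
  then have "bounded (\<rho> ` {0..R})" by (intro compact_imp_bounded compact_continuous_image) auto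
  then obtain P where P: "\<And>r. r \<in> {0..R} \<Longrightarrow> norm (\<rho> r) \<le> P" unfolding bounded_iff by blast
  have "weight \<rho> r \<le> max 1 R powr P" if "0 \<le> r" "r \<le> R" for r
  proof -
    have "\<rho> r \<ge> 0" using po that by (simp add: proximate_order_def)
    then have "r powr \<rho> r \<le> max 1 R powr \<rho> r" using that by (intro powr_mono2) auto
    also have "\<dots> \<le> max 1 R powr P" using P[of r] that by (intro powr_mono) auto
    finally show ?thesis by (simp add: weight_def)
  qed
  then show ?thesis using that[of "max 1 R powr P"] by simp
qed

text \<open>Beyond \<open>r0\<close>, the lower power bound serves as monotonicity when s \<le> r,
  and for r < s the upper one applies with s/r at most 2\<mu>. Before \<open>r0\<close> the weight
  need not be monotone; that bounded range goes into the additive constant.\<close>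

lemma weight_dominated:
  assumes po: "proximate_order \<rho> \<rho>0" and pos: "\<rho>0 > 0"
  obtains D C where "D \<ge> 1" "C \<ge> 0"
    "\<And>r s. 0 \<le> r \<Longrightarrow> 0 \<le> s \<Longrightarrow> s \<le> b * (r + 1) \<Longrightarrow> weight \<rho> s \<le> D * weight \<rho> r + C"
proof -
  obtain r0 where r0: "r0 \<ge> 1"
    and lower: "\<And>r s. r0 \<le> r \<Longrightarrow> r \<le> s \<Longrightarrow> (s / r) powr (\<rho>0 / 2) * weight \<rho> r \<le> weight \<rho> s"
    and upper: "\<And>r s. r0 \<le> r \<Longrightarrow> r \<le> s \<Longrightarrow> weight \<rho> s \<le> (s / r) powr (2 * \<rho>0) * weight \<rho> r"
    using proximate_order_regular[OF po pos] by blast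
  define \<mu> where "\<mu> = max 1 b"
  obtain C where C: "C \<ge> 0" "\<And>r. 0 \<le> r \<Longrightarrow> r \<le> \<mu> * (r0 + 1) \<Longrightarrow> weight \<rho> r \<le> C"
    using weight_bounded[OF po] by blast
  define D where "D = (2 * \<mu>) powr (2 * \<rho>0)"
  have D: "D \<ge> 1" using pos by (simp add: D_def \<mu>_def ge_one_powr_ge_zero)
  have main: "weight \<rho> s \<le> D * weight \<rho> r + C" if r: "0 \<le> r" and s: "0 \<le> s" "s \<le> b * (r + 1)" for r s
  proof -
    have s': "s \<le> \<mu> * (r + 1)" using order_trans[OF s(2) mult_right_mono[of b \<mu> "r + 1"]] r by (simp add: \<mu>_def)
    have DW: "0 \<le> D * weight \<rho> r" using D by (simp add: weight_nonneg)
    have r0': "r0 \<le> \<mu> * (r0 + 1)"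
    proof -
      have "1 * (r0 + 1) \<le> \<mu> * (r0 + 1)" using r0 by (intro mult_right_mono) (auto simp: \<mu>_def)
      then show ?thesis by (rule order_trans[rotated]) simp
    qed
    consider "r < r0 \<or> s < r0" | "r0 \<le> s" "s \<le> r" | "r0 \<le> r" "r < s" by linarith
    then show ?thesis
    proof cases
      case 1
      have "s \<le> \<mu> * (r0 + 1)"
      proof (cases "r < r0")
        case True
        then have "\<mu> * (r + 1) \<le> \<mu> * (r0 + 1)" by (intro mult_left_mono) (auto simp: \<mu>_def)
        then show ?thesis by (rule order_trans[OF s'])
      qed (use 1 r0' in linarith)
      then show ?thesis using C(2)[of s] s(1) DW by linarith
    next
      case 2
      have "1 * weight \<rho> s \<le> (r / s) powr (\<rho>0 / 2) * weight \<rho> s"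
        using 2 r0 pos by (intro mult_right_mono weight_nonneg ge_one_powr_ge_zero) (auto simp: field_simps)
      also have "\<dots> \<le> weight \<rho> r" by (rule lower[OF 2])
      also have "\<dots> \<le> D * weight \<rho> r" using D mult_right_mono[OF D weight_nonneg[of \<rho> r]] by simp
      finally show ?thesis using C(1) by simp
    next
      case 3
      have "\<mu> * (r + 1) \<le> \<mu> * (2 * r)" using 3 r0 by (intro mult_left_mono) (auto simp: \<mu>_def)
      then have "s / r \<le> 2 * \<mu>" using s' 3 r0 by (simp add: field_simps)
      then have "(s / r) powr (2 * \<rho>0) \<le> D" unfolding D_def using 3 r0 pos by (intro powr_mono2) auto
      then have "(s / r) powr (2 * \<rho>0) * weight \<rho> r \<le> D * weight \<rho> r" by (intro mult_right_mono weight_nonneg)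
      then show ?thesis using upper[of r s] 3 C(1) by linarith
    qed
  qed
  show ?thesis
  proof (rule that[of D C])
    show "D \<ge> 1" "C \<ge> 0" by (rule D C(1))+
    show "weight \<rho> s \<le> D * weight \<rho> r + C" if "0 \<le> r" "0 \<le> s" "s \<le> b * (r + 1)" for r s
      by (rule main[OF that])
  qed
qed

lemma weight_bigo:
  assumes po1: "proximate_order \<rho>1 ord1" and O: "(\<lambda>r. r powr \<rho>1 r) \<in> O[at_top](\<lambda>r. r powr \<rho>2 r)"
  obtains D C where "D \<ge> 1" "C \<ge> 0" "\<And>r. 0 \<le> r \<Longrightarrow> weight \<rho>1 r \<le> D * weight \<rho>2 r + C"
proof -
  obtain c where c: "c > 0" "\<forall>\<^sub>F r in at_top. norm (r powr \<rho>1 r) \<le> c * norm (r powr \<rho>2 r)"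
    using landau_o.bigE[OF O] by blast
  then obtain R where R: "\<And>r. r \<ge> R \<Longrightarrow> weight \<rho>1 r \<le> c * weight \<rho>2 r"
    unfolding eventually_at_top_linorder weight_def by auto
  obtain C where C: "C \<ge> 0" "\<And>r. 0 \<le> r \<Longrightarrow> r \<le> R \<Longrightarrow> weight \<rho>1 r \<le> C"
    using weight_bounded[OF po1] by blast
  have "weight \<rho>1 r \<le> max 1 c * weight \<rho>2 r + C" if "0 \<le> r" for r
  proof (cases "r \<le> R")
    case True
    have "0 \<le> max 1 c * weight \<rho>2 r" by (simp add: weight_nonneg)
    then show ?thesis using C(2)[OF that True] by linarith
  next
    case False
    have "c * weight \<rho>2 r \<le> max 1 c * weight \<rho>2 r" by (intro mult_right_mono weight_nonneg) simp
    then show ?thesis using R[of r] False C(1) by linarith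
  qed
  then show ?thesis using that[of "max 1 c" C] C(1) by simp
qed

text \<open>Puts the normalization into the form used later: G_q = (\<phi>(q)/\<kappa>)^q with
  increasing \<phi>. Once \<phi>(q) has passed the point where the normalization agrees with \<rho>,
  the original weight at \<phi>(q) is q.\<close>

lemma normalization_inverse:
  assumes norm: "normalization \<rho>' \<rho> \<rho>0" and pos: "\<rho>0 > 0"
  shows "\<exists>\<phi> \<kappa>. \<kappa> > 0 \<and> (\<forall>q>0. \<phi> q > 0) \<and> (\<forall>q. G_seq \<rho>' \<rho>0 q = (if q = 0 then 1 else (\<phi> (real q) / \<kappa>) ^ q)) \<and>
    (\<forall>p q. 0 < p \<longrightarrow> p \<le> q \<longrightarrow> \<phi> p \<le> \<phi> q) \<and>
    (\<forall>R. \<exists>q0. \<forall>q\<ge>q0. q > 0 \<and> \<phi> q \<ge> R \<and> weight \<rho> (\<phi> q) = q)"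
proof -
  let ?w = "\<lambda>r. r powr \<rho>' r"
  define \<phi> where "\<phi> q = the_inv_into {0<..} ?w q" for q
  define \<kappa> where "\<kappa> = (exp 1 * \<rho>0) powr (1 / \<rho>0)"
  obtain r1 where r1: "r1 > 0" "\<And>r. r \<ge> r1 \<Longrightarrow> \<rho>' r = \<rho> r"
    using norm unfolding normalization_def by blast
  have sm: "strict_mono_on {0<..} ?w" and im: "?w ` {0<..} = {0<..}"
    using norm by (auto simp: normalization_def)
  have inj: "inj_on ?w {0<..}" by (rule strict_mono_on_imp_inj_on[OF sm])
  have \<phi>_pos: "\<phi> q > 0" if "q > 0" for q
    unfolding \<phi>_def using the_inv_into_into[OF inj, of q "{0<..}"] im that by auto
  have w\<phi>: "?w (\<phi> q) = q" if "q > 0" for q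
    unfolding \<phi>_def using f_the_inv_into_f[OF inj, of q] im that by auto
  have mono: "\<phi> p \<le> \<phi> q" if "0 < p" "p \<le> q" for p q
  proof (rule ccontr)
    assume "\<not> \<phi> p \<le> \<phi> q"
    then have "?w (\<phi> q) < ?w (\<phi> p)"
      using that by (intro strict_mono_onD[OF sm]) (auto simp: \<phi>_pos)
    then show False using that w\<phi>[of p] w\<phi>[of q] by simp
  qed
  have \<kappa>: "\<kappa> > 0" using pos by (simp add: \<kappa>_def)
  have G: "G_seq \<rho>' \<rho>0 q = (if q = 0 then 1 else (\<phi> (real q) / \<kappa>) ^ q)" for q
  proof -
    have "\<kappa> ^ q = \<kappa> powr real q" using \<kappa> by (simp add: powr_realpow)
    also have "\<dots> = (exp 1 * \<rho>0) powr (real q / \<rho>0)" by (simp add: \<kappa>_def powr_powr)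
    finally show ?thesis by (simp add: G_seq_def \<phi>_def power_divide)
  qed
  have large: "\<exists>q0. \<forall>q\<ge>q0. q > 0 \<and> \<phi> q \<ge> R \<and> weight \<rho> (\<phi> q) = q" for R
  proof (intro exI allI impI)
    define S where "S = max R r1"
    have S: "S > 0" using r1(1) by (simp add: S_def)
    fix q assume q: "q \<ge> ?w S"
    have "?w S > 0" using S by simp
    then have q0: "q > 0" using q by linarith
    have "\<phi> q \<ge> S"
    proof (rule ccontr)
      assume "\<not> \<phi> q \<ge> S"
      then have "?w (\<phi> q) < ?w S" using S \<phi>_pos[OF q0] by (intro strict_mono_onD[OF sm]) auto
      then show False using q w\<phi>[OF q0] by simp
    qed
    then have "\<phi> q \<ge> R" "\<phi> q \<ge> r1" by (auto simp: S_def)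
    then show "q > 0 \<and> \<phi> q \<ge> R \<and> weight \<rho> (\<phi> q) = q"
      using q0 w\<phi>[OF q0] r1(2) by (simp add: weight_def)
  qed
  show ?thesis using \<kappa> \<phi>_pos G mono large by blast
qed

lemma G_seq_pos:
  assumes "normalization \<rho>' \<rho> \<rho>0" "\<rho>0 > 0" shows "G_seq \<rho>' \<rho>0 q > 0"
proof -
  obtain \<phi> \<kappa> where *: "\<kappa> > 0" "\<And>q. q > 0 \<Longrightarrow> \<phi> q > 0" "\<And>q. G_seq \<rho>' \<rho>0 q = (if q = 0 then 1 else (\<phi> (real q) / \<kappa>) ^ q)"
    using normalization_inverse[OF assms] by blast
  show ?thesis using *(1,2) by (simp add: *(3))
qed

text \<open>Since \<phi> increases, both bases may be replaced by \<phi>(j + k).\<close>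

lemma G_seq_supermult:
  assumes "normalization \<rho>' \<rho> \<rho>0" "\<rho>0 > 0"
  shows "G_seq \<rho>' \<rho>0 j * G_seq \<rho>' \<rho>0 k \<le> G_seq \<rho>' \<rho>0 (j + k)"
proof -
  obtain \<phi> \<kappa> where *: "\<kappa> > 0" "\<And>q. q > 0 \<Longrightarrow> \<phi> q > 0" "\<And>q. G_seq \<rho>' \<rho>0 q = (if q = 0 then 1 else (\<phi> (real q) / \<kappa>) ^ q)"
    "\<And>p q. 0 < p \<Longrightarrow> p \<le> q \<Longrightarrow> \<phi> p \<le> \<phi> q"
    using normalization_inverse[OF assms] by blast
  show ?thesis
  proof (cases "j = 0 \<or> k = 0")
    case False
    have "(\<phi> (real j) / \<kappa>) ^ j * (\<phi> (real k) / \<kappa>) ^ k \<le> (\<phi> (real (j + k)) / \<kappa>) ^ j * (\<phi> (real (j + k)) / \<kappa>) ^ k"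
      using False *(1) *(2)[of "real j"] *(2)[of "real k"] *(2)[of "real (j + k)"]
      by (intro mult_mono power_mono divide_right_mono *(4)) auto
    then show ?thesis using False by (simp add: *(3) power_add)
  qed (auto simp: *(3))
qed

text \<open>The optimal radius in the Cauchy estimate is of order \<phi>(q). Taking
  \<phi>(q)/\<delta> instead raises the weight to at most \<delta> powr (-2\<rho>0) q, which the
  choice of \<sigma> cancels down to q, while the denominator gains \<delta>^-q. So every \<epsilon>
  is attainable if \<sigma> is small enough. The finitely many small q are absorbed into
  \<open>C\<close> with radius 1.\<close>

lemma G_seq_lower:
  assumes po: "proximate_order \<rho> \<rho>0" and norm: "normalization \<rho>' \<rho> \<rho>0" and pos: "\<rho>0 > 0" and \<epsilon>: "\<epsilon> > 0"
  obtains \<sigma> C where "\<sigma> > 0" "C > 0"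
    "\<And>q. \<exists>R>0. exp (\<sigma> * weight \<rho> R) / R ^ q \<le> C * \<epsilon> ^ q / G_seq \<rho>' \<rho>0 q"
proof -
  obtain r0 where r0: "r0 \<ge> 1"
    and lower: "\<And>r s. r0 \<le> r \<Longrightarrow> r \<le> s \<Longrightarrow> (s / r) powr (\<rho>0 / 2) * weight \<rho> r \<le> weight \<rho> s"
    and upper: "\<And>r s. r0 \<le> r \<Longrightarrow> r \<le> s \<Longrightarrow> weight \<rho> s \<le> (s / r) powr (2 * \<rho>0) * weight \<rho> r"
    using proximate_order_regular[OF po pos] by blast
  obtain \<phi> \<kappa> where \<kappa>: "\<kappa> > 0" and \<phi>: "\<And>q. q > 0 \<Longrightarrow> \<phi> q > 0"
    and G: "\<And>q. G_seq \<rho>' \<rho>0 q = (if q = 0 then 1 else (\<phi> (real q) / \<kappa>) ^ q)"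
    and \<phi>_mono: "\<And>p q. 0 < p \<Longrightarrow> p \<le> q \<Longrightarrow> \<phi> p \<le> \<phi> q"
    and large: "\<And>R. \<exists>q0. \<forall>q\<ge>q0. q > 0 \<and> \<phi> q \<ge> R \<and> weight \<rho> (\<phi> q) = q"
    using normalization_inverse[OF norm pos] by blast
  obtain q1 where q1: "\<And>q. q \<ge> q1 \<Longrightarrow> q > 0 \<and> \<phi> q \<ge> r0 \<and> weight \<rho> (\<phi> q) = q" using large by blast
  define q0 where "q0 = nat \<lceil>q1\<rceil>"
  define \<delta> where "\<delta> = min 1 (\<epsilon> * \<kappa> / exp 1)"
  have \<delta>: "\<delta> > 0" "\<delta> \<le> 1" "\<delta> * exp 1 \<le> \<epsilon> * \<kappa>" using \<epsilon> \<kappa> by (auto simp: \<delta>_def min_def field_simps)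
  define \<sigma> where "\<sigma> = \<delta> powr (2 * \<rho>0)"
  have \<sigma>: "\<sigma> > 0" using \<delta>(1) by (simp add: \<sigma>_def)
  let ?G = "G_seq \<rho>' \<rho>0"
  have Gpos: "?G q > 0" for q by (rule G_seq_pos[OF norm pos])
  define C where "C = 1 + (\<Sum>q<q0. exp (\<sigma> * weight \<rho> 1) * ?G q / \<epsilon> ^ q)"
  have sum_nonneg': "(\<Sum>q<q0. exp (\<sigma> * weight \<rho> 1) * ?G q / \<epsilon> ^ q) \<ge> 0"
    using Gpos \<epsilon> by (intro sum_nonneg) (simp add: less_imp_le)
  then have C: "C \<ge> 1" by (simp add: C_def)
  have "\<exists>R>0. exp (\<sigma> * weight \<rho> R) / R ^ q \<le> C * \<epsilon> ^ q / ?G q" for q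
  proof (cases "q < q0")
    case True
    have "exp (\<sigma> * weight \<rho> 1) * ?G q / \<epsilon> ^ q \<le> (\<Sum>q<q0. exp (\<sigma> * weight \<rho> 1) * ?G q / \<epsilon> ^ q)"
      using True Gpos \<epsilon> by (intro member_le_sum) (auto simp: less_imp_le)
    then have "exp (\<sigma> * weight \<rho> 1) * ?G q / \<epsilon> ^ q \<le> C" by (simp add: C_def)
    then show ?thesis using Gpos[of q] \<epsilon> by (intro exI[of _ 1]) (simp add: field_simps)
  next
    case False
    then have "real q \<ge> q1" unfolding q0_def by linarith
    from q1[OF this] have q: "q > 0" "\<phi> q \<ge> r0" "weight \<rho> (\<phi> q) = real q" by auto
    define R where "R = \<phi> q / \<delta>"
    have p: "\<phi> q > 0" using q r0 by linarith
    have R: "R > 0" "\<phi> q \<le> R" using p \<delta> by (auto simp: R_def field_simps)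
    have "weight \<rho> R \<le> (R / \<phi> q) powr (2 * \<rho>0) * real q" using upper[OF q(2) R(2)] q(3) by simp
    also have "R / \<phi> q = 1 / \<delta>" using p by (simp add: R_def)
    finally have "\<sigma> * weight \<rho> R \<le> \<sigma> * ((1 / \<delta>) powr (2 * \<rho>0) * real q)" using \<sigma> by (intro mult_left_mono) auto
    also have "\<dots> = real q" using \<delta>(1) by (simp add: \<sigma>_def powr_divide)
    finally have "exp (\<sigma> * weight \<rho> R) \<le> exp 1 ^ q" by (simp add: exp_of_nat_mult[symmetric])
    then have "exp (\<sigma> * weight \<rho> R) / R ^ q \<le> exp 1 ^ q / R ^ q" using R by (intro divide_right_mono) auto
    also have "\<dots> = (\<delta> * exp 1) ^ q / \<phi> q ^ q" using \<delta>(1) by (simp add: R_def power_divide power_mult_distrib)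
    also have "\<dots> \<le> (\<epsilon> * \<kappa>) ^ q / \<phi> q ^ q" using \<delta> p by (intro divide_right_mono power_mono) auto
    also have "\<dots> = 1 * \<epsilon> ^ q / ?G q" using q by (simp add: G power_divide power_mult_distrib)
    also have "\<dots> \<le> C * \<epsilon> ^ q / ?G q"
      using C \<epsilon> Gpos[of q] by (intro divide_right_mono mult_right_mono) auto
    finally show ?thesis using R by blast
  qed
  then show ?thesis using that[OF \<sigma>, of C] C by simp
qed

text \<open>One term of the exponential series, of an order N with N \<alpha> \<ge> 1, already
  dominates s.\<close>

lemma power_le_exp_powr:
  fixes \<alpha> \<sigma> :: real
  assumes "\<alpha> > 0" "\<sigma> > 0"
  obtains \<Lambda> where "\<Lambda> \<ge> 1" "\<And>s. s \<ge> 1 \<Longrightarrow> s \<le> \<Lambda> * exp (\<sigma> * s powr \<alpha>)"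
proof -
  define N where "N = nat \<lceil>1 / \<alpha>\<rceil>"
  have N: "real N * \<alpha> \<ge> 1"
  proof -
    have "1 / \<alpha> \<le> real N" unfolding N_def by linarith
    then show ?thesis using assms(1) by (simp add: field_simps)
  qed
  have "s \<le> fact N / \<sigma> ^ N * exp (\<sigma> * s powr \<alpha>)" if s: "s \<ge> 1" for s
  proof -
    let ?y = "s powr \<alpha>"
    have "s = s powr 1" using s by simp
    also have "\<dots> \<le> s powr (real N * \<alpha>)" using N s by (intro powr_mono) auto
    also have "\<dots> = ?y ^ N" using s by (simp add: powr_powr mult.commute flip: powr_realpow)
    finally have 1: "s \<le> ?y ^ N" .
    have "(\<sigma> * ?y) ^ N /\<^sub>R fact N \<le> exp (\<sigma> * ?y)"
      using sum_le_suminf[OF summable_exp_generic[of "\<sigma> * ?y"], of "{N}"] assms(2) by (simp add: exp_def)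
    then have "?y ^ N \<le> fact N / \<sigma> ^ N * exp (\<sigma> * ?y)"
      using assms(2) by (simp add: field_simps power_mult_distrib)
    then show ?thesis using 1 by linarith
  qed
  moreover have "fact N / \<sigma> ^ N * exp (\<sigma> * s powr \<alpha>) \<le> max 1 (fact N / \<sigma> ^ N) * exp (\<sigma> * s powr \<alpha>)" for s
    by (intro mult_right_mono) auto
  ultimately have "s \<le> max 1 (fact N / \<sigma> ^ N) * exp (\<sigma> * s powr \<alpha>)" if "s \<ge> 1" for s
    using that order_trans by blast
  then show ?thesis using that[of "max 1 (fact N / \<sigma> ^ N)"] by simp
qed

text \<open>Write r = \<phi>(q) s. For s \<ge> 1 the weight is at least s powr (\<rho>0/2) times q,
  and its exponential beats s^q up to \<Lambda>^q. Here \<sigma> is prescribed and the geometric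
  factor \<mu> is paid, opposite to \<open>G_seq_lower\<close>.\<close>

lemma G_seq_upper:
  assumes po: "proximate_order \<rho> \<rho>0" and norm: "normalization \<rho>' \<rho> \<rho>0" and pos: "\<rho>0 > 0" and \<sigma>: "\<sigma> > 0"
  obtains \<mu> C where "\<mu> > 0" "C > 0"
    "\<And>q r. r \<ge> 0 \<Longrightarrow> r ^ q \<le> C * \<mu> ^ q * G_seq \<rho>' \<rho>0 q * exp (\<sigma> * weight \<rho> r)"
proof -
  obtain r0 where r0: "r0 \<ge> 1"
    and lower: "\<And>r s. r0 \<le> r \<Longrightarrow> r \<le> s \<Longrightarrow> (s / r) powr (\<rho>0 / 2) * weight \<rho> r \<le> weight \<rho> s"
    and upper: "\<And>r s. r0 \<le> r \<Longrightarrow> r \<le> s \<Longrightarrow> weight \<rho> s \<le> (s / r) powr (2 * \<rho>0) * weight \<rho> r"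
    using proximate_order_regular[OF po pos] by blast
  obtain \<phi> \<kappa> where \<kappa>: "\<kappa> > 0" and \<phi>: "\<And>q. q > 0 \<Longrightarrow> \<phi> q > 0"
    and G: "\<And>q. G_seq \<rho>' \<rho>0 q = (if q = 0 then 1 else (\<phi> (real q) / \<kappa>) ^ q)"
    and \<phi>_mono: "\<And>p q. 0 < p \<Longrightarrow> p \<le> q \<Longrightarrow> \<phi> p \<le> \<phi> q"
    and large: "\<And>R. \<exists>q0. \<forall>q\<ge>q0. q > 0 \<and> \<phi> q \<ge> R \<and> weight \<rho> (\<phi> q) = q"
    using normalization_inverse[OF norm pos] by blast
  obtain q1 where q1: "\<And>q. q \<ge> q1 \<Longrightarrow> q > 0 \<and> \<phi> q \<ge> r0 \<and> weight \<rho> (\<phi> q) = q" using large by blast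
  define q0 where "q0 = nat \<lceil>q1\<rceil>"
  obtain \<Lambda> where \<Lambda>: "\<Lambda> \<ge> 1" "\<And>s. s \<ge> 1 \<Longrightarrow> s \<le> \<Lambda> * exp (\<sigma> * s powr (\<rho>0 / 2))"
    using power_le_exp_powr[of "\<rho>0 / 2" \<sigma>] pos \<sigma> by auto
  let ?G = "G_seq \<rho>' \<rho>0"
  have Gpos: "?G q > 0" for q by (rule G_seq_pos[OF norm pos])
  define \<mu> where "\<mu> = \<kappa> * \<Lambda>"
  have \<mu>: "\<mu> > 0" using \<kappa> \<Lambda>(1) by (simp add: \<mu>_def)
  have big: "r ^ q \<le> \<mu> ^ q * ?G q * exp (\<sigma> * weight \<rho> r)" if q': "q \<ge> q0" and r: "r \<ge> 0" for q r
  proof -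
    have "real q \<ge> q1" using q' unfolding q0_def by linarith
    from q1[OF this] have q: "q > 0" "\<phi> q \<ge> r0" "weight \<rho> (\<phi> q) = real q" by auto
    have p: "\<phi> q > 0" using q r0 by linarith
    have e: "\<mu> ^ q * ?G q = \<phi> q ^ q * \<Lambda> ^ q" using q \<kappa> by (simp add: G \<mu>_def power_divide power_mult_distrib)
    show ?thesis
    proof (cases "r \<le> \<phi> q")
      case True
      have "r ^ q * 1 * 1 \<le> \<phi> q ^ q * \<Lambda> ^ q * exp (\<sigma> * weight \<rho> r)"
        using True r \<Lambda>(1) \<sigma> p by (intro mult_mono power_mono one_le_power) (auto simp: weight_nonneg)
      then show ?thesis by (simp add: e)
    next
      case False
      define s where "s = r / \<phi> q"
      have s: "s \<ge> 1" "r = \<phi> q * s" using False p by (auto simp: s_def)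
      have "s powr (\<rho>0 / 2) * real q \<le> weight \<rho> r" using lower[OF q(2), of r] False q(3) by (simp add: s_def)
      then have "\<sigma> * (s powr (\<rho>0 / 2) * real q) \<le> \<sigma> * weight \<rho> r" using \<sigma> by (intro mult_left_mono) auto
      then have 1: "exp (\<sigma> * s powr (\<rho>0 / 2)) ^ q \<le> exp (\<sigma> * weight \<rho> r)"
        by (simp add: exp_of_nat_mult[symmetric] mult_ac)
      have "s ^ q \<le> (\<Lambda> * exp (\<sigma> * s powr (\<rho>0 / 2))) ^ q" using s(1) by (intro power_mono \<Lambda>(2)) auto
      also have "\<dots> \<le> \<Lambda> ^ q * exp (\<sigma> * weight \<rho> r)"
        unfolding power_mult_distrib using \<Lambda>(1) by (intro mult_left_mono 1) auto
      finally have "\<phi> q ^ q * s ^ q \<le> \<phi> q ^ q * (\<Lambda> ^ q * exp (\<sigma> * weight \<rho> r))" using p by (intro mult_left_mono) auto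
      then show ?thesis by (simp add: e s(2) power_mult_distrib mult.assoc)
    qed
  qed
  \<comment> \<open>For q < q0 the estimate r^q \<le> 1 + r^q0 reduces to the bound already
    available at q0.\<close>
  define B where "B = 1 + \<mu> ^ q0 * ?G q0"
  have B: "B \<ge> 1" using \<mu> Gpos[of q0] by (simp add: B_def less_imp_le)
  define C where "C = 1 + (\<Sum>q<q0. B / (\<mu> ^ q * ?G q))"
  have "(\<Sum>q<q0. B / (\<mu> ^ q * ?G q)) \<ge> 0"
    using Gpos \<mu> B by (intro sum_nonneg) (simp add: less_imp_le)
  then have C: "C \<ge> 1" by (simp add: C_def)
  have "r ^ q \<le> C * \<mu> ^ q * ?G q * exp (\<sigma> * weight \<rho> r)" if r: "r \<ge> 0" for q r
  proof (cases "q < q0")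
    case True
    have E: "exp (\<sigma> * weight \<rho> r) \<ge> 1" using \<sigma> by (simp add: weight_nonneg)
    have "r ^ q \<le> 1 + r ^ q0"
    proof (cases "r \<le> 1")
      case True
      then show ?thesis using r power_le_one[of r q] zero_le_power[of r q0] by linarith
    next
      case False
      then have "r ^ q \<le> r ^ q0" using True by (intro power_increasing) auto
      then show ?thesis by simp
    qed
    also have "\<dots> \<le> 1 * exp (\<sigma> * weight \<rho> r) + \<mu> ^ q0 * ?G q0 * exp (\<sigma> * weight \<rho> r)"
      using big[of q0 r] r E by (intro add_mono) auto
    also have "\<dots> = B * exp (\<sigma> * weight \<rho> r)" by (simp add: B_def algebra_simps)
    finally have 1: "r ^ q \<le> B * exp (\<sigma> * weight \<rho> r)" .
    have "B / (\<mu> ^ q * ?G q) \<le> (\<Sum>q<q0. B / (\<mu> ^ q * ?G q))"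
      using True Gpos \<mu> B by (intro member_le_sum) (auto simp: less_imp_le)
    then have "B / (\<mu> ^ q * ?G q) \<le> C" by (simp add: C_def)
    then have "B \<le> C * (\<mu> ^ q * ?G q)" using Gpos[of q] \<mu> by (simp add: pos_divide_le_eq)
    then have "B * exp (\<sigma> * weight \<rho> r) \<le> C * (\<mu> ^ q * ?G q) * exp (\<sigma> * weight \<rho> r)" by (intro mult_right_mono) auto
    from order_trans[OF 1 this] show ?thesis by (simp only: mult.assoc)
  next
    case False
    have "1 * (\<mu> ^ q * ?G q * exp (\<sigma> * weight \<rho> r)) \<le> C * (\<mu> ^ q * ?G q * exp (\<sigma> * weight \<rho> r))"
      using C \<mu> Gpos[of q] by (intro mult_right_mono) (auto simp: less_imp_le)
    moreover have "r ^ q \<le> 1 * (\<mu> ^ q * ?G q * exp (\<sigma> * weight \<rho> r))" using big[of q r] False r by simp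
    ultimately show ?thesis unfolding mult.assoc[of C] by (rule order_trans[rotated])
  qed
  then show ?thesis using that[OF \<mu>, of C] C by simp
qed

subsection \<open>Growth spaces\<close>

text \<open>A real form of an upper bound for the extended-valued norm; \<open>B\<close> need not be
  optimal.\<close>

definition growth_bound :: "(real \<Rightarrow> real) \<Rightarrow> real \<Rightarrow> 'n::{finite,linorder} clfun \<Rightarrow> real \<Rightarrow> bool" where
  "growth_bound \<rho> \<sigma> f B \<longleftrightarrow> (\<forall>x. norm (f x) \<le> B * exp (\<sigma> * weight \<rho> (norm x)))"

lemma growth_boundI: "(\<And>x. norm (f x) \<le> B * exp (\<sigma> * weight \<rho> (norm x))) \<Longrightarrow> growth_bound \<rho> \<sigma> f B"
  and growth_boundD: "growth_bound \<rho> \<sigma> f B \<Longrightarrow> norm (f x) \<le> B * exp (\<sigma> * weight \<rho> (norm x))"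
  unfolding growth_bound_def by blast+

lemma growth_bound_nonneg: "growth_bound \<rho> \<sigma> f B \<Longrightarrow> B \<ge> 0"
  using order_trans[OF norm_ge_zero growth_boundD[of \<rho> \<sigma> f B 0]] by (simp add: zero_le_mult_iff)

lemma growth_norm_le_iff: "growth_norm \<rho> \<sigma> f \<le> ereal B \<longleftrightarrow> growth_bound \<rho> \<sigma> f B"
proof -
  have "norm (f x) * exp (- \<sigma> * norm x powr \<rho> (norm x)) \<le> B \<longleftrightarrow> norm (f x) \<le> B * exp (\<sigma> * weight \<rho> (norm x))" for x
    by (simp add: weight_def exp_minus field_simps)
  then show ?thesis unfolding growth_norm_def growth_bound_def SUP_le_iff by simp
qed

lemma growth_norm_less_iff: "growth_norm \<rho> \<sigma> f < ereal \<delta> \<longleftrightarrow> (\<exists>B<\<delta>. growth_bound \<rho> \<sigma> f B)"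
proof
  assume less: "growth_norm \<rho> \<sigma> f < ereal \<delta>"
  have "ereal 0 \<le> ereal (norm (f 0) * exp (- \<sigma> * norm (0 :: 'a paravec) powr \<rho> (norm (0 :: 'a paravec))))" by simp
  also have "\<dots> \<le> growth_norm \<rho> \<sigma> f" unfolding growth_norm_def by (rule SUP_upper) simp
  finally have "ereal 0 \<le> growth_norm \<rho> \<sigma> f" .
  then obtain B where "growth_norm \<rho> \<sigma> f = ereal B" using less by (cases "growth_norm \<rho> \<sigma> f") auto
  then show "\<exists>B<\<delta>. growth_bound \<rho> \<sigma> f B" using less growth_norm_le_iff[of \<rho> \<sigma> f B] by auto
next
  assume "\<exists>B<\<delta>. growth_bound \<rho> \<sigma> f B"
  then obtain B where "B < \<delta>" "growth_norm \<rho> \<sigma> f \<le> ereal B" unfolding growth_norm_le_iff by blast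
  then show "growth_norm \<rho> \<sigma> f < ereal \<delta>" by (metis le_less_trans less_ereal.simps(1))
qed

lemma growth_norm_finite_iff: "growth_norm \<rho> \<sigma> f < \<infinity> \<longleftrightarrow> (\<exists>B. growth_bound \<rho> \<sigma> f B)"
proof
  assume "growth_norm \<rho> \<sigma> f < \<infinity>"
  then obtain \<delta> where "growth_norm \<rho> \<sigma> f < ereal \<delta>" using less_PInf_Ex_of_nat by auto
  then show "\<exists>B. growth_bound \<rho> \<sigma> f B" unfolding growth_norm_less_iff by blast
next
  assume "\<exists>B. growth_bound \<rho> \<sigma> f B"
  then show "growth_norm \<rho> \<sigma> f < \<infinity>"
    unfolding growth_norm_le_iff[symmetric] by (auto intro: le_less_trans)
qed

lemma growth_min_iff: "f \<in> growth_min \<rho> \<longleftrightarrow> f \<in> monogenic \<and> (\<forall>\<sigma>>0. \<exists>B. growth_bound \<rho> \<sigma> f B)"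
proof -
  have "f \<in> growth_min \<rho> \<longleftrightarrow> (\<forall>\<sigma>>0. f \<in> monogenic \<and> (\<exists>B. growth_bound \<rho> \<sigma> f B))"
    unfolding growth_min_def growth_space_def growth_norm_finite_iff by auto
  then show ?thesis using zero_less_one by blast
qed

lemma growth_min_monogenic: "f \<in> growth_min \<rho> \<Longrightarrow> f \<in> monogenic"
  by (simp add: growth_min_iff)

lemma growth_bound_mono:
  assumes "growth_bound \<rho> \<sigma> f B" "\<sigma> \<le> \<sigma>'" "B \<le> B'" shows "growth_bound \<rho> \<sigma>' f B'"
proof (rule growth_boundI)
  fix x
  have "norm (f x) \<le> B * exp (\<sigma> * weight \<rho> (norm x))" by (rule growth_boundD[OF assms(1)])
  also have "\<dots> \<le> B' * exp (\<sigma>' * weight \<rho> (norm x))"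
    using growth_bound_nonneg[OF assms(1)] assms(2,3) by (intro mult_mono) (auto intro: mult_right_mono weight_nonneg)
  finally show "norm (f x) \<le> B' * exp (\<sigma>' * weight \<rho> (norm x))" .
qed

lemma growth_bound_add:
  assumes "growth_bound \<rho> \<sigma> f B" "growth_bound \<rho> \<sigma> g B'"
  shows "growth_bound \<rho> \<sigma> (\<lambda>x. f x + g x) (B + B')"
  using norm_triangle_mono[OF growth_boundD[OF assms(1)] growth_boundD[OF assms(2)]]
  by (intro growth_boundI) (simp add: algebra_simps)

lemma growth_bound_minus: "growth_bound \<rho> \<sigma> f B \<Longrightarrow> growth_bound \<rho> \<sigma> (\<lambda>x. - f x) B"
  by (simp add: growth_bound_def)

lemma growth_bound_diff:
  "growth_bound \<rho> \<sigma> f B \<Longrightarrow> growth_bound \<rho> \<sigma> g B' \<Longrightarrow> growth_bound \<rho> \<sigma> (\<lambda>x. f x - g x) (B + B')"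
  using growth_bound_add[OF _ growth_bound_minus] by fastforce

lemma growth_min_add: "f \<in> growth_min \<rho> \<Longrightarrow> g \<in> growth_min \<rho> \<Longrightarrow> (\<lambda>x. f x + g x) \<in> growth_min \<rho>"
  unfolding growth_min_iff using monogenic_add(1)[of f g] growth_bound_add[of \<rho> _ f _ g] by blast

lemma growth_min_diff: "f \<in> growth_min \<rho> \<Longrightarrow> g \<in> growth_min \<rho> \<Longrightarrow> (\<lambda>x. f x - g x) \<in> growth_min \<rho>"
  unfolding growth_min_iff using monogenic_diff(1)[of f g] growth_bound_diff[of \<rho> _ f _ g] by blast

lemma growth_min_mult_right:
  fixes f :: "'n::{finite,linorder} clfun"
  assumes "f \<in> growth_min \<rho>" shows "(\<lambda>x. f x \<star> a) \<in> growth_min \<rho>"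
proof -
  obtain K where K: "K \<ge> 1" "\<And>a b :: 'n clifford. norm (a \<star> b) \<le> K * norm a * norm b"
    using cl_mult_norm_bound by blast
  have "growth_bound \<rho> \<sigma> (\<lambda>x. f x \<star> a) (K * B * norm a)" if "growth_bound \<rho> \<sigma> f B" for \<sigma> B
  proof (rule growth_boundI)
    fix x
    have "K * norm (f x) * norm a \<le> K * (B * exp (\<sigma> * weight \<rho> (norm x))) * norm a"
      using K(1) growth_boundD[OF that] by (intro mult_right_mono mult_left_mono) auto
    then show "norm (f x \<star> a) \<le> K * B * norm a * exp (\<sigma> * weight \<rho> (norm x))"
      using K(2)[of "f x" a] by (simp add: mult_ac)
  qed
  then show ?thesis using assms monogenic_mult_right(1)[of f a] unfolding growth_min_iff by blast
qed

lemma growth_min_zero: "(\<lambda>x. 0) \<in> growth_min \<rho>"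
proof -
  have "growth_bound \<rho> \<sigma> (\<lambda>x. 0) 0" for \<sigma> by (simp add: growth_bound_def)
  then show ?thesis unfolding growth_min_iff using monogenic_const by blast
qed

lemma growth_min_sum:
  assumes "\<And>i. i \<in> I \<Longrightarrow> f i \<in> growth_min \<rho>" shows "(\<lambda>x. \<Sum>i\<in>I. f i x) \<in> growth_min \<rho>"
  using assms by (induction I rule: infinite_finite_induct) (auto intro: growth_min_zero growth_min_add)

text \<open>The norms increase as \<sigma> decreases, so the ball for the smaller \<sigma> and
  \<delta> lies in the intersection of two balls. Thus the given subbasis yields neighbourhood bases
  of single balls.\<close>

lemma openin_growth_min_topology_iff:
  "openin (growth_min_topology \<rho>) U \<longleftrightarrow> U \<subseteq> growth_min \<rho> \<and>
    (\<forall>f\<in>U. \<exists>\<sigma>>0. \<exists>\<delta>>0. \<forall>g\<in>growth_min \<rho>. growth_bound \<rho> \<sigma> (\<lambda>x. g x - f x) \<delta> \<longrightarrow> g \<in> U)"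
  (is "_ \<longleftrightarrow> ?R U")
proof
  let ?S = "{{g \<in> growth_min \<rho>. growth_norm \<rho> \<epsilon> (\<lambda>x. g x - f x) < ereal \<delta>} | f \<epsilon> \<delta>.
        f \<in> growth_min \<rho> \<and> \<epsilon> > 0 \<and> \<delta> > 0}"
  assume "openin (growth_min_topology \<rho>) U"
  then have "generate_topology_on ?S U"
    by (simp add: growth_min_topology_def openin_topology_generated_by_iff)
  then show "?R U"
  proof (induction rule: generate_topology_on.induct)
    case Empty
    then show ?case by simp
  next
    case (Int a b)
    show ?case
    proof (intro conjI ballI)
      show "a \<inter> b \<subseteq> growth_min \<rho>" using Int by blast
      fix f assume f: "f \<in> a \<inter> b"
      obtain s1 d1 where 1: "s1 > 0" "d1 > 0" "\<forall>g\<in>growth_min \<rho>. growth_bound \<rho> s1 (\<lambda>x. g x - f x) d1 \<longrightarrow> g \<in> a"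
        using Int f by blast
      obtain s2 d2 where 2: "s2 > 0" "d2 > 0" "\<forall>g\<in>growth_min \<rho>. growth_bound \<rho> s2 (\<lambda>x. g x - f x) d2 \<longrightarrow> g \<in> b"
        using Int f by blast
      have "g \<in> a \<inter> b" if "g \<in> growth_min \<rho>" "growth_bound \<rho> (min s1 s2) (\<lambda>x. g x - f x) (min d1 d2)" for g
        using 1(3) 2(3) that growth_bound_mono[OF that(2), of s1 d1] growth_bound_mono[OF that(2), of s2 d2] by auto
      then show "\<exists>\<sigma>>0. \<exists>\<delta>>0. \<forall>g\<in>growth_min \<rho>. growth_bound \<rho> \<sigma> (\<lambda>x. g x - f x) \<delta> \<longrightarrow> g \<in> a \<inter> b"
        using 1 2 by (intro exI[of _ "min s1 s2"] exI[of _ "min d1 d2"] conjI) auto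
    qed
  next
    case (UN K)
    show ?case
    proof (intro conjI ballI)
      show "\<Union> K \<subseteq> growth_min \<rho>" using UN by blast
      fix f assume "f \<in> \<Union> K"
      then obtain k where k: "k \<in> K" "f \<in> k" by blast
      then obtain \<sigma> \<delta> where "\<sigma> > 0" "\<delta> > 0" "\<forall>g\<in>growth_min \<rho>. growth_bound \<rho> \<sigma> (\<lambda>x. g x - f x) \<delta> \<longrightarrow> g \<in> k"
        using UN by blast
      then show "\<exists>\<sigma>>0. \<exists>\<delta>>0. \<forall>g\<in>growth_min \<rho>. growth_bound \<rho> \<sigma> (\<lambda>x. g x - f x) \<delta> \<longrightarrow> g \<in> \<Union> K"
        using k(1) by blast
    qed
  next
    case (Basis s)
    then obtain h \<epsilon> \<delta> where s: "s = {g \<in> growth_min \<rho>. growth_norm \<rho> \<epsilon> (\<lambda>x. g x - h x) < ereal \<delta>}"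
      and h: "\<epsilon> > 0" "\<delta> > 0" by blast
    show ?case
    proof (intro conjI ballI)
      show "s \<subseteq> growth_min \<rho>" by (auto simp: s)
      fix f assume "f \<in> s"
      then obtain B where B: "B < \<delta>" "growth_bound \<rho> \<epsilon> (\<lambda>x. f x - h x) B"
        by (auto simp: s growth_norm_less_iff)
      have "g \<in> s" if g: "g \<in> growth_min \<rho>" "growth_bound \<rho> \<epsilon> (\<lambda>x. g x - f x) ((\<delta> - B) / 2)" for g
      proof -
        have "growth_bound \<rho> \<epsilon> (\<lambda>x. g x - h x) ((\<delta> - B) / 2 + B)"
          using growth_bound_add[OF g(2) B(2)] by simp
        moreover have "(\<delta> - B) / 2 + B < \<delta>" using B(1) by (simp add: field_simps)
        ultimately show ?thesis using g(1) unfolding s growth_norm_less_iff by blast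
      qed
      moreover have "(\<delta> - B) / 2 > 0" using B(1) by simp
      ultimately show "\<exists>\<sigma>>0. \<exists>\<delta>>0. \<forall>g\<in>growth_min \<rho>. growth_bound \<rho> \<sigma> (\<lambda>x. g x - f x) \<delta> \<longrightarrow> g \<in> s"
        using h(1) by blast
    qed
  qed
next
  assume R: "?R U"
  show "openin (growth_min_topology \<rho>) U"
  proof (subst openin_subopen, intro ballI)
    fix f assume f: "f \<in> U"
    then obtain \<sigma> \<delta> where *: "\<sigma> > 0" "\<delta> > 0" "\<forall>g\<in>growth_min \<rho>. growth_bound \<rho> \<sigma> (\<lambda>x. g x - f x) \<delta> \<longrightarrow> g \<in> U"
      using R by blast
    let ?B = "{g \<in> growth_min \<rho>. growth_norm \<rho> \<sigma> (\<lambda>x. g x - f x) < ereal \<delta>}"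
    have fm: "f \<in> growth_min \<rho>" using R f by blast
    have "openin (growth_min_topology \<rho>) ?B"
      unfolding growth_min_topology_def
      by (rule topology_generated_by_Basis) (use fm * in blast)
    moreover have "f \<in> ?B"
      using fm *(2) by (auto simp: growth_norm_less_iff growth_bound_def intro!: exI[of _ 0])
    moreover have "?B \<subseteq> U"
    proof
      fix g assume "g \<in> ?B"
      then obtain B where "B < \<delta>" "growth_bound \<rho> \<sigma> (\<lambda>x. g x - f x) B" "g \<in> growth_min \<rho>"
        by (auto simp: growth_norm_less_iff)
      then show "g \<in> U" using *(3) growth_bound_mono[of \<rho> \<sigma> _ B \<sigma> \<delta>] by auto
    qed
    ultimately show "\<exists>T. openin (growth_min_topology \<rho>) T \<and> f \<in> T \<and> T \<subseteq> U" by blast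
  qed
qed

lemma continuous_map_growth_minI:
  fixes F :: "'n::{finite,linorder} clfun \<Rightarrow> 'n clfun"
  assumes maps: "\<And>f. f \<in> growth_min \<rho>1 \<Longrightarrow> F f \<in> growth_min \<rho>2"
    and est: "\<And>\<sigma>. \<sigma> > 0 \<Longrightarrow> \<exists>\<sigma>'>0. \<exists>K>0. \<forall>f\<in>growth_min \<rho>1. \<forall>g\<in>growth_min \<rho>1. \<forall>B.
      growth_bound \<rho>1 \<sigma>' (\<lambda>x. g x - f x) B \<longrightarrow> growth_bound \<rho>2 \<sigma> (\<lambda>x. F g x - F f x) (K * B)"
  shows "continuous_map (growth_min_topology \<rho>1) (growth_min_topology \<rho>2) F"
  unfolding continuous_map_def topspace_growth_min_topology
proof (intro conjI allI impI)
  show "F \<in> growth_min \<rho>1 \<rightarrow> growth_min \<rho>2" using maps by blast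
  fix U :: "'n clfun set" assume U: "openin (growth_min_topology \<rho>2) U"
  show "openin (growth_min_topology \<rho>1) {f \<in> growth_min \<rho>1. F f \<in> U}"
    unfolding openin_growth_min_topology_iff[where \<rho> = \<rho>1]
  proof (intro conjI ballI)
    fix f assume "f \<in> {f \<in> growth_min \<rho>1. F f \<in> U}"
    then have f: "f \<in> growth_min \<rho>1" "F f \<in> U" by auto
    then obtain \<sigma> \<delta> where *: "\<sigma> > 0" "\<delta> > 0" "\<forall>g\<in>growth_min \<rho>2. growth_bound \<rho>2 \<sigma> (\<lambda>x. g x - F f x) \<delta> \<longrightarrow> g \<in> U"
      using U unfolding openin_growth_min_topology_iff by blast
    obtain \<sigma>' K where E: "\<sigma>' > 0" "K > 0" "\<forall>f\<in>growth_min \<rho>1. \<forall>g\<in>growth_min \<rho>1. \<forall>B.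
      growth_bound \<rho>1 \<sigma>' (\<lambda>x. g x - f x) B \<longrightarrow> growth_bound \<rho>2 \<sigma> (\<lambda>x. F g x - F f x) (K * B)"
      using est[OF *(1)] by blast
    have "F g \<in> U" if g: "g \<in> growth_min \<rho>1" "growth_bound \<rho>1 \<sigma>' (\<lambda>x. g x - f x) (\<delta> / K)" for g
    proof -
      have "growth_bound \<rho>2 \<sigma> (\<lambda>x. F g x - F f x) (K * (\<delta> / K))" using E(3) f(1) g by blast
      then have "growth_bound \<rho>2 \<sigma> (\<lambda>x. F g x - F f x) \<delta>" using E(2) by simp
      then show ?thesis using *(3) maps[OF g(1)] by blast
    qed
    moreover have "\<delta> / K > 0" using * E by simp
    ultimately show "\<exists>\<sigma>>0. \<exists>\<delta>>0. \<forall>g\<in>growth_min \<rho>1. growth_bound \<rho>1 \<sigma> (\<lambda>x. g x - f x) \<delta> \<longrightarrow> g \<in> {f \<in> growth_min \<rho>1. F f \<in> U}"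
      using E(1) by blast
  qed auto
qed

lemma limitin_growth_minI:
  assumes l: "l \<in> growth_min \<rho>" and h: "\<And>M. h M \<in> growth_min \<rho>"
    and lim: "\<And>\<sigma> \<delta>. \<sigma> > 0 \<Longrightarrow> \<delta> > 0 \<Longrightarrow> \<forall>\<^sub>F M in F. growth_bound \<rho> \<sigma> (\<lambda>x. h M x - l x) \<delta>"
  shows "limitin (growth_min_topology \<rho>) h l F"
  unfolding limitin_def topspace_growth_min_topology
proof (intro conjI allI impI l)
  fix U assume "openin (growth_min_topology \<rho>) U \<and> l \<in> U"
  then obtain \<sigma> \<delta> where "\<sigma> > 0" "\<delta> > 0" "\<forall>g\<in>growth_min \<rho>. growth_bound \<rho> \<sigma> (\<lambda>x. g x - l x) \<delta> \<longrightarrow> g \<in> U"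
    unfolding openin_growth_min_topology_iff by blast
  then show "\<forall>\<^sub>F M in F. h M \<in> U" using lim[of \<sigma> \<delta>] h by (auto elim: eventually_mono)
qed

section \<open>Right linear maps and their seminorm bounds\<close>

lemma right_linear_zero:
  assumes "right_linear_on S F" "f \<in> S" shows "F (\<lambda>x. 0) = (\<lambda>x. 0)"
proof -
  have "F (\<lambda>x. f x \<star> 0) = (\<lambda>x. F f x \<star> 0)" using assms unfolding right_linear_on_def by blast
  then show ?thesis by (simp add: cl_mult.zero_right)
qed

text \<open>Continuity at 0 gives one ball mapped into a unit ball; rescaling turns this into a
  linear bound. A bound \<open>B = 0\<close> cannot be rescaled and forces f = 0.\<close>

lemma continuous_hom_estimate:
  fixes F :: "'n::{finite,linorder} clfun \<Rightarrow> 'n clfun"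
  assumes F: "continuous_hom \<rho>1 \<rho>2 F" and \<sigma>: "\<sigma> > 0"
  shows "\<exists>\<sigma>'>0. \<exists>K>0. \<forall>f\<in>growth_min \<rho>1. \<forall>B. growth_bound \<rho>1 \<sigma>' f B \<longrightarrow> growth_bound \<rho>2 \<sigma> (F f) (K * B)"
proof -
  have lin: "right_linear_on (growth_min \<rho>1) F"
    and cont: "continuous_map (growth_min_topology \<rho>1) (growth_min_topology \<rho>2) F"
    using F by (auto simp: continuous_hom_def)
  have F0: "F (\<lambda>x. 0) = (\<lambda>x. 0)" by (rule right_linear_zero[OF lin growth_min_zero])
  let ?U = "{g \<in> growth_min \<rho>2. growth_norm \<rho>2 \<sigma> (\<lambda>x. g x - 0) < ereal 1}"
  have "openin (growth_min_topology \<rho>2) ?U"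
    unfolding growth_min_topology_def
    using growth_min_zero \<sigma>
    by (intro topology_generated_by_Basis CollectI exI[of _ "\<lambda>x. 0"] exI[of _ \<sigma>] exI[of _ 1]) simp
  then have "openin (growth_min_topology \<rho>1) {f \<in> growth_min \<rho>1. F f \<in> ?U}"
    using cont unfolding continuous_map_def topspace_growth_min_topology by blast
  moreover have "(\<lambda>x. 0) \<in> {f \<in> growth_min \<rho>1. F f \<in> ?U}"
    by (auto simp: F0 growth_min_zero growth_norm_less_iff growth_bound_def intro!: exI[of _ 0])
  ultimately obtain \<sigma>' \<delta> where *: "\<sigma>' > 0" "\<delta> > 0"
    "\<forall>g\<in>growth_min \<rho>1. growth_bound \<rho>1 \<sigma>' (\<lambda>x. g x - 0) \<delta> \<longrightarrow> g \<in> {f \<in> growth_min \<rho>1. F f \<in> ?U}"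
    unfolding openin_growth_min_topology_iff by meson
  have pos: "growth_bound \<rho>2 \<sigma> (F f) (1 / \<delta> * B)" if f: "f \<in> growth_min \<rho>1" "growth_bound \<rho>1 \<sigma>' f B" "B > 0" for f B
  proof -
    let ?c = "\<delta> / B"
    let ?g = "\<lambda>x. f x \<star> (?c *\<^sub>R cl_one)"
    have "growth_bound \<rho>1 \<sigma>' ?g \<delta>"
    proof (rule growth_boundI)
      fix x
      have "?c * norm (f x) \<le> ?c * (B * exp (\<sigma>' * weight \<rho>1 (norm x)))"
        using *(2) f(3) by (intro mult_left_mono growth_boundD[OF f(2)]) auto
      then show "norm (?g x) \<le> \<delta> * exp (\<sigma>' * weight \<rho>1 (norm x))"
        using *(2) f(3) by (simp add: cl_mult_scaleR_one)
    qed
    then have "F ?g \<in> ?U" using *(3) growth_min_mult_right[OF f(1)] by auto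
    then obtain B' where B': "B' < 1" "growth_bound \<rho>2 \<sigma> (F ?g) B'" by (auto simp: growth_norm_less_iff)
    have "F ?g = (\<lambda>x. F f x \<star> (?c *\<^sub>R cl_one))" using lin f(1) unfolding right_linear_on_def by blast
    then have Fg: "F ?g = (\<lambda>x. ?c *\<^sub>R F f x)" by (simp add: cl_mult_scaleR_one)
    have 1: "growth_bound \<rho>2 \<sigma> (F ?g) 1" using growth_bound_mono[OF B'(2), of \<sigma> 1] B'(1) by simp
    show ?thesis
    proof (rule growth_boundI)
      fix x
      show "norm (F f x) \<le> 1 / \<delta> * B * exp (\<sigma> * weight \<rho>2 (norm x))"
        using growth_boundD[OF 1, of x] *(2) f(3) unfolding Fg by (simp add: field_simps)
    qed
  qed
  have "growth_bound \<rho>2 \<sigma> (F f) (1 / \<delta> * B)" if f: "f \<in> growth_min \<rho>1" "growth_bound \<rho>1 \<sigma>' f B" for f B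
  proof (cases "B > 0")
    case False
    then have "B = 0" using growth_bound_nonneg[OF f(2)] by simp
    then have "f = (\<lambda>x. 0)" using f(2) by (auto simp: growth_bound_def fun_eq_iff)
    then show ?thesis using \<open>B = 0\<close> by (simp add: F0 growth_bound_def)
  qed (rule pos[OF f])
  then have "\<forall>f\<in>growth_min \<rho>1. \<forall>B. growth_bound \<rho>1 \<sigma>' f B \<longrightarrow> growth_bound \<rho>2 \<sigma> (F f) (1 / \<delta> * B)" by blast
  moreover have "1 / \<delta> > 0" using *(2) by simp
  ultimately show ?thesis using *(1) by blast
qed

subsection \<open>Taylor coefficients and growth\<close>

text \<open>The Cauchy estimate at a radius proportional to r makes the terms geometric in m. The
  weight there is at most D times the weight at r plus a constant, hence the smaller type \<sigma>/D
  asked of \<open>f\<close>.\<close>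

lemma majorant_growth:
  assumes po: "proximate_order \<rho> \<rho>0" and pos: "\<rho>0 > 0" and \<sigma>: "\<sigma> > 0" and b: "b \<ge> 0"
  shows "\<exists>\<sigma>'>0. \<exists>K>0. \<forall>(f :: 'n::{finite,linorder} clfun)\<in>monogenic. \<forall>B. growth_bound \<rho> \<sigma>' f B \<longrightarrow>
    (\<forall>r\<ge>0. \<forall>m. (b * r) ^ msize m * norm (taylor_coeff f m) \<le> K * B * exp (\<sigma> * weight \<rho> r) * geo m)"
proof -
  obtain C0 where C0: "C0 \<ge> 1" "\<And>(f :: 'n clfun) R M m. f \<in> monogenic \<Longrightarrow> R > 0 \<Longrightarrow>
      (\<And>x. norm x \<le> R \<Longrightarrow> norm (f x) \<le> M) \<Longrightarrow> norm (taylor_coeff f m) \<le> (C0 / R) ^ msize m * M"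
    using taylor_coeff_bound by blast
  define b' where "b' = C0 * b * (2 * real CARD('n))"
  have b': "b' \<ge> 0" using C0(1) b by (simp add: b'_def)
  obtain D C where D: "D \<ge> 1" "C \<ge> 0"
    "\<And>r s. 0 \<le> r \<Longrightarrow> 0 \<le> s \<Longrightarrow> s \<le> (b' + 1) * (r + 1) \<Longrightarrow> weight \<rho> s \<le> D * weight \<rho> r + C"
    using weight_dominated[OF po pos, of "b' + 1"] by blast
  define \<sigma>' where "\<sigma>' = \<sigma> / D"
  have \<sigma>': "\<sigma>' > 0" "\<sigma>' * D = \<sigma>" using \<sigma> D(1) by (auto simp: \<sigma>'_def)
  have "(b * r) ^ msize m * norm (taylor_coeff f m) \<le> exp (\<sigma>' * C) * B * exp (\<sigma> * weight \<rho> r) * geo m"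
    if f: "f \<in> monogenic" "growth_bound \<rho> \<sigma>' f B" and r: "r \<ge> 0" for f :: "'n clfun" and B r m
  proof -
    have B: "B \<ge> 0" by (rule growth_bound_nonneg[OF f(2)])
    define R where "R = b' * r + 1"
    have R: "R > 0" using b' r by (simp add: R_def add_nonneg_pos)
    let ?M = "exp (\<sigma>' * C) * B * exp (\<sigma> * weight \<rho> r)"
    have "norm (taylor_coeff f m) \<le> (C0 / R) ^ msize m * ?M"
    proof (rule C0(2)[OF f(1) R])
      fix x :: "'n paravec" assume x: "norm x \<le> R"
      have "norm x \<le> (b' + 1) * (r + 1)" using x b' r by (simp add: R_def algebra_simps)
      then have "\<sigma>' * weight \<rho> (norm x) \<le> \<sigma>' * (D * weight \<rho> r + C)"
        using D(3)[of r "norm x"] r \<sigma>' by (intro mult_left_mono) auto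
      also have "\<dots> = \<sigma> * weight \<rho> r + \<sigma>' * C" using \<sigma>'(2) by (simp add: algebra_simps)
      finally have "exp (\<sigma>' * weight \<rho> (norm x)) \<le> exp (\<sigma> * weight \<rho> r) * exp (\<sigma>' * C)"
        by (simp flip: exp_add)
      then have "B * exp (\<sigma>' * weight \<rho> (norm x)) \<le> B * (exp (\<sigma> * weight \<rho> r) * exp (\<sigma>' * C))"
        using B by (rule mult_left_mono)
      then show "norm (f x) \<le> ?M" using growth_boundD[OF f(2), of x] by (simp add: mult_ac)
    qed
    then have "(b * r) ^ msize m * norm (taylor_coeff f m) \<le> (b * r) ^ msize m * ((C0 / R) ^ msize m * ?M)"
      using b r by (intro mult_left_mono) auto
    also have "\<dots> = (b * r * C0 / R) ^ msize m * ?M" by (simp add: power_mult_distrib power_divide)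
    also have "\<dots> \<le> geo m * ?M"
      using C0(1) b r R B by (intro mult_right_mono power_le_geo) (auto simp: R_def b'_def field_simps)
    finally show ?thesis by (simp add: mult.commute)
  qed
  then show ?thesis using \<sigma>'(1) by (intro exI[of _ \<sigma>'] exI[of _ "exp (\<sigma>' * C)"] conjI ballI allI impI) auto
qed

lemma fact_add_le: "fact (a + b) \<le> 2 ^ (a + b) * fact a * (fact b :: real)"
proof -
  have "real ((a + b) choose a) \<le> real (2 ^ (a + b))" by (intro of_nat_mono binomial_le_pow2)
  moreover have "fact (a + b) = fact a * fact b * real ((a + b) choose a)"
    using binomial_fact_lemma[of a "a + b"] by (metis add_diff_cancel_left' le_add1 of_nat_fact of_nat_mult)
  ultimately show ?thesis by (simp add: mult_ac mult_left_mono)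
qed

lemma mfact_madd_le: "mfact (madd m l) \<le> 2 ^ (msize m + msize l) * mfact m * mfact l"
proof -
  have "mfact (madd m l) \<le> (\<Prod>i\<in>UNIV. 2 ^ (m i + l i) * fact (m i) * fact (l i))"
    unfolding mfact_def madd_def by (intro prod_mono conjI fact_add_le) auto
  also have "\<dots> = 2 ^ (msize m + msize l) * mfact m * mfact l"
    by (simp add: prod.distrib mfact_def msize_def power_sum power_add)
  finally show ?thesis .
qed

lemma taylor_coeff_mpd:
  "f \<in> monogenic \<Longrightarrow> taylor_coeff (mpd m f) l = (mfact (madd m l) / mfact l) *\<^sub>R taylor_coeff f (madd m l)"
  using mfact_pos[of "madd m l"] by (simp add: taylor_coeff_def mpd_mpd)

text \<open>The central estimate: a derivative of order m is small like \<epsilon>^|m| m!/G, and its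
  own Taylor series is still geometric at every r. Both come from one Cauchy estimate for the
  coefficient at m + l.\<close>

lemma majorant_mpd_growth:
  assumes po: "proximate_order \<rho> \<rho>0" and norm: "normalization \<rho>' \<rho> \<rho>0" and pos: "\<rho>0 > 0"
    and \<epsilon>: "\<epsilon> > 0" and \<tau>: "\<tau> > 0" and b: "b \<ge> 0"
  shows "\<exists>\<sigma>>0. \<exists>K>0. \<forall>(f :: 'n::{finite,linorder} clfun)\<in>monogenic. \<forall>B. growth_bound \<rho> \<sigma> f B \<longrightarrow>
    (\<forall>r\<ge>0. \<forall>m l. (b * r) ^ msize l * norm (taylor_coeff (mpd m f) l) \<le>
      K * B * (mfact m * \<epsilon> ^ msize m / G_seq \<rho>' \<rho>0 (msize m)) * exp (\<tau> * weight \<rho> r) * geo l)"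
proof -
  obtain C0 where C0: "C0 \<ge> 1" "\<And>(f :: 'n clfun) R M m. f \<in> monogenic \<Longrightarrow> R > 0 \<Longrightarrow>
      (\<And>x. norm x \<le> R \<Longrightarrow> norm (f x) \<le> M) \<Longrightarrow> norm (taylor_coeff f m) \<le> (C0 / R) ^ msize m * M"
    using taylor_coeff_bound by blast
  define b' where "b' = 2 * C0 * b * (2 * real CARD('n))"
  have b': "b' \<ge> 0" using C0(1) b by (simp add: b'_def)
  define \<beta> where "\<beta> = 2 * b' + 2"
  obtain D C where D: "D \<ge> 1" "C \<ge> 0"
    "\<And>r s. 0 \<le> r \<Longrightarrow> 0 \<le> s \<Longrightarrow> s \<le> \<beta> * (r + 1) \<Longrightarrow> weight \<rho> s \<le> D * weight \<rho> r + C"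
    using weight_dominated[OF po pos, of \<beta>] by blast
  \<comment> \<open>Dividing \<epsilon> by 2 C0 anticipates the loss per order of differentiation:
    \<open>C0\<close> from the Cauchy estimate and 2 from splitting (m + l)!.\<close>
  obtain \<sigma>1 C1 where 1: "\<sigma>1 > 0" "C1 > 0"
    "\<And>q. \<exists>R>0. exp (\<sigma>1 * weight \<rho> R) / R ^ q \<le> C1 * (\<epsilon> / (2 * C0)) ^ q / G_seq \<rho>' \<rho>0 q"
    using G_seq_lower[OF po norm pos, of "\<epsilon> / (2 * C0)"] \<epsilon> C0(1) by auto
  define \<sigma> where "\<sigma> = min \<sigma>1 \<tau> / D"
  have \<sigma>: "\<sigma> > 0" "\<sigma> * D \<le> \<sigma>1" "\<sigma> * D \<le> \<tau>" using 1(1) \<tau> D(1) by (auto simp: \<sigma>_def)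
  have "(b * r) ^ msize l * norm (taylor_coeff (mpd m f) l) \<le>
      (exp (\<sigma> * C) * C1) * B * (mfact m * \<epsilon> ^ msize m / G_seq \<rho>' \<rho>0 (msize m)) * exp (\<tau> * weight \<rho> r) * geo l"
    if f: "f \<in> monogenic" "growth_bound \<rho> \<sigma> f B" and r: "r \<ge> 0" for f :: "'n clfun" and B r m l
  proof -
    have B: "B \<ge> 0" by (rule growth_bound_nonneg[OF f(2)])
    let ?q = "msize m" and ?p = "msize l"
    obtain S where S: "S > 0" "exp (\<sigma>1 * weight \<rho> S) / S ^ ?q \<le> C1 * (\<epsilon> / (2 * C0)) ^ ?q / G_seq \<rho>' \<rho>0 ?q"
      using 1(3) by blast
    define T where "T = b' * r + 1"
    have T: "T > 0" using b' r by (simp add: T_def add_nonneg_pos)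
    \<comment> \<open>\<open>T\<close>, proportional to r, is for the sum over l; \<open>S\<close>,
      supplied by \<open>G_seq_lower\<close>, is for the decay in m.\<close>
    define R where "R = T + S"
    have R: "R > 0" using T S(1) by (simp add: R_def)
    let ?M = "B * exp (\<sigma> * C) * exp (\<tau> * weight \<rho> r) * exp (\<sigma>1 * weight \<rho> S)"
    have M0: "?M \<ge> 0" using B by simp
    have tc: "norm (taylor_coeff f (madd m l)) \<le> (C0 / R) ^ msize (madd m l) * ?M"
    proof (rule C0(2)[OF f(1) R])
      fix x :: "'n paravec" assume x: "norm x \<le> R"
      \<comment> \<open>The point lies within twice the larger of \<open>T\<close> and
        \<open>S\<close>, so the weight is controlled through r or through \<open>S\<close>, and the
        other term is nonnegative.\<close>
      have "weight \<rho> (norm x) \<le> D * weight \<rho> r + D * weight \<rho> S + C"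
      proof (cases "S \<le> T")
        case True
        then have "norm x \<le> \<beta> * (r + 1)" using x b' r by (simp add: R_def T_def \<beta>_def algebra_simps)
        moreover have "0 \<le> D * weight \<rho> S" using D(1) by (simp add: weight_nonneg)
        ultimately show ?thesis using D(3)[of r "norm x"] r by simp
      next
        case False
        have "0 \<le> b' * S" using b' S(1) by simp
        moreover have "norm x \<le> 2 * S" using x False by (simp add: R_def)
        moreover have "\<beta> * (S + 1) = 2 * (b' * S) + 2 * S + 2 * b' + 2" by (simp add: \<beta>_def algebra_simps)
        ultimately have "norm x \<le> \<beta> * (S + 1)" using b' by linarith
        moreover have "0 \<le> D * weight \<rho> r" using D(1) by (simp add: weight_nonneg)
        ultimately show ?thesis using D(3)[of S "norm x"] S(1) by simp
      qed
      then have "\<sigma> * weight \<rho> (norm x) \<le> \<sigma> * (D * weight \<rho> r + D * weight \<rho> S + C)"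
        using \<sigma>(1) by (intro mult_left_mono) auto
      also have "\<dots> = (\<sigma> * D) * weight \<rho> r + (\<sigma> * D) * weight \<rho> S + \<sigma> * C" by (simp add: algebra_simps)
      also have "\<dots> \<le> \<tau> * weight \<rho> r + \<sigma>1 * weight \<rho> S + \<sigma> * C"
        using \<sigma>(2,3) by (intro add_mono mult_right_mono weight_nonneg order_refl) auto
      finally have "exp (\<sigma> * weight \<rho> (norm x)) \<le> exp (\<sigma> * C) * exp (\<tau> * weight \<rho> r) * exp (\<sigma>1 * weight \<rho> S)"
        by (simp add: add_ac flip: exp_add)
      then have "B * exp (\<sigma> * weight \<rho> (norm x)) \<le> B * (exp (\<sigma> * C) * exp (\<tau> * weight \<rho> r) * exp (\<sigma>1 * weight \<rho> S))"
        using B by (rule mult_left_mono)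
      then show "norm (f x) \<le> ?M" using growth_boundD[OF f(2), of x] by (simp add: mult_ac)
    qed
    have "norm (taylor_coeff (mpd m f) l) = mfact (madd m l) / mfact l * norm (taylor_coeff f (madd m l))"
      using mfact_pos[of "madd m l"] mfact_pos[of l] by (simp add: taylor_coeff_mpd[OF f(1)])
    also have "\<dots> \<le> (2 ^ (?q + ?p) * mfact m * mfact l) / mfact l * ((C0 / R) ^ msize (madd m l) * ?M)"
      using mfact_pos[of l] mfact_pos[of m]
      by (intro mult_mono divide_right_mono mfact_madd_le tc) (auto simp: less_imp_le)
    also have "\<dots> = mfact m * (2 * C0 / R) ^ ?q * (2 * C0 / R) ^ ?p * ?M"
      using mfact_pos[of l] by (simp add: msize_madd power_add power_mult_distrib power_divide)
    \<comment> \<open>Of the |m| + |l| powers of R in the denominator, |m| are weakened to S and |l|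
      to T.\<close>
    also have "\<dots> \<le> mfact m * (2 * C0 / S) ^ ?q * (2 * C0 / T) ^ ?p * ?M"
      using mfact_pos[of m] C0(1) T S(1) B
      by (intro mult_right_mono mult_mono mult_left_mono power_mono divide_left_mono) (auto simp: R_def)
    finally have "(b * r) ^ ?p * norm (taylor_coeff (mpd m f) l) \<le>
        (b * r) ^ ?p * (mfact m * (2 * C0 / S) ^ ?q * (2 * C0 / T) ^ ?p * ?M)"
      using b r by (intro mult_left_mono) auto
    also have "\<dots> = mfact m * (2 * C0) ^ ?q * (B * exp (\<sigma> * C) * exp (\<tau> * weight \<rho> r)) *
        (exp (\<sigma>1 * weight \<rho> S) / S ^ ?q) * (b * r * (2 * C0) / T) ^ ?p"
      by (simp add: power_mult_distrib power_divide)
    also have "\<dots> \<le> mfact m * (2 * C0) ^ ?q * (B * exp (\<sigma> * C) * exp (\<tau> * weight \<rho> r)) *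
        (C1 * (\<epsilon> / (2 * C0)) ^ ?q / G_seq \<rho>' \<rho>0 ?q) * geo l"
    proof (intro mult_mono S(2) power_le_geo order_refl)
      show "b * r * (2 * C0) / T * (2 * real CARD('n)) \<le> 1"
        using T by (simp add: b'_def T_def field_simps)
      show "0 \<le> mfact m * (2 * C0) ^ ?q * (B * exp (\<sigma> * C) * exp (\<tau> * weight \<rho> r))"
        using mfact_pos[of m] C0(1) B by simp
      then show "0 \<le> mfact m * (2 * C0) ^ ?q * (B * exp (\<sigma> * C) * exp (\<tau> * weight \<rho> r)) *
        (C1 * (\<epsilon> / (2 * C0)) ^ ?q / G_seq \<rho>' \<rho>0 ?q)"
        using 1(2) \<epsilon> C0(1) G_seq_pos[OF norm pos, of ?q] by simp
    qed (use b r C0(1) T S(1) B mfact_pos[of m] in auto)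
    also have "\<dots> = (exp (\<sigma> * C) * C1) * B * (mfact m * \<epsilon> ^ ?q / G_seq \<rho>' \<rho>0 ?q) * exp (\<tau> * weight \<rho> r) * geo l"
      using C0(1) by (simp add: power_divide)
    finally show ?thesis .
  qed
  then show ?thesis using \<sigma>(1) 1(2)
    by (intro exI[of _ \<sigma>] exI[of _ "exp (\<sigma> * C) * C1"] conjI ballI allI impI) auto
qed

subsection \<open>Differential operators\<close>

lemma ck_prod_has_sum:
  fixes f g :: "'n::{finite,linorder} clfun"
  assumes f: "f \<in> monogenic" and g: "g \<in> monogenic"
  shows "((\<lambda>(m, k). fueter (madd m k) x \<star> taylor_coeff f m \<star> taylor_coeff g k) has_sum (f \<odot>\<^sub>L g) x) UNIV"
proof (rule ck_prod_properties[where 'n = 'n], goal_cases)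
  case (1 A K)
  show ?case by (rule 1(3)[OF f g])
qed

lemma ck_prod_monogenic:
  fixes f g :: "'n::{finite,linorder} clfun"
  assumes f: "f \<in> monogenic" and g: "g \<in> monogenic"
  shows "f \<odot>\<^sub>L g \<in> monogenic"
proof (rule ck_prod_properties[where 'n = 'n], goal_cases)
  case (1 A K)
  show ?case by (rule 1(5)[OF f g])
qed

lemma ck_prod_norm:
  "\<exists>A\<ge>1. \<exists>K\<ge>1. \<forall>f\<in>monogenic. \<forall>g\<in>monogenic. \<forall>x :: 'n::{finite,linorder} paravec.
    norm ((f \<odot>\<^sub>L g) x) \<le> K * majorant f (A * norm x) * majorant g (A * norm x)"
proof (rule ck_prod_properties[where 'n = 'n], goal_cases)
  case (1 A K)
  show ?case using 1(1,2) by (intro exI[of _ A] exI[of _ K] conjI ballI allI 1(4))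
qed

lemma ck_prod_linear:
  fixes f g h :: "'n::{finite,linorder} clfun"
  assumes f: "f \<in> monogenic" and g: "g \<in> monogenic" and h: "h \<in> monogenic"
  shows "(f \<odot>\<^sub>L (\<lambda>x. g x + h x)) x = (f \<odot>\<^sub>L g) x + (f \<odot>\<^sub>L h) x"
    and "(f \<odot>\<^sub>L (\<lambda>x. g x \<star> a)) x = (f \<odot>\<^sub>L g) x \<star> a"
proof -
  let ?t = "\<lambda>g. \<lambda>(m, k). fueter (madd m k) x \<star> taylor_coeff f m \<star> taylor_coeff g k"
  note sum = ck_prod_has_sum[OF f, of _ x]
  have "(?t (\<lambda>x. g x + h x) has_sum (f \<odot>\<^sub>L g) x + (f \<odot>\<^sub>L h) x) UNIV"
    using has_sum_add[OF sum[OF g] sum[OF h]]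
    by (simp add: taylor_coeff_linear(1)[OF g h] cl_mult.add_right split_def)
  then show "(f \<odot>\<^sub>L (\<lambda>x. g x + h x)) x = (f \<odot>\<^sub>L g) x + (f \<odot>\<^sub>L h) x"
    by (rule has_sum_unique[OF sum[OF monogenic_add(1)[OF g h]]])
  have "(?t (\<lambda>x. g x \<star> a) has_sum (f \<odot>\<^sub>L g) x \<star> a) UNIV"
    using has_sum_bounded_linear[OF cl_mult.bounded_linear_left sum[OF g], of a]
    by (simp add: taylor_coeff_linear(2)[OF g g] cl_mult_assoc split_def)
  then show "(f \<odot>\<^sub>L (\<lambda>x. g x \<star> a)) x = (f \<odot>\<^sub>L g) x \<star> a"
    by (rule has_sum_unique[OF sum[OF monogenic_mult_right(1)[OF g]]])
qed

lemma op_term_linear: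
  assumes "u m \<in> monogenic" "f \<in> monogenic" "g \<in> monogenic"
  shows "op_term u (\<lambda>x. f x + g x) m x = op_term u f m x + op_term u g m x"
    and "op_term u (\<lambda>x. f x \<star> a) m x = op_term u f m x \<star> a"
  using ck_prod_linear[OF assms(1) monogenic_mpd[OF assms(2)] monogenic_mpd[OF assms(3)]]
  by (simp_all add: op_term_def mpd_linear(1,2)[OF assms(2,3)])

lemma growth_union_monogenic: "f \<in> growth_union \<rho> \<Longrightarrow> f \<in> monogenic"
  by (auto simp: growth_union_def growth_space_def)

lemma geo_tail_eventually_less:
  assumes "e > 0"
  shows "\<forall>\<^sub>F S :: 'n::{finite,linorder} multi set in finite_subsets_at_top UNIV. finite S \<and>
    infsum geo (UNIV :: 'n multi set) - sum geo S < (e :: real)"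
proof -
  have "(sum (geo :: 'n multi \<Rightarrow> real) \<longlongrightarrow> infsum geo (UNIV :: 'n multi set)) (finite_subsets_at_top UNIV)"
    unfolding has_sum_def[symmetric] by (rule has_sum_infsum[OF geo_summable])
  from tendstoD[OF this assms] have "\<forall>\<^sub>F S :: 'n multi set in finite_subsets_at_top UNIV. infsum geo (UNIV :: 'n multi set) - sum geo S < e"
    by (rule eventually_mono) (auto simp: dist_real_def)
  moreover have "\<forall>\<^sub>F S :: 'n multi set in finite_subsets_at_top UNIV. finite S"
    by (rule eventually_finite_subsets_at_top_weakI) simp
  ultimately show ?thesis by (auto elim: eventually_elim2)
qed

text \<open>The tail of \<open>geo\<close> bounds the tails in the norm itself, independently of x;
  this upgrades pointwise sums to sums in the topology.\<close>

lemma geometric_growth_sum: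
  fixes h :: "'n::{finite,linorder} multi \<Rightarrow> 'n clfun"
  assumes h: "\<And>m. growth_bound \<rho> \<sigma> (h m) (B * geo m)"
  shows "((\<lambda>m. h m x) has_sum (\<Sum>\<^sub>\<infinity>m. h m x)) UNIV"
    and "growth_bound \<rho> \<sigma> (\<lambda>x. \<Sum>\<^sub>\<infinity>m. h m x) (2 * B)"
    and "finite S \<Longrightarrow> growth_bound \<rho> \<sigma> (\<lambda>x. (\<Sum>m\<in>S. h m x) - (\<Sum>\<^sub>\<infinity>m. h m x)) (B * (infsum geo (UNIV :: 'n multi set) - sum geo S))"
proof -
  have b: "norm (h m x) \<le> (B * exp (\<sigma> * weight \<rho> (norm x))) * geo m" for m x
    using growth_boundD[OF h[of m], of x] by (simp add: mult_ac)
  show s: "((\<lambda>m. h m x) has_sum (\<Sum>\<^sub>\<infinity>m. h m x)) UNIV" for x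
    by (rule has_sum_infsum[OF Infinite_Sum.abs_summable_summable[OF geo_bounded_summable(1)[OF b]]])
  have gs: "((\<lambda>m::'n multi. c * geo m) has_sum c * infsum geo (UNIV :: 'n multi set)) UNIV" for c
    by (rule has_sum_cmult_right[OF has_sum_infsum[OF geo_summable]])
  show "growth_bound \<rho> \<sigma> (\<lambda>x. \<Sum>\<^sub>\<infinity>m. h m x) (2 * B)"
  proof (rule growth_boundI)
    fix x :: "'n paravec"
    have "norm (\<Sum>\<^sub>\<infinity>m. h m x) \<le> (\<Sum>\<^sub>\<infinity>m. norm (h m x))"
      by (rule norm_infsum_bound[OF geo_bounded_summable(1)[OF b]])
    also have "\<dots> \<le> 2 * (B * exp (\<sigma> * weight \<rho> (norm x)))" by (rule geo_bounded_summable(2)[OF b])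
    finally show "norm (\<Sum>\<^sub>\<infinity>m. h m x) \<le> 2 * B * exp (\<sigma> * weight \<rho> (norm x))" by (simp add: mult.assoc)
  qed
  assume S: "finite S"
  show "growth_bound \<rho> \<sigma> (\<lambda>x. (\<Sum>m\<in>S. h m x) - (\<Sum>\<^sub>\<infinity>m. h m x)) (B * (infsum geo (UNIV :: 'n multi set) - sum geo S))"
  proof (rule growth_boundI)
    fix x :: "'n paravec"
    let ?c = "B * exp (\<sigma> * weight \<rho> (norm x))"
    have "((\<lambda>m. h m x) has_sum (\<Sum>\<^sub>\<infinity>m. h m x) - (\<Sum>m\<in>S. h m x)) (UNIV - S)"
      by (rule has_sum_Diff[OF s has_sum_finite[OF S]]) simp
    moreover have "((\<lambda>m. ?c * geo m) has_sum ?c * infsum geo (UNIV :: 'n multi set) - (\<Sum>m\<in>S. ?c * geo m)) (UNIV - S)"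
      by (rule has_sum_Diff[OF gs has_sum_finite[OF S]]) simp
    ultimately have "norm ((\<Sum>\<^sub>\<infinity>m. h m x) - (\<Sum>m\<in>S. h m x)) \<le> ?c * infsum geo (UNIV :: 'n multi set) - (\<Sum>m\<in>S. ?c * geo m)"
      using b by (rule norm_infsum_le)
    also have "\<dots> = B * (infsum geo (UNIV :: 'n multi set) - sum geo S) * exp (\<sigma> * weight \<rho> (norm x))"
      unfolding sum_distrib_left[symmetric] by (simp add: algebra_simps)
    finally show "norm ((\<Sum>m\<in>S. h m x) - (\<Sum>\<^sub>\<infinity>m. h m x)) \<le> B * (infsum geo (UNIV :: 'n multi set) - sum geo S) * exp (\<sigma> * weight \<rho> (norm x))"
      by (simp only: norm_minus_commute)
  qed
qed

lemma geometric_growth_limit: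
  fixes h :: "'n::{finite,linorder} multi \<Rightarrow> 'n clfun"
  assumes po: "proximate_order \<rho> \<rho>0" and mono: "\<And>m. h m \<in> monogenic"
    and h: "\<And>\<sigma>. \<sigma> > 0 \<Longrightarrow> \<exists>B. \<forall>m. growth_bound \<rho> \<sigma> (h m) (B * geo m)"
  shows "(\<lambda>x. \<Sum>\<^sub>\<infinity>m. h m x) \<in> growth_min \<rho>"
    and "\<sigma> > 0 \<Longrightarrow> \<delta> > 0 \<Longrightarrow> \<forall>\<^sub>F S in finite_subsets_at_top UNIV.
      growth_bound \<rho> \<sigma> (\<lambda>x. (\<Sum>m\<in>S. h m x) - (\<Sum>\<^sub>\<infinity>m. h m x)) \<delta>"
    and "limitin (growth_min_topology \<rho>) (\<lambda>S x. \<Sum>m\<in>S. h m x) (\<lambda>x. \<Sum>\<^sub>\<infinity>m. h m x) (finite_subsets_at_top UNIV)"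
proof -
  have "(\<lambda>x. \<Sum>\<^sub>\<infinity>m. h m x) \<in> monogenic"
  proof (rule monogenic_infsum(1)[OF mono])
    fix R :: real
    obtain B where B: "\<And>m. growth_bound \<rho> 1 (h m) (B * geo m)" using h[of 1] by auto
    obtain C where C: "\<And>r. 0 \<le> r \<Longrightarrow> r \<le> R \<Longrightarrow> weight \<rho> r \<le> C" using weight_bounded[OF po] by blast
    have "norm (h m x) \<le> (B * exp C) * geo m" if "norm x \<le> R" for m x
    proof -
      have "norm (h m x) \<le> B * geo m * exp (weight \<rho> (norm x))" using growth_boundD[OF B[of m], of x] by simp
      also have "\<dots> \<le> B * geo m * exp C"
        using C[of "norm x"] that growth_bound_nonneg[OF B[of m]] by (intro mult_left_mono) auto
      finally show ?thesis by (simp add: mult_ac)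
    qed
    moreover have "(\<lambda>m::'n multi. (B * exp C) * geo m) summable_on UNIV" by (rule summable_on_cmult_right[OF geo_summable])
    ultimately show "\<exists>b. b summable_on UNIV \<and> (\<forall>m x. norm x \<le> R \<longrightarrow> norm (h m x) \<le> b m)" by blast
  qed
  moreover have "\<exists>B. growth_bound \<rho> \<sigma> (\<lambda>x. \<Sum>\<^sub>\<infinity>m. h m x) B" if "\<sigma> > 0" for \<sigma>
    using h[OF that] geometric_growth_sum(2) by metis
  ultimately show l: "(\<lambda>x. \<Sum>\<^sub>\<infinity>m. h m x) \<in> growth_min \<rho>" unfolding growth_min_iff by blast
  show ev: "\<forall>\<^sub>F S in finite_subsets_at_top UNIV. growth_bound \<rho> \<sigma> (\<lambda>x. (\<Sum>m\<in>S. h m x) - (\<Sum>\<^sub>\<infinity>m. h m x)) \<delta>"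
    if \<sigma>: "\<sigma> > 0" and \<delta>: "\<delta> > 0" for \<sigma> \<delta>
  proof -
    obtain B where B: "\<And>m. growth_bound \<rho> \<sigma> (h m) (B * geo m)" using h[OF \<sigma>] by blast
    have B0: "B \<ge> 0" using growth_bound_nonneg[OF B[of "\<lambda>i. 0"]] geo_pos[of "\<lambda>i::'n. 0"] by (simp add: zero_le_mult_iff)
    have "\<delta> / (B + 1) > 0" using \<delta> B0 by simp
    from geo_tail_eventually_less[OF this]
    show ?thesis
    proof (rule eventually_mono)
      fix S :: "'n multi set" assume elim: "finite S \<and> infsum geo (UNIV :: 'n multi set) - sum geo S < \<delta> / (B + 1)"
      have "B * (infsum geo (UNIV :: 'n multi set) - sum geo S) \<le> B * (\<delta> / (B + 1))"
        using elim B0 by (intro mult_left_mono) auto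
      also have "\<dots> \<le> \<delta>" using \<delta> B0 by (simp add: field_simps)
      finally show "growth_bound \<rho> \<sigma> (\<lambda>x. (\<Sum>m\<in>S. h m x) - (\<Sum>\<^sub>\<infinity>m. h m x)) \<delta>"
        by (rule growth_bound_mono[OF geometric_growth_sum(3)[OF B conjunct1[OF elim]] order_refl])
    qed
  qed
  have "h m \<in> growth_min \<rho>" for m unfolding growth_min_iff using mono h by blast
  then show "limitin (growth_min_topology \<rho>) (\<lambda>S x. \<Sum>m\<in>S. h m x) (\<lambda>x. \<Sum>\<^sub>\<infinity>m. h m x) (finite_subsets_at_top UNIV)"
    by (intro limitin_growth_minI l growth_min_sum ev)
qed

lemma right_linear_onD:
  assumes "right_linear_on S F" "f \<in> S"
  shows "g \<in> S \<Longrightarrow> F (\<lambda>x. f x + g x) = (\<lambda>x. F f x + F g x)" and "F (\<lambda>x. f x \<star> a) = (\<lambda>x. F f x \<star> a)"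
  using assms by (simp_all add: right_linear_on_def)

lemma right_linear_diff:
  assumes F: "right_linear_on (growth_min \<rho>) F" and f: "f \<in> growth_min \<rho>" and g: "g \<in> growth_min \<rho>"
  shows "F (\<lambda>x. f x - g x) = (\<lambda>x. F f x - F g x)"
proof -
  let ?h = "\<lambda>x. g x \<star> ((- 1) *\<^sub>R cl_one)"
  have "F (\<lambda>x. f x + ?h x) = (\<lambda>x. F f x + F ?h x)" "F ?h = (\<lambda>x. F g x \<star> ((- 1) *\<^sub>R cl_one))"
    by (rule right_linear_onD(1)[OF F f growth_min_mult_right[OF g]], rule right_linear_onD(2)[OF F g])
  then show ?thesis unfolding cl_mult_scaleR_one by simp
qed

section \<open>Convergence and continuity of the operators\<close>

locale proximate_pair =
  fixes \<rho>1 \<rho>2 \<rho>1' :: "real \<Rightarrow> real" and ord1 ord2 :: real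
  assumes pos1: "ord1 > 0" and pos2: "ord2 > 0"
    and po1: "proximate_order \<rho>1 ord1" and po2: "proximate_order \<rho>2 ord2"
    and norm1: "normalization \<rho>1' \<rho>1 ord1"
    and dominated: "(\<lambda>r. r powr \<rho>1 r) \<in> O[at_top](\<lambda>r. r powr \<rho>2 r)"
begin

text \<open>The only point at which the growth comparison of the two orders enters.\<close>

lemma exp_weight_dominated:
  assumes "\<sigma> > 0"
  obtains \<tau> E where "\<tau> > 0" "E > 0" "\<And>r. r \<ge> 0 \<Longrightarrow> exp (\<tau> * weight \<rho>1 r) \<le> E * exp (\<sigma> * weight \<rho>2 r)"
proof -
  obtain D C where D: "D \<ge> 1" "C \<ge> 0" "\<And>r. 0 \<le> r \<Longrightarrow> weight \<rho>1 r \<le> D * weight \<rho>2 r + C"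
    using weight_bigo[OF po1 dominated] by blast
  define \<tau> where "\<tau> = \<sigma> / D"
  have \<tau>: "\<tau> > 0" "\<tau> * D = \<sigma>" using assms D(1) by (auto simp: \<tau>_def)
  have "exp (\<tau> * weight \<rho>1 r) \<le> exp (\<tau> * C) * exp (\<sigma> * weight \<rho>2 r)" if "r \<ge> 0" for r
  proof -
    have "\<tau> * weight \<rho>1 r \<le> \<tau> * (D * weight \<rho>2 r + C)" using D(3)[OF that] \<tau>(1) by (intro mult_left_mono) auto
    also have "\<dots> = \<tau> * C + \<sigma> * weight \<rho>2 r" using \<tau>(2) by (simp add: algebra_simps)
    finally show ?thesis by (simp flip: exp_add)
  qed
  then show ?thesis using that[of \<tau> "exp (\<tau> * C)"] \<tau>(1) by simp
qed

text \<open>In the product of the two majorants the factors G/m! of the coefficient and m!/G of the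
  derivative cancel, and half of \<sigma> is spent on each. The choices run from \<sigma> to the
  type for \<open>u\<close>, then to its constant \<open>L\<close>, then to \<epsilon>, and finally
  to the type for \<open>f\<close>.\<close>

lemma op_term_bound:
  fixes u :: "'n::{finite,linorder} multi \<Rightarrow> 'n clfun"
  assumes u: "u \<in> diff_ops \<rho>1' ord1 \<rho>2" and \<sigma>: "\<sigma> > 0"
  shows "\<exists>\<sigma>'>0. \<exists>K>0. \<forall>f\<in>monogenic. \<forall>B. growth_bound \<rho>1 \<sigma>' f B \<longrightarrow>
    (\<forall>m. growth_bound \<rho>2 \<sigma> (op_term u f m) (K * B * geo m))"
proof -
  let ?G = "\<lambda>m :: 'n multi. G_seq \<rho>1' ord1 (msize m)"
  have Gpos: "?G m > 0" for m by (rule G_seq_pos[OF norm1 pos1])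
  have um: "u m \<in> monogenic" for m using u growth_union_monogenic by (auto simp: diff_ops_def)
  obtain A K where AK: "A \<ge> 1" "K \<ge> 1"
    and ck: "\<forall>f\<in>monogenic. \<forall>g\<in>monogenic. \<forall>x :: 'n paravec.
      norm ((f \<odot>\<^sub>L g) x) \<le> K * majorant f (A * norm x) * majorant g (A * norm x)"
    using ck_prod_norm by blast
  obtain \<sigma>u K1 where 1: "\<sigma>u > 0" "K1 > 0" "\<forall>(f :: 'n clfun)\<in>monogenic. \<forall>B. growth_bound \<rho>2 \<sigma>u f B \<longrightarrow>
    (\<forall>r\<ge>0. \<forall>m. (A * r) ^ msize m * norm (taylor_coeff f m) \<le> K1 * B * exp (\<sigma> / 2 * weight \<rho>2 r) * geo m)"
    using majorant_growth[OF po2 pos2, of "\<sigma> / 2" A] \<sigma> AK(1) by auto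
  obtain L C where L: "L > 0" "C > 0" "\<And>m. growth_bound \<rho>2 \<sigma>u (u m) (C * (?G m / mfact m) * L ^ msize m)"
    using u 1(1) unfolding diff_ops_def growth_norm_le_iff by blast
  obtain \<tau> E where E: "\<tau> > 0" "E > 0" "\<And>r. r \<ge> 0 \<Longrightarrow> exp (\<tau> * weight \<rho>1 r) \<le> E * exp (\<sigma> / 2 * weight \<rho>2 r)"
    using exp_weight_dominated[of "\<sigma> / 2"] \<sigma> by auto
  \<comment> \<open>Chosen so that L \<epsilon> is the ratio of \<open>geo\<close>.\<close>
  define \<epsilon> where "\<epsilon> = 1 / (2 * real CARD('n) * L)"
  have \<epsilon>: "\<epsilon> > 0" using L(1) by (simp add: \<epsilon>_def)
  have geo: "L ^ msize m * \<epsilon> ^ msize m = geo m" for m :: "'n multi"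
    using L(1) by (simp add: geo_def \<epsilon>_def flip: power_mult_distrib)
  obtain \<sigma>' K2 where 2: "\<sigma>' > 0" "K2 > 0" "\<forall>(f :: 'n clfun)\<in>monogenic. \<forall>B. growth_bound \<rho>1 \<sigma>' f B \<longrightarrow>
    (\<forall>r\<ge>0. \<forall>m l. (A * r) ^ msize l * norm (taylor_coeff (mpd m f) l) \<le>
      K2 * B * (mfact m * \<epsilon> ^ msize m / ?G m) * exp (\<tau> * weight \<rho>1 r) * geo l)"
    using majorant_mpd_growth[OF po1 norm1 pos1 \<epsilon> E(1), of A] AK(1) by auto
  define K' where "K' = K * (2 * K1 * C) * (2 * K2 * E)"
  have "growth_bound \<rho>2 \<sigma> (op_term u f m) (K' * B * geo m)"
    if f: "f \<in> monogenic" "growth_bound \<rho>1 \<sigma>' f B" for f :: "'n clfun" and B m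
  proof (rule growth_boundI)
    fix x :: "'n paravec"
    let ?r = "norm x" and ?q = "msize m"
    let ?e = "exp (\<sigma> / 2 * weight \<rho>2 ?r)"
    have B: "B \<ge> 0" by (rule growth_bound_nonneg[OF f(2)])
    have Ar: "A * ?r \<ge> 0" using AK(1) by simp
    have m1: "majorant (u m) (A * ?r) \<le> 2 * (K1 * (C * (?G m / mfact m) * L ^ ?q) * ?e)"
      by (rule majorant_le[OF Ar 1(3)[rule_format, OF um L(3) norm_ge_zero]])
    have "majorant (mpd m f) (A * ?r) \<le> 2 * (K2 * B * (mfact m * \<epsilon> ^ ?q / ?G m) * exp (\<tau> * weight \<rho>1 ?r))"
      by (rule majorant_le[OF Ar 2(3)[rule_format, OF f norm_ge_zero]])
    also have "\<dots> \<le> 2 * (K2 * B * (mfact m * \<epsilon> ^ ?q / ?G m) * (E * ?e))"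
      using 2(2) B mfact_pos[of m] Gpos[of m] \<epsilon> E(3)[of ?r] by (intro mult_left_mono) auto
    finally have m2: "majorant (mpd m f) (A * ?r) \<le> 2 * (K2 * B * (mfact m * \<epsilon> ^ ?q / ?G m) * (E * ?e))" .
    have "norm (op_term u f m x) \<le> K * majorant (u m) (A * ?r) * majorant (mpd m f) (A * ?r)"
      unfolding op_term_def by (rule ck[rule_format, OF um monogenic_mpd[OF f(1)]])
    also have "\<dots> \<le> K * (2 * (K1 * (C * (?G m / mfact m) * L ^ ?q) * ?e)) * (2 * (K2 * B * (mfact m * \<epsilon> ^ ?q / ?G m) * (E * ?e)))"
      using AK(2) 1(2) L(1,2) Gpos[of m] mfact_pos[of m]
      by (intro mult_mono m1 m2 majorant_nonneg Ar order_refl) auto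
    also have "\<dots> = K' * B * (L ^ ?q * \<epsilon> ^ ?q) * (?e * ?e)"
      using Gpos[of m] mfact_pos[of m] by (simp add: K'_def)
    also have "?e * ?e = exp (\<sigma> * weight \<rho>2 ?r)" by (simp flip: exp_add)
    finally show "norm (op_term u f m x) \<le> K' * B * geo m * exp (\<sigma> * weight \<rho>2 ?r)" by (simp only: geo)
  qed
  moreover have "K' > 0" using AK(2) 1(2) L(2) 2(2) E(2) by (simp add: K'_def)
  ultimately show ?thesis using 2(1) by blast
qed

lemma op_term_monogenic:
  fixes u :: "'n::{finite,linorder} multi \<Rightarrow> 'n clfun"
  assumes "u m \<in> monogenic" "f \<in> monogenic" shows "op_term u f m \<in> monogenic"
  unfolding op_term_def by (rule ck_prod_monogenic[OF assms(1) monogenic_mpd[OF assms(2)]])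

lemma op_apply_limit:
  fixes u :: "'n::{finite,linorder} multi \<Rightarrow> 'n clfun"
  assumes u: "u \<in> diff_ops \<rho>1' ord1 \<rho>2" and f: "f \<in> growth_min \<rho>1"
  shows "op_apply u f \<in> growth_min \<rho>2"
    and "limitin (growth_min_topology \<rho>2) (\<lambda>M x. \<Sum>m\<in>M. op_term u f m x) (op_apply u f) (finite_subsets_at_top UNIV)"
    and "((\<lambda>m. op_term u f m x) has_sum op_apply u f x) UNIV"
proof -
  have fm: "f \<in> monogenic" by (rule growth_min_monogenic[OF f])
  have um: "u m \<in> monogenic" for m using u growth_union_monogenic by (auto simp: diff_ops_def)
  have b: "\<exists>B. \<forall>m. growth_bound \<rho>2 \<sigma> (op_term u f m) (B * geo m)" if \<sigma>: "\<sigma> > 0" for \<sigma>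
  proof -
    obtain \<sigma>' K where K: "\<sigma>' > 0" "\<forall>f\<in>monogenic. \<forall>B. growth_bound \<rho>1 \<sigma>' f B \<longrightarrow>
      (\<forall>m. growth_bound \<rho>2 \<sigma> (op_term u f m) (K * B * geo m))" using op_term_bound[OF u \<sigma>] by blast
    obtain B where "growth_bound \<rho>1 \<sigma>' f B" using f K(1) unfolding growth_min_iff by blast
    then show ?thesis using K(2) fm by blast
  qed
  have eq: "op_apply u f = (\<lambda>x. \<Sum>\<^sub>\<infinity>m. op_term u f m x)" by (simp add: op_apply_def fun_eq_iff)
  show "op_apply u f \<in> growth_min \<rho>2"
    "limitin (growth_min_topology \<rho>2) (\<lambda>M x. \<Sum>m\<in>M. op_term u f m x) (op_apply u f) (finite_subsets_at_top UNIV)"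
    unfolding eq by (rule geometric_growth_limit[OF po2 op_term_monogenic[of u _ f, OF um fm] b]; assumption)+
  obtain B where "\<forall>m. growth_bound \<rho>2 1 (op_term u f m) (B * geo m)" using b[of 1] by auto
  then show "((\<lambda>m. op_term u f m x) has_sum op_apply u f x) UNIV"
    unfolding op_apply_def using geometric_growth_sum(1) by blast
qed

lemma op_apply_right_linear:
  fixes u :: "'n::{finite,linorder} multi \<Rightarrow> 'n clfun"
  assumes u: "u \<in> diff_ops \<rho>1' ord1 \<rho>2"
  shows "right_linear_on (growth_min \<rho>1) (op_apply u)"
proof -
  have um: "u m \<in> monogenic" for m using u growth_union_monogenic by (auto simp: diff_ops_def)
  note sum = op_apply_limit(3)[OF u]
  show ?thesis unfolding right_linear_on_def
  proof (intro conjI ballI allI ext)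
    fix f g :: "'n clfun" and x assume f: "f \<in> growth_min \<rho>1" and g: "g \<in> growth_min \<rho>1"
    note fm = growth_min_monogenic[OF f] and gm = growth_min_monogenic[OF g]
    have "((\<lambda>m. op_term u (\<lambda>x. f x + g x) m x) has_sum op_apply u f x + op_apply u g x) UNIV"
      unfolding op_term_linear(1)[of u, OF um fm gm] by (intro has_sum_add sum f g)
    then show "op_apply u (\<lambda>x. f x + g x) x = op_apply u f x + op_apply u g x"
      by (rule has_sum_unique[OF sum[OF growth_min_add[OF f g]]])
  next
    fix f :: "'n clfun" and a x assume f: "f \<in> growth_min \<rho>1"
    note fm = growth_min_monogenic[OF f]
    have "((\<lambda>m. op_term u (\<lambda>x. f x \<star> a) m x) has_sum op_apply u f x \<star> a) UNIV"
      unfolding op_term_linear(2)[of u, OF um fm fm]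
      by (rule has_sum_bounded_linear[OF cl_mult.bounded_linear_left sum[OF f]])
    then show "op_apply u (\<lambda>x. f x \<star> a) x = op_apply u f x \<star> a"
      by (rule has_sum_unique[OF sum[OF growth_min_mult_right[OF f]]])
  qed
qed

lemma op_apply_continuous_hom:
  fixes u :: "'n::{finite,linorder} multi \<Rightarrow> 'n clfun"
  assumes u: "u \<in> diff_ops \<rho>1' ord1 \<rho>2"
  shows "continuous_hom \<rho>1 \<rho>2 (op_apply u)"
proof -
  note lin = op_apply_right_linear[OF u]
  have "continuous_map (growth_min_topology \<rho>1) (growth_min_topology \<rho>2) (op_apply u)"
  proof (rule continuous_map_growth_minI)
    fix \<sigma> :: real assume "\<sigma> > 0"
    from op_term_bound[OF u this] obtain \<sigma>' K where K: "\<sigma>' > 0" "K > 0"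
      "\<forall>f\<in>monogenic. \<forall>B. growth_bound \<rho>1 \<sigma>' f B \<longrightarrow> (\<forall>m. growth_bound \<rho>2 \<sigma> (op_term u f m) (K * B * geo m))"
      by blast
    have "growth_bound \<rho>2 \<sigma> (\<lambda>x. op_apply u g x - op_apply u f x) (2 * K * B)"
      if f: "f \<in> growth_min \<rho>1" and g: "g \<in> growth_min \<rho>1" and b: "growth_bound \<rho>1 \<sigma>' (\<lambda>x. g x - f x) B" for f g B
    proof -
      have "growth_bound \<rho>2 \<sigma> (\<lambda>x. \<Sum>\<^sub>\<infinity>m. op_term u (\<lambda>x. g x - f x) m x) (2 * (K * B))"
        using K(3) growth_min_monogenic[OF growth_min_diff[OF g f]] b by (intro geometric_growth_sum(2)) blast
      then have "growth_bound \<rho>2 \<sigma> (op_apply u (\<lambda>x. g x - f x)) (2 * (K * B))"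
        by (simp add: op_apply_def[abs_def])
      then show ?thesis unfolding right_linear_diff[OF lin g f] by (simp add: mult.assoc)
    qed
    then show "\<exists>\<sigma>'>0. \<exists>K>0. \<forall>f\<in>growth_min \<rho>1. \<forall>g\<in>growth_min \<rho>1. \<forall>B.
      growth_bound \<rho>1 \<sigma>' (\<lambda>x. g x - f x) B \<longrightarrow> growth_bound \<rho>2 \<sigma> (\<lambda>x. op_apply u g x - op_apply u f x) (K * B)"
      using K(1,2) by (intro exI[of _ \<sigma>'] exI[of _ "2 * K"] conjI ballI allI impI) auto
  qed (rule op_apply_limit(1)[OF u])
  then show ?thesis using lin by (simp add: continuous_hom_def)
qed

subsection \<open>Homomorphisms are determined by the Fueter polynomials\<close>

lemma fueter_growth:
  assumes "\<sigma> > 0"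
  shows "\<exists>\<mu>>0. \<exists>C>0. \<forall>m :: 'n::{finite,linorder} multi.
    growth_bound \<rho>1 \<sigma> (fueter m) (C * \<mu> ^ msize m * G_seq \<rho>1' ord1 (msize m))"
proof -
  obtain A where A: "A \<ge> 1" "\<And>(m :: 'n multi) x a. norm (fueter m x \<star> a) \<le> (A * norm x) ^ msize m * norm a"
    using fueter_norm_bound by blast
  obtain \<mu> C where C: "\<mu> > 0" "C > 0"
    "\<And>q r. r \<ge> 0 \<Longrightarrow> r ^ q \<le> C * \<mu> ^ q * G_seq \<rho>1' ord1 q * exp (\<sigma> * weight \<rho>1 r)"
    using G_seq_upper[OF po1 norm1 pos1 assms] by blast
  have "growth_bound \<rho>1 \<sigma> (fueter m) (C * (A * \<mu>) ^ msize m * G_seq \<rho>1' ord1 (msize m))" for m :: "'n multi"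
  proof (rule growth_boundI)
    fix x :: "'n paravec"
    have "norm (fueter m x) \<le> A ^ msize m * norm x ^ msize m"
      using A(2)[of m x cl_one] by (simp add: cl_mult_one power_mult_distrib)
    also have "\<dots> \<le> A ^ msize m * (C * \<mu> ^ msize m * G_seq \<rho>1' ord1 (msize m) * exp (\<sigma> * weight \<rho>1 (norm x)))"
      using A(1) by (intro mult_left_mono C(3)) auto
    finally show "norm (fueter m x) \<le> C * (A * \<mu>) ^ msize m * G_seq \<rho>1' ord1 (msize m) * exp (\<sigma> * weight \<rho>1 (norm x))"
      by (simp add: power_mult_distrib mult_ac)
  qed
  then show ?thesis using A(1) C(1,2) by (intro exI[of _ "A * \<mu>"] exI[of _ C]) auto
qed

lemma fueter_growth_min: "fueter m \<in> growth_min \<rho>1"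
  unfolding growth_min_iff using monogenic_fueter fueter_growth by blast

text \<open>The Taylor series of \<open>f\<close> converges in the topology of the space; apply F to
  the finite partial sums, where right linearity leaves the coefficients on the right, and use the
  seminorm bound for the remainder.\<close>

lemma continuous_hom_fueter_series:
  fixes F :: "'n::{finite,linorder} clfun \<Rightarrow> 'n clfun"
  assumes F: "continuous_hom \<rho>1 \<rho>2 F" and f: "f \<in> growth_min \<rho>1"
  shows "((\<lambda>m. F (fueter m) x \<star> taylor_coeff f m) has_sum F f x) UNIV"
proof -
  have lin: "right_linear_on (growth_min \<rho>1) F" using F by (simp add: continuous_hom_def)
  have fm: "f \<in> monogenic" by (rule growth_min_monogenic[OF f])
  define h where "h m x = fueter m x \<star> taylor_coeff f m" for m x
  have h: "h m \<in> growth_min \<rho>1" for m unfolding h_def[abs_def] by (rule growth_min_mult_right[OF fueter_growth_min])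
  have Fh: "F (h m) = (\<lambda>x. F (fueter m) x \<star> taylor_coeff f m)" for m
    unfolding h_def[abs_def] by (rule right_linear_onD(2)[OF lin fueter_growth_min])
  have Fsum: "F (\<lambda>x. \<Sum>m\<in>S. h m x) = (\<lambda>x. \<Sum>m\<in>S. F (h m) x)" if "finite S" for S
    using that
  proof (induction S)
    case empty
    then show ?case using right_linear_zero[OF lin growth_min_zero] by simp
  next
    case (insert m S)
    have "F (\<lambda>x. h m x + (\<Sum>m\<in>S. h m x)) = (\<lambda>x. F (h m) x + F (\<lambda>x. \<Sum>m\<in>S. h m x) x)"
      by (rule right_linear_onD(1)[OF lin h growth_min_sum[OF h]])
    then show ?case using insert by simp
  qed
  have f_eq: "(\<Sum>\<^sub>\<infinity>m. h m x) = f x" for x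
    unfolding h_def by (rule infsumI[OF monogenic_taylor_has_sum[OF fm]])
  obtain A where A: "A \<ge> 1" "\<And>(m :: 'n multi) x a. norm (fueter m x \<star> a) \<le> (A * norm x) ^ msize m * norm a"
    using fueter_norm_bound by blast
  have hb: "\<exists>B. \<forall>m. growth_bound \<rho>1 \<sigma> (h m) (B * geo m)" if \<sigma>: "\<sigma> > 0" for \<sigma>
  proof -
    obtain \<sigma>' K where K: "\<sigma>' > 0" "\<forall>(f :: 'n clfun)\<in>monogenic. \<forall>B. growth_bound \<rho>1 \<sigma>' f B \<longrightarrow>
      (\<forall>r\<ge>0. \<forall>m. (A * r) ^ msize m * norm (taylor_coeff f m) \<le> K * B * exp (\<sigma> * weight \<rho>1 r) * geo m)"
      using majorant_growth[OF po1 pos1 \<sigma>, of A] A(1) by auto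
    obtain B where B: "growth_bound \<rho>1 \<sigma>' f B" using f K(1) unfolding growth_min_iff by blast
    have "growth_bound \<rho>1 \<sigma> (h m) (K * B * geo m)" for m
    proof (rule growth_boundI)
      fix x :: "'n paravec"
      have "(A * norm x) ^ msize m * norm (taylor_coeff f m) \<le> K * B * exp (\<sigma> * weight \<rho>1 (norm x)) * geo m"
        using K(2) fm B norm_ge_zero by blast
      then show "norm (h m x) \<le> K * B * geo m * exp (\<sigma> * weight \<rho>1 (norm x))"
        using A(2)[of m x "taylor_coeff f m"] by (simp add: h_def mult_ac)
    qed
    then show ?thesis by blast
  qed
  obtain \<sigma>' K where K: "\<sigma>' > 0" "K > 0" "\<forall>f\<in>growth_min \<rho>1. \<forall>B. growth_bound \<rho>1 \<sigma>' f B \<longrightarrow> growth_bound \<rho>2 1 (F f) (K * B)"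
    using continuous_hom_estimate[OF F, of 1] by auto
  show ?thesis unfolding has_sum_def
  proof (rule tendstoI)
    fix e :: real assume e: "e > 0"
    define \<delta> where "\<delta> = e / (2 * K * exp (weight \<rho>2 (norm x)))"
    have \<delta>: "\<delta> > 0" using e K(2) by (simp add: \<delta>_def)
    have hm: "h m \<in> monogenic" for m by (rule growth_min_monogenic[OF h])
    have fin: "\<forall>\<^sub>F S :: 'n multi set in finite_subsets_at_top UNIV. finite S"
      by (rule eventually_finite_subsets_at_top_weakI) simp
    have "\<forall>\<^sub>F S in finite_subsets_at_top UNIV. growth_bound \<rho>1 \<sigma>' (\<lambda>x. (\<Sum>m\<in>S. h m x) - (\<Sum>\<^sub>\<infinity>m. h m x)) \<delta>"
      by (rule geometric_growth_limit(2)[OF po1 hm hb K(1) \<delta>])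
    then have "\<forall>\<^sub>F S in finite_subsets_at_top UNIV. growth_bound \<rho>1 \<sigma>' (\<lambda>x. (\<Sum>m\<in>S. h m x) - f x) \<delta>"
      by (simp only: f_eq)
    then show "\<forall>\<^sub>F S in finite_subsets_at_top UNIV. dist (\<Sum>m\<in>S. F (fueter m) x \<star> taylor_coeff f m) (F f x) < e"
      using fin
    proof (eventually_elim)
      case (elim S)
      have S: "(\<lambda>x. \<Sum>m\<in>S. h m x) \<in> growth_min \<rho>1" by (rule growth_min_sum[OF h])
      have "growth_bound \<rho>2 1 (F (\<lambda>x. (\<Sum>m\<in>S. h m x) - f x)) (K * \<delta>)"
        using K(3) growth_min_diff[OF S f] elim(1) by blast
      then have "norm ((\<Sum>m\<in>S. F (h m) x) - F f x) \<le> K * \<delta> * exp (1 * weight \<rho>2 (norm x))"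
        unfolding right_linear_diff[OF lin S f] Fsum[OF elim(2)] by (rule growth_boundD)
      also have "\<dots> < e" using e K(2) by (simp add: \<delta>_def)
      finally show ?case by (simp add: dist_norm Fh)
    qed
  qed
qed

end

subsection \<open>The symbol of a homomorphism\<close>

definition msub :: "'n multi \<Rightarrow> 'n multi \<Rightarrow> 'n multi" where
  "msub p m = (\<lambda>i. p i - m i)"

text \<open>The product structure lets cardinalities and sums over intervals of multi-indices factor
  over the coordinates.\<close>

lemma multi_interval:
  "{m :: 'n::{finite,linorder} multi. k \<le> m \<and> m \<le> p} = (\<Pi>\<^sub>E i\<in>UNIV. {k i..p i})"
  by (auto simp: le_fun_def PiE_iff)

lemma finite_multi_interval: "finite {m :: 'n::{finite,linorder} multi. k \<le> m \<and> m \<le> p}"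
  unfolding multi_interval by (intro finite_PiE) auto

lemma multi_atMost: "{m :: 'n::{finite,linorder} multi. m \<le> p} = {m. (\<lambda>i. 0) \<le> m \<and> m \<le> p}"
  by (auto simp: le_fun_def)

lemma finite_multi_atMost: "finite {m :: 'n::{finite,linorder} multi. m \<le> p}"
  unfolding multi_atMost by (rule finite_multi_interval)

lemma card_multi_atMost: "card {m :: 'n::{finite,linorder} multi. m \<le> p} \<le> 2 ^ msize p"
proof -
  have "card {m. m \<le> p} = (\<Prod>i\<in>UNIV. Suc (p i))"
    unfolding multi_atMost multi_interval by (simp add: card_PiE)
  also have "\<dots> \<le> (\<Prod>i\<in>UNIV. 2 ^ p i)"
    by (intro prod_mono) (simp add: Suc_leI)
  also have "\<dots> = 2 ^ msize p" by (simp add: msize_def power_sum)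
  finally show ?thesis .
qed

text \<open>The expansion of (1 - 1)^(b - a), shifted to start at a.\<close>

lemma alternating_interval_sum:
  assumes "a \<le> b"
  shows "(\<Sum>j=a..b. (- 1) ^ (j - a) * (fact (b - a) / (fact (b - j) * fact (j - a)))) = (if a = b then 1 else (0 :: real))"
proof -
  define n where "n = b - a"
  have b: "b = a + n" using assms by (simp add: n_def)
  have "(\<Sum>j=a..b. (- 1) ^ (j - a) * (fact (b - a) / (fact (b - j) * fact (j - a)))) =
      (\<Sum>i\<le>n. (- 1) ^ i * real (n choose i))"
    unfolding b
    by (rule sum.reindex_bij_witness[where i = "\<lambda>i. a + i" and j = "\<lambda>j. j - a"])
      (auto simp: binomial_fact mult.commute add.commute)
  also have "\<dots> = (if a = b then 1 else 0)"
    using choose_alternating_sum[of n, where 'a = real] by (auto simp: b)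
  finally show ?thesis .
qed

lemma alternating_multi_sum:
  fixes k p :: "'n::{finite,linorder} multi"
  assumes "k \<le> p"
  shows "(\<Sum>m | k \<le> m \<and> m \<le> p. (- 1) ^ msize (msub m k) * (mfact (msub p k) / (mfact (msub p m) * mfact (msub m k)))) =
    (if k = p then 1 else 0)"
proof -
  have "(\<Sum>m | k \<le> m \<and> m \<le> p. (- 1) ^ msize (msub m k) * (mfact (msub p k) / (mfact (msub p m) * mfact (msub m k)))) =
      (\<Sum>m\<in>(\<Pi>\<^sub>E i\<in>UNIV. {k i..p i}). \<Prod>i\<in>UNIV. (- 1) ^ (m i - k i) * (fact (p i - k i) / (fact (p i - m i) * fact (m i - k i))))"
    unfolding multi_interval
    by (intro sum.cong refl) (simp add: mfact_def msize_def msub_def power_sum prod.distrib prod_dividef)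
  also have "\<dots> = (\<Prod>i\<in>UNIV. \<Sum>j=k i..p i. (- 1) ^ (j - k i) * (fact (p i - k i) / (fact (p i - j) * fact (j - k i))))"
    by (rule prod_sum_PiE[symmetric]) auto
  also have "\<dots> = (\<Prod>i\<in>UNIV. if k i = p i then 1 else 0)"
    using assms by (intro prod.cong refl alternating_interval_sum) (simp add: le_fun_def)
  also have "\<dots> = (if k = p then 1 else 0)"
    by (auto simp: fun_eq_iff prod_zero_iff)
  finally show ?thesis .
qed

section \<open>Calculus of the CK-product with a monomial\<close>

lemma monogenic_shift:
  fixes w :: "'n::{finite,linorder} clfun"
  assumes "w \<in> monogenic" shows "shift j w \<in> monogenic"
proof (rule shift_properties[where 'n = 'n], goal_cases)
  case (1 A)
  show ?case by (rule 1(3)[OF assms])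
qed

lemma taylor_coeff_shift:
  fixes w :: "'n::{finite,linorder} clfun"
  assumes "w \<in> monogenic"
  shows "taylor_coeff (shift j w) p = (if j \<le> p then taylor_coeff w (msub p j) else 0)"
  unfolding msub_def
proof (rule shift_properties[where 'n = 'n], goal_cases)
  case (1 A)
  show ?case by (rule 1(4)[OF assms])
qed

lemma shift_norm:
  "\<exists>A\<ge>1. \<forall>w\<in>monogenic. \<forall>j. \<forall>x :: 'n::{finite,linorder} paravec.
    norm (shift j w x) \<le> (A * norm x) ^ msize j * majorant w (A * norm x)"
proof (rule shift_properties[where 'n = 'n], goal_cases)
  case (1 A)
  show ?case using 1(1) by (intro exI[of _ A] conjI ballI allI 1(2))
qed

lemma shift_shift:
  assumes "w \<in> monogenic" shows "shift i (shift j w) = shift (madd i j) w"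
proof (rule monogenic_eqI)
  fix p
  have "(i \<le> p \<and> j \<le> msub p i) = (madd i j \<le> p)"
    by (auto simp: le_fun_def madd_def msub_def) (metis add_leD1 le_diff_conv2 add.commute)+
  moreover have "msub (msub p i) j = msub p (madd i j)" by (simp add: msub_def madd_def fun_eq_iff)
  ultimately show "taylor_coeff (shift i (shift j w)) p = taylor_coeff (shift (madd i j) w) p"
    by (cases "madd i j \<le> p") (auto simp: taylor_coeff_shift monogenic_shift assms)
qed (simp_all add: monogenic_shift assms)

lemma shift_zero: "w \<in> monogenic \<Longrightarrow> shift (\<lambda>i. 0) w = w"
  by (rule monogenic_eqI) (simp_all add: monogenic_shift taylor_coeff_shift le_fun_def msub_def)

lemma shift_sum:
  assumes "\<And>k. w k \<in> monogenic"
  shows "shift j (\<lambda>x. \<Sum>k\<in>I. c k *\<^sub>R w k x) = (\<lambda>x. \<Sum>k\<in>I. c k *\<^sub>R shift j (w k) x)"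
proof (rule monogenic_eqI)
  note m = monogenic_scaleR(1)[OF assms] monogenic_scaleR(1)[OF monogenic_shift[OF assms]]
  show "shift j (\<lambda>x. \<Sum>k\<in>I. c k *\<^sub>R w k x) \<in> monogenic" "(\<lambda>x. \<Sum>k\<in>I. c k *\<^sub>R shift j (w k) x) \<in> monogenic"
    by (intro monogenic_shift monogenic_sum m)+
  show "taylor_coeff (shift j (\<lambda>x. \<Sum>k\<in>I. c k *\<^sub>R w k x)) p = taylor_coeff (\<lambda>x. \<Sum>k\<in>I. c k *\<^sub>R shift j (w k) x) p" for p
    by (simp add: taylor_coeff_shift monogenic_sum m taylor_coeff_sum taylor_coeff_scaleR assms monogenic_shift)
qed

text \<open>Derivatives of a Fueter polynomial are multiples of Fueter polynomials and vanish unless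
  m \<le> p, so the series is a finite sum of CK-products with single monomials.\<close>

lemma op_apply_fueter:
  fixes u :: "'n::{finite,linorder} multi \<Rightarrow> 'n clfun"
  shows "op_apply u (fueter p) x = (\<Sum>m | m \<le> p. (mfact p / mfact (msub p m)) *\<^sub>R shift (msub p m) (u m) x)"
proof -
  have tc: "taylor_coeff (mpd m (fueter p)) l = (if m \<le> p \<and> l = msub p m then (mfact p / mfact (msub p m)) *\<^sub>R cl_one else 0)" for m l
  proof -
    have "madd m l = p \<longleftrightarrow> m \<le> p \<and> l = msub p m"
      by (auto simp: madd_def msub_def le_fun_def fun_eq_iff) (metis le_add1, metis add_diff_cancel_left')
    then show ?thesis by (auto simp: taylor_coeff_mpd[OF monogenic_fueter] taylor_coeff_fueter)
  qed
  have 1: "op_term u (fueter p) m x = (mfact p / mfact (msub p m)) *\<^sub>R shift (msub p m) (u m) x" if "m \<le> p" for m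
    unfolding op_term_def by (rule ck_prod_single) (simp add: tc that)
  have 0: "op_term u (fueter p) m x = 0" if "\<not> m \<le> p" for m
    using ck_prod_single[of "mpd m (fueter p)" m 0 "u m" x] by (simp add: op_term_def tc that)
  have "op_apply u (fueter p) x = (\<Sum>\<^sub>\<infinity>m\<in>{m. m \<le> p}. op_term u (fueter p) m x)"
    unfolding op_apply_def by (rule infsum_cong_neutral) (auto simp: 0)
  also have "\<dots> = (\<Sum>m | m \<le> p. op_term u (fueter p) m x)"
    by (rule infsum_finite[OF finite_multi_atMost])
  finally show ?thesis using 1 by simp
qed

text \<open>The coefficients are recovered from the images \<open>w\<^sub>k\<close> of the Fueter polynomials \<open>V\<^sub>k\<close> by binomial inversion
  of \<open>w\<^sub>p = \<Sum>\<^bsub>m\<le>p\<^esub> p!/(p - m)! u\<^sub>m \<odot> V\<^bsub>p-m\<^esub>\<close>.\<close>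

definition symbol :: "('n::{finite,linorder} multi \<Rightarrow> 'n clfun) \<Rightarrow> 'n multi \<Rightarrow> 'n clfun" where
  "symbol w m x = (\<Sum>k | k \<le> m. ((- 1) ^ msize (msub m k) / (mfact k * mfact (msub m k))) *\<^sub>R shift (msub m k) (w k) x)"

lemma monogenic_symbol:
  assumes "\<And>k. w k \<in> monogenic" shows "symbol w m \<in> monogenic"
  unfolding symbol_def[abs_def] by (intro monogenic_sum monogenic_scaleR(1) monogenic_shift assms)

lemma symbol_inversion:
  fixes w :: "'n::{finite,linorder} multi \<Rightarrow> 'n clfun"
  assumes w: "\<And>k. w k \<in> monogenic"
  shows "(\<Sum>m | m \<le> p. (mfact p / mfact (msub p m)) *\<^sub>R shift (msub p m) (symbol w m) x) = w p x"
proof -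
  define X where "X k = shift (msub p k) (w k) x" for k
  define c where "c m k = (mfact p / mfact (msub p m)) * ((- 1) ^ msize (msub m k) / (mfact k * mfact (msub m k)))" for m k
  let ?B = "{m. m \<le> p}"
  have "(mfact p / mfact (msub p m)) *\<^sub>R shift (msub p m) (symbol w m) x = (\<Sum>k\<in>{k. k \<in> ?B \<and> k \<le> m}. c m k *\<^sub>R X k)"
    if m: "m \<le> p" for m
  proof -
    have "shift (msub p m) (symbol w m) x =
        (\<Sum>k | k \<le> m. ((- 1) ^ msize (msub m k) / (mfact k * mfact (msub m k))) *\<^sub>R shift (msub p m) (shift (msub m k) (w k)) x)"
      unfolding symbol_def[abs_def] by (subst shift_sum[OF monogenic_shift[OF w]]) (rule refl)
    also have "\<dots> = (\<Sum>k | k \<le> m. ((- 1) ^ msize (msub m k) / (mfact k * mfact (msub m k))) *\<^sub>R X k)"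
    proof (intro sum.cong refl)
      fix k assume k: "k \<in> {k. k \<le> m}"
      have "madd (msub p m) (msub m k) = msub p k"
        using k m by (auto simp: madd_def msub_def le_fun_def fun_eq_iff)
      then show "((- 1) ^ msize (msub m k) / (mfact k * mfact (msub m k))) *\<^sub>R shift (msub p m) (shift (msub m k) (w k)) x =
          ((- 1) ^ msize (msub m k) / (mfact k * mfact (msub m k))) *\<^sub>R X k"
        by (simp add: shift_shift[OF w] X_def)
    qed
    also have "{k. k \<le> m} = {k. k \<in> ?B \<and> k \<le> m}" using m by (auto intro: order_trans)
    finally show ?thesis by (simp add: scaleR_sum_right c_def)
  qed
  then have "(\<Sum>m | m \<le> p. (mfact p / mfact (msub p m)) *\<^sub>R shift (msub p m) (symbol w m) x) =
      (\<Sum>m\<in>?B. \<Sum>k\<in>{k. k \<in> ?B \<and> k \<le> m}. c m k *\<^sub>R X k)" by simp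
  \<comment> \<open>\<open>X k\<close> is free of m because the two shifts compose to p - k. After
    the interchange only scalars are summed over m, and they expand (1 - 1)^(p - k).\<close>
  also have "\<dots> = (\<Sum>k\<in>?B. \<Sum>m\<in>{m. m \<in> ?B \<and> k \<le> m}. c m k *\<^sub>R X k)"
    by (rule sum.swap_restrict) (rule finite_multi_atMost)+
  also have "\<dots> = (\<Sum>k\<in>?B. (if k = p then w p x else 0))"
  proof (intro sum.cong refl)
    fix k assume k: "k \<in> ?B"
    have "(\<Sum>m\<in>{m. m \<in> ?B \<and> k \<le> m}. c m k) = (\<Sum>m | k \<le> m \<and> m \<le> p. (mfact p / (mfact k * mfact (msub p k))) *
        ((- 1) ^ msize (msub m k) * (mfact (msub p k) / (mfact (msub p m) * mfact (msub m k)))))"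
      using mfact_pos[of "msub p k"] by (intro sum.cong) (auto simp: c_def)
    also have "\<dots> = (if k = p then 1 else 0)"
    proof -
      have "mfact (msub p p) = 1" by (simp add: msub_def mfact_def)
      then show ?thesis
        unfolding sum_distrib_left[symmetric] alternating_multi_sum[OF k[simplified]]
        using mfact_pos[of p] by simp
    qed
    finally show "(\<Sum>m\<in>{m. m \<in> ?B \<and> k \<le> m}. c m k *\<^sub>R X k) = (if k = p then w p x else 0)"
      by (simp add: scaleR_sum_left[symmetric] X_def msub_def shift_zero[OF w])
  qed
  also have "\<dots> = w p x" by (simp add: finite_multi_atMost)
  finally show ?thesis .
qed

text \<open>The equations are triangular: at p, the coefficient of index p enters with factor p!,
  and all others have smaller size.\<close>

lemma op_apply_fueter_determines:
  fixes u v :: "'n::{finite,linorder} multi \<Rightarrow> 'n clfun"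
  assumes u: "\<And>m. u m \<in> monogenic" and v: "\<And>m. v m \<in> monogenic"
    and eq: "\<And>p. op_apply u (fueter p) = op_apply v (fueter p)"
  shows "u = v"
proof
  fix p
  show "u p = v p"
  proof (induction "msize p" arbitrary: p rule: less_induct)
    case less
    show ?case
    proof
      fix x
      let ?t = "\<lambda>u m. (mfact p / mfact (msub p m)) *\<^sub>R shift (msub p m) (u m) x"
      have "(\<Sum>m | m \<le> p. ?t u m) = (\<Sum>m | m \<le> p. ?t v m)"
        using eq[of p] unfolding op_apply_fueter[symmetric] by simp
      moreover have "(\<Sum>m | m \<le> p. ?t w m) = ?t w p + (\<Sum>m\<in>{m. m \<le> p} - {p}. ?t w m)"
        for w :: "'n multi \<Rightarrow> 'n clfun"
        by (rule sum.remove[OF finite_multi_atMost]) simp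
      moreover have "(\<Sum>m\<in>{m. m \<le> p} - {p}. ?t u m) = (\<Sum>m\<in>{m. m \<le> p} - {p}. ?t v m)"
      proof (intro sum.cong refl)
        fix m assume m: "m \<in> {m. m \<le> p} - {p}"
        then obtain i where "m i < p i" by (auto simp: le_fun_def fun_eq_iff) (metis le_neq_implies_less)
        then have "msize m < msize p"
          using m unfolding msize_def by (intro sum_strict_mono_ex1) (auto simp: le_fun_def)
        then show "?t u m = ?t v m" using less by simp
      qed
      ultimately have "?t u p = ?t v p" by simp
      moreover have "msub p p = (\<lambda>i. 0)" by (simp add: msub_def)
      ultimately show "u p x = v p x"
        using mfact_pos[of p] by (simp add: shift_zero u v mfact_def)
    qed
  qed
qed

context proximate_pair
begin

text \<open>Each summand pairs a monomial of size |m - k| with the image of one of size |k|. Both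
  bring a value of G, and supermultiplicativity merges the two into G at |m|.\<close>

lemma symbol_growth:
  fixes F :: "'n::{finite,linorder} clfun \<Rightarrow> 'n clfun"
  assumes F: "continuous_hom \<rho>1 \<rho>2 F" and \<sigma>: "\<sigma> > 0"
  shows "\<exists>L>0. \<exists>C>0. \<forall>m. growth_bound \<rho>2 \<sigma> (symbol (\<lambda>k. F (fueter k)) m)
    (C * (G_seq \<rho>1' ord1 (msize m) / mfact m) * L ^ msize m)"
proof -
  let ?G = "\<lambda>q. G_seq \<rho>1' ord1 q"
  have Gpos: "?G q > 0" for q by (rule G_seq_pos[OF norm1 pos1])
  let ?w = "\<lambda>k. F (fueter k)"
  have "continuous_map (growth_min_topology \<rho>1) (growth_min_topology \<rho>2) F" using F by (simp add: continuous_hom_def)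
  then have "F f \<in> growth_min \<rho>2" if "f \<in> growth_min \<rho>1" for f
    using that unfolding continuous_map_def topspace_growth_min_topology by blast
  then have w: "?w k \<in> monogenic" for k using growth_min_monogenic fueter_growth_min by blast
  obtain A where A: "A \<ge> 1" and shift: "\<forall>w\<in>monogenic. \<forall>j. \<forall>x :: 'n paravec.
    norm (shift j w x) \<le> (A * norm x) ^ msize j * majorant w (A * norm x)"
    using shift_norm by blast
  obtain \<sigma>u K1 where 1: "\<sigma>u > 0" "K1 > 0" "\<forall>(f :: 'n clfun)\<in>monogenic. \<forall>B. growth_bound \<rho>2 \<sigma>u f B \<longrightarrow>
    (\<forall>r\<ge>0. \<forall>m. (A * r) ^ msize m * norm (taylor_coeff f m) \<le> K1 * B * exp (\<sigma> / 2 * weight \<rho>2 r) * geo m)"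
    using majorant_growth[OF po2 pos2, of "\<sigma> / 2" A] \<sigma> A by auto
  obtain \<sigma>F KF where KF: "\<sigma>F > 0" "KF > 0" "\<forall>f\<in>growth_min \<rho>1. \<forall>B. growth_bound \<rho>1 \<sigma>F f B \<longrightarrow> growth_bound \<rho>2 \<sigma>u (F f) (KF * B)"
    using continuous_hom_estimate[OF F 1(1)] by blast
  obtain \<mu>1 C1 where C1: "\<mu>1 > 0" "C1 > 0"
    "\<And>m :: 'n multi. growth_bound \<rho>1 \<sigma>F (fueter m) (C1 * \<mu>1 ^ msize m * ?G (msize m))"
    using fueter_growth[OF KF(1)] by blast
  obtain \<tau> E where E: "\<tau> > 0" "E > 0" "\<And>r. r \<ge> 0 \<Longrightarrow> exp (\<tau> * weight \<rho>1 r) \<le> E * exp (\<sigma> / 2 * weight \<rho>2 r)"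
    using exp_weight_dominated[of "\<sigma> / 2"] \<sigma> by auto
  obtain \<mu>2 C2 where C2: "\<mu>2 > 0" "C2 > 0"
    "\<And>q r. r \<ge> 0 \<Longrightarrow> r ^ q \<le> C2 * \<mu>2 ^ q * ?G q * exp (\<tau> * weight \<rho>1 r)"
    using G_seq_upper[OF po1 norm1 pos1 E(1)] by blast
  define \<mu> where "\<mu> = max \<mu>1 (A * \<mu>2)"
  have \<mu>: "\<mu> > 0" "\<mu>1 \<le> \<mu>" "A * \<mu>2 \<le> \<mu>" using C1(1) by (auto simp: \<mu>_def)
  define C where "C = (C2 * E) * (2 * K1 * KF * C1)"
  have C: "C > 0" using C2(2) E(2) 1(2) KF(2) C1(2) by (simp add: C_def)
  \<comment> \<open>Half of \<sigma> pays for the power of |x| from the monomial, first in the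
    weight of \<rho>1 and then transferred to \<rho>2; the other half pays for the Taylor
    coefficients of the image.\<close>
  have sh: "norm (shift j (?w k) x) \<le> C * \<mu> ^ (msize j + msize k) * ?G (msize j + msize k) * exp (\<sigma> * weight \<rho>2 (norm x))"
    for j k and x :: "'n paravec"
  proof -
    let ?r = "norm x" and ?p = "msize j" and ?q = "msize k"
    let ?e = "exp (\<sigma> / 2 * weight \<rho>2 ?r)"
    have Ar: "A * ?r \<ge> 0" using A by simp
    have wb: "growth_bound \<rho>2 \<sigma>u (?w k) (KF * (C1 * \<mu>1 ^ ?q * ?G ?q))"
      using KF(3) fueter_growth_min C1(3) by blast
    have m1: "majorant (?w k) (A * ?r) \<le> 2 * (K1 * (KF * (C1 * \<mu>1 ^ ?q * ?G ?q)) * ?e)"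
      by (rule majorant_le[OF Ar 1(3)[rule_format, OF w wb norm_ge_zero]])
    have "?r ^ ?p \<le> C2 * \<mu>2 ^ ?p * ?G ?p * exp (\<tau> * weight \<rho>1 ?r)" by (rule C2(3)) simp
    also have "\<dots> \<le> C2 * \<mu>2 ^ ?p * ?G ?p * (E * ?e)"
      using C2(1,2) Gpos[of ?p] E(3)[of ?r] by (intro mult_left_mono) auto
    finally have m2: "(A * ?r) ^ ?p \<le> A ^ ?p * (C2 * \<mu>2 ^ ?p * ?G ?p * (E * ?e))"
      using A by (simp add: power_mult_distrib mult_left_mono)
    have "norm (shift j (?w k) x) \<le> (A * ?r) ^ ?p * majorant (?w k) (A * ?r)" using shift w by blast
    also have "\<dots> \<le> (A ^ ?p * (C2 * \<mu>2 ^ ?p * ?G ?p * (E * ?e))) * (2 * (K1 * (KF * (C1 * \<mu>1 ^ ?q * ?G ?q)) * ?e))"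
      using A C2(1,2) Gpos[of ?p] E(2) by (intro mult_mono m1 m2 majorant_nonneg Ar) auto
    also have "\<dots> = C * ((A * \<mu>2) ^ ?p * \<mu>1 ^ ?q) * (?G ?p * ?G ?q) * (?e * ?e)"
      by (simp add: C_def power_mult_distrib)
    also have "\<dots> \<le> C * (\<mu> ^ ?p * \<mu> ^ ?q) * ?G (?p + ?q) * (?e * ?e)"
      using C \<mu> C1(1) C2(1) A Gpos[of ?p] Gpos[of ?q]
      by (intro mult_right_mono mult_mono mult_left_mono power_mono G_seq_supermult[OF norm1 pos1]) auto
    also have "?e * ?e = exp (\<sigma> * weight \<rho>2 ?r)" by (simp flip: exp_add)
    finally show ?thesis by (simp add: power_add mult.assoc)
  qed
  have "growth_bound \<rho>2 \<sigma> (symbol ?w m) (C * (?G (msize m) / mfact m) * (4 * \<mu>) ^ msize m)" for m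
  proof (rule growth_boundI)
    fix x :: "'n paravec"
    let ?q = "msize m"
    \<comment> \<open>One power of 2 bounds m!/(k! (m - k)!) and a second one, below, the number of
      k \<le> m; hence the ratio \<open>4 * \<mu>\<close>.\<close>
    let ?b = "2 ^ ?q / mfact m * (C * \<mu> ^ ?q * ?G ?q * exp (\<sigma> * weight \<rho>2 (norm x)))"
    have b: "norm (((- 1) ^ msize (msub m k) / (mfact k * mfact (msub m k))) *\<^sub>R shift (msub m k) (?w k) x) \<le> ?b"
      if k: "k \<le> m" for k
    proof -
      have "madd (msub m k) k = m" using k by (auto simp: madd_def msub_def le_fun_def fun_eq_iff)
      then have s: "msize (msub m k) + msize k = ?q" and f: "mfact m \<le> 2 ^ ?q * mfact (msub m k) * mfact k"
        using mfact_madd_le[of "msub m k" k] msize_madd[of "msub m k" k] by auto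
      have "norm (((- 1) ^ msize (msub m k) / (mfact k * mfact (msub m k))) *\<^sub>R shift (msub m k) (?w k) x) =
          1 / (mfact k * mfact (msub m k)) * norm (shift (msub m k) (?w k) x)"
        using mfact_pos[of k] mfact_pos[of "msub m k"] by (simp add: power_abs)
      also have "\<dots> \<le> 2 ^ ?q / mfact m * (C * \<mu> ^ ?q * ?G ?q * exp (\<sigma> * weight \<rho>2 (norm x)))"
        using f mfact_pos[of k] mfact_pos[of "msub m k"] mfact_pos[of m] sh[of "msub m k" k x] unfolding s
        by (intro mult_mono) (auto simp: field_simps)
      finally show ?thesis .
    qed
    have "norm (symbol ?w m x) \<le> real (card {k. k \<le> m}) * ?b"
      unfolding symbol_def by (rule sum_norm_bound) (use b in auto)
    also have "\<dots> \<le> 2 ^ ?q * ?b"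
    proof (rule mult_right_mono)
      show "real (card {k. k \<le> m}) \<le> 2 ^ ?q" using of_nat_mono[OF card_multi_atMost[of m], where 'a = real] by simp
      show "0 \<le> ?b" using mfact_pos[of m] C \<mu>(1) Gpos[of ?q] by simp
    qed
    also have "\<dots> = C * (?G ?q / mfact m) * ((2 * 2) * \<mu>) ^ ?q * exp (\<sigma> * weight \<rho>2 (norm x))"
      unfolding power_mult_distrib by simp
    finally show "norm (symbol ?w m x) \<le> C * (?G ?q / mfact m) * (4 * \<mu>) ^ ?q * exp (\<sigma> * weight \<rho>2 (norm x))"
      by simp
  qed
  then show ?thesis using C \<mu>(1) by (intro exI[of _ "4 * \<mu>"] exI[of _ C]) auto
qed

text \<open>Once \<open>u\<close> is known to be admissible, \<open>op_apply u\<close> is itself a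
  continuous homomorphism. It agrees with F on Fueter polynomials by inversion, so both values at
  \<open>f\<close> are sums of the same series.\<close>

lemma continuous_hom_symbol:
  fixes F :: "'n::{finite,linorder} clfun \<Rightarrow> 'n clfun"
  assumes F: "continuous_hom \<rho>1 \<rho>2 F"
  defines "u \<equiv> symbol (\<lambda>k. F (fueter k))"
  shows "u \<in> diff_ops \<rho>1' ord1 \<rho>2" and "f \<in> growth_min \<rho>1 \<Longrightarrow> F f = op_apply u f"
proof -
  have "continuous_map (growth_min_topology \<rho>1) (growth_min_topology \<rho>2) F" using F by (simp add: continuous_hom_def)
  then have "F f \<in> growth_min \<rho>2" if "f \<in> growth_min \<rho>1" for f
    using that unfolding continuous_map_def topspace_growth_min_topology by blast
  then have w: "F (fueter k) \<in> monogenic" for k using growth_min_monogenic fueter_growth_min by blast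
  have um: "u m \<in> monogenic" for m unfolding u_def by (rule monogenic_symbol[OF w])
  have "\<exists>B. growth_bound \<rho>2 1 (u m) B" for m using symbol_growth[OF F, of 1] unfolding u_def by auto
  then have "u m \<in> growth_space \<rho>2 1" for m
    using um by (simp add: growth_space_def growth_norm_finite_iff del: ereal_infty_less)
  then have "u m \<in> growth_union \<rho>2" for m unfolding growth_union_def using zero_less_one by blast
  then show u: "u \<in> diff_ops \<rho>1' ord1 \<rho>2"
    using symbol_growth[OF F] unfolding diff_ops_def growth_norm_le_iff u_def by blast
  show "F f = op_apply u f" if f: "f \<in> growth_min \<rho>1"
  proof
    fix x
    have "op_apply u (fueter m) x = F (fueter m) x" for m
      unfolding op_apply_fueter u_def by (rule symbol_inversion[OF w])
    then have "((\<lambda>m. F (fueter m) x \<star> taylor_coeff f m) has_sum op_apply u f x) UNIV"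
      using continuous_hom_fueter_series[OF op_apply_continuous_hom[OF u] f, of x] by simp
    then show "F f x = op_apply u f x"
      by (rule has_sum_unique[OF continuous_hom_fueter_series[OF F f]])
  qed
qed

text \<open>Fueter polynomials belong to the space, and agreement on them already forces equality of
  the coefficients.\<close>

lemma diff_ops_eqI:
  fixes u v :: "'n::{finite,linorder} multi \<Rightarrow> 'n clfun"
  assumes u: "u \<in> diff_ops \<rho>1' ord1 \<rho>2" and v: "v \<in> diff_ops \<rho>1' ord1 \<rho>2"
    and eq: "\<And>f. f \<in> growth_min \<rho>1 \<Longrightarrow> op_apply u f = op_apply v f"
  shows "u = v"
proof (rule op_apply_fueter_determines)
  show "u m \<in> monogenic" "v m \<in> monogenic" for m
    using u v unfolding diff_ops_def by (auto intro: growth_union_monogenic)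
qed (rule eq[OF fueter_growth_min])

end

theorem theorem4p5:
  fixes \<rho>1 \<rho>2 \<rho>1' :: "real \<Rightarrow> real" and ord1 ord2 :: real
  assumes "ord1 > 0" and "ord2 > 0"
    and "proximate_order \<rho>1 ord1" and "proximate_order \<rho>2 ord2"
    and "normalization \<rho>1' \<rho>1 ord1"
    and "(\<lambda>r. r powr \<rho>1 r) \<in> O[at_top](\<lambda>r. r powr \<rho>2 r)"
  shows "(\<forall>u \<in> (diff_ops \<rho>1' ord1 \<rho>2 ::
              ('n::{finite,linorder} multi \<Rightarrow> 'n paravec \<Rightarrow> 'n clifford) set).
            (\<forall>f \<in> growth_min \<rho>1.
               limitin (growth_min_topology \<rho>2) (\<lambda>M x. \<Sum>m\<in>M. op_term u f m x) (op_apply u f)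
                 (finite_subsets_at_top UNIV) \<and>
               op_apply u f \<in> growth_min \<rho>2) \<and>
            continuous_hom \<rho>1 \<rho>2 (op_apply u)) \<and>
         (\<forall>F :: ('n paravec \<Rightarrow> 'n clifford) \<Rightarrow> 'n paravec \<Rightarrow> 'n clifford.
            continuous_hom \<rho>1 \<rho>2 F \<longrightarrow>
            (\<exists>!u. u \<in> diff_ops \<rho>1' ord1 \<rho>2 \<and> (\<forall>f \<in> growth_min \<rho>1. F f = op_apply u f)))"
proof -
  interpret proximate_pair \<rho>1 \<rho>2 \<rho>1' ord1 ord2
    by unfold_locales (rule assms)+
  show ?thesis
  proof (intro conjI ballI allI impI)
    fix u :: "'n multi \<Rightarrow> 'n paravec \<Rightarrow> 'n clifford" assume u: "u \<in> diff_ops \<rho>1' ord1 \<rho>2"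
    show "continuous_hom \<rho>1 \<rho>2 (op_apply u)" by (rule op_apply_continuous_hom[OF u])
    fix f :: "'n paravec \<Rightarrow> 'n clifford" assume f: "f \<in> growth_min \<rho>1"
    show "limitin (growth_min_topology \<rho>2) (\<lambda>M x. \<Sum>m\<in>M. op_term u f m x) (op_apply u f) (finite_subsets_at_top UNIV)"
      by (rule op_apply_limit(2)[OF u f])
    show "op_apply u f \<in> growth_min \<rho>2" by (rule op_apply_limit(1)[OF u f])
  next
    fix F :: "('n paravec \<Rightarrow> 'n clifford) \<Rightarrow> 'n paravec \<Rightarrow> 'n clifford" assume F: "continuous_hom \<rho>1 \<rho>2 F"
    show "\<exists>!u. u \<in> diff_ops \<rho>1' ord1 \<rho>2 \<and> (\<forall>f \<in> growth_min \<rho>1. F f = op_apply u f)"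
    proof (rule ex1I[of _ "symbol (\<lambda>k. F (fueter k))"])
      show *: "symbol (\<lambda>k. F (fueter k)) \<in> diff_ops \<rho>1' ord1 \<rho>2 \<and>
          (\<forall>f \<in> growth_min \<rho>1. F f = op_apply (symbol (\<lambda>k. F (fueter k))) f)"
        using continuous_hom_symbol[OF F] by blast
      fix v assume v: "v \<in> diff_ops \<rho>1' ord1 \<rho>2 \<and> (\<forall>f \<in> growth_min \<rho>1. F f = op_apply v f)"
      show "v = symbol (\<lambda>k. F (fueter k))"
        by (rule diff_ops_eqI) (use * v in auto)
    qed
  qed
qed

end
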